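(* Let $G=F_4$ be the simply connected compact Lie group of type $F_4$, let $m$ be a positive integer and $p$ a prime. Write $m=p^i m'$ with $p\nmid m'$. (1) If $p=2$, then $N(F_4,m,2)$ is the number of tuples $(b_1,b_2,b_3,b_4)\in\mathbb{Z}^4\cup(\mathbb{Z}+\frac12)^4$ such that $$b_2>b_3>b_4>0,\quad b_1>b_2+b_3+b_4,\quad p^i>b_1+b_2.$$ (2) If $p>2$, then $N(F_4,m,p)$ is the number of tuples $(b_1,b_2,b_3,b_4)\in\mathbb{Z}^4$ such that $$b_2>b_3>b_4>0,\quad b_1>b_2+b_3+b_4,\quad p^i>b_1+b_2,\quad 2\mid(b_1+b_2+b_3+b_4).$$
   Context: Let $G$ be a simply connected simple compact Lie group with maximal torus $T$ and weight lattice $\Pi^*=\mathrm{Hom}(T,S^1)$. $\langle\cdot,\cdot\rangle$ is the unique Weyl-invariant inner product on $\Pi^*$ (extended to $\Pi^*\otimes\mathbb{R}$) with $\langle u,u\rangle=2$ for all long roots $u$ (in the simply laced case all roots are long). The fundamental Weyl chamber $V\subset\Pi^*\otimes\mathbb{R}$ is the set of points having non-negative inner product with all positive roots; $\theta$ is the highest root. The level $m$ fundamental alcove is $A=\{x\in V:\langle\theta,x\rangle\le m\}$. A level $m$ regular weight is an element of $\Pi^*$ in the interior of $A$. $N(G,m,p)$ denotes the number of level $m$ regular weights $a$ such that for every weight $w\in\Pi^*$ the denominator (in lowest terms) of the rational number $\langle w,a\rangle/m$ is a power $p^k$, $k\ge0$, of $p$. *)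

theory Defs
  imports "HOL-Analysis.Analysis" "HOL-Computational_Algebra.Primes"
begin

section \<open>Compact Lie groups, maximal tori and characters\<close>

text \<open>Every compact Lie group has a faithful orthogonal representation, and a closed subgroup
  of an orthogonal group is a compact Lie group; hence compact Lie groups are taken to be compact
  groups of orthogonal matrices. The inverse of \<open>g\<close> is \<open>transpose g\<close>.\<close>

definition compact_lie_group :: "(real^'n^'n) set \<Rightarrow> bool" where
  "compact_lie_group G \<longleftrightarrow>
     compact G \<and> mat 1 \<in> G \<and>
     (\<forall>g\<in>G. orthogonal_matrix g \<and> transpose g \<in> G) \<and>
     (\<forall>g\<in>G. \<forall>h\<in>G. g ** h \<in> G)"

text \<open>The tangent space at the identity.\<close>

definition lie_algebra :: "(real^'n^'n) set \<Rightarrow> (real^'n^'n) set" where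
  "lie_algebra G =
     {X. \<exists>\<gamma>::real \<Rightarrow> real^'n^'n.
        (\<forall>s. \<gamma> s \<in> G) \<and> \<gamma> 0 = mat 1 \<and> (\<gamma> has_vector_derivative X) (at 0)}"

definition lie_bracket :: "real^'n^'n \<Rightarrow> real^'n^'n \<Rightarrow> real^'n^'n" where
  "lie_bracket X Y = X ** Y - Y ** X"

text \<open>Simplicity in the sense of Lie groups: connected, with simple (in particular non-abelian)
  Lie algebra; a finite centre is allowed.\<close>

definition simple_lie_group :: "(real^'n^'n) set \<Rightarrow> bool" where
  "simple_lie_group G \<longleftrightarrow>
     connected G \<and>
     (\<exists>X\<in>lie_algebra G. \<exists>Y\<in>lie_algebra G. lie_bracket X Y \<noteq> 0) \<and>
     (\<forall>I. subspace I \<and> I \<subseteq> lie_algebra G \<and>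
          (\<forall>X\<in>lie_algebra G. \<forall>Y\<in>I. lie_bracket X Y \<in> I) \<longrightarrow>
          I = {0} \<or> I = lie_algebra G)"

definition torus :: "(real^'n^'n) set \<Rightarrow> bool" where
  "torus T \<longleftrightarrow> compact_lie_group T \<and> connected T \<and> (\<forall>s\<in>T. \<forall>t\<in>T. s ** t = t ** s)"

definition maximal_torus :: "(real^'n^'n) set \<Rightarrow> (real^'n^'n) set \<Rightarrow> bool" where
  "maximal_torus G T \<longleftrightarrow>
     torus T \<and> T \<subseteq> G \<and> (\<forall>S. torus S \<and> T \<subseteq> S \<and> S \<subseteq> G \<longrightarrow> S = T)"

text \<open>The weight lattice \<open>Hom(T, S\<^sup>1)\<close>; the group operation is pointwise multiplication.
  Values outside \<open>T\<close> are normalised to 1, so that equality of functions is equality of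
  characters.\<close>

definition characters :: "(real^'n^'n) set \<Rightarrow> (real^'n^'n \<Rightarrow> complex) set" where
  "characters T =
     {\<phi>. continuous_on T \<phi> \<and> (\<forall>t\<in>T. cmod (\<phi> t) = 1) \<and>
         (\<forall>s\<in>T. \<forall>t\<in>T. \<phi> (s ** t) = \<phi> s * \<phi> t) \<and> (\<forall>t. t \<notin> T \<longrightarrow> \<phi> t = 1)}"

text \<open>The roots are the nontrivial characters \<open>\<phi>\<close> of \<open>T\<close> for which some nonzero
  \<open>X + \<i>Y\<close> in the complexified Lie algebra satisfies \<open>Ad(t)(X + \<i>Y) = \<phi>(t)(X + \<i>Y)\<close>
  for all \<open>t\<close> in \<open>T\<close>; the two equations are the real and imaginary parts.\<close>

definition roots :: "(real^'n^'n) set \<Rightarrow> (real^'n^'n) set \<Rightarrow> (real^'n^'n \<Rightarrow> complex) set" where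
  "roots G T =
     {\<phi> \<in> characters T. \<phi> \<noteq> (\<lambda>t. 1) \<and>
        (\<exists>X\<in>lie_algebra G. \<exists>Y\<in>lie_algebra G. (X \<noteq> 0 \<or> Y \<noteq> 0) \<and>
          (\<forall>t\<in>T. t ** X ** transpose t = Re (\<phi> t) *\<^sub>R X - Im (\<phi> t) *\<^sub>R Y \<and>
                 t ** Y ** transpose t = Im (\<phi> t) *\<^sub>R X + Re (\<phi> t) *\<^sub>R Y))}"

text \<open>The Weyl group is \<open>N(T)/T\<close>; only the action of its representatives on characters is
  needed.\<close>

definition normalizer :: "(real^'n^'n) set \<Rightarrow> (real^'n^'n) set \<Rightarrow> (real^'n^'n) set" where
  "normalizer G T = {n \<in> G. (\<lambda>t. n ** t ** transpose n) ` T = T}"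

definition weyl_act :: "real^'n^'n \<Rightarrow> (real^'n^'n \<Rightarrow> complex) \<Rightarrow> (real^'n^'n \<Rightarrow> complex)" where
  "weyl_act n \<phi> = (\<lambda>t. \<phi> (transpose n ** t ** n))"

section \<open>The Euclidean space spanned by the weight lattice\<close>

text \<open>The real span of the weight lattice, with its inner product, is a Euclidean space
  \<open>'e\<close> together with an isomorphism \<open>\<iota>\<close> from the character group onto a full lattice in
  \<open>'e\<close>, i.e. onto the integral span of a basis of \<open>'e\<close>.\<close>

definition real_extension ::
  "(real^'n^'n) set \<Rightarrow> ((real^'n^'n \<Rightarrow> complex) \<Rightarrow> 'e::euclidean_space) \<Rightarrow> bool" where
  "real_extension T \<iota> \<longleftrightarrow>
     (\<forall>\<phi>\<in>characters T. \<forall>\<psi>\<in>characters T. \<iota> (\<lambda>t. \<phi> t * \<psi> t) = \<iota> \<phi> + \<iota> \<psi>) \<and>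
     inj_on \<iota> (characters T) \<and>
     (\<exists>B. independent B \<and> span B = UNIV \<and>
          \<iota> ` characters T = {\<Sum>b\<in>B. real_of_int (c b) *\<^sub>R b | c. True})"

definition normalized_inner ::
  "(real^'n^'n) set \<Rightarrow> (real^'n^'n) set \<Rightarrow>
   ((real^'n^'n \<Rightarrow> complex) \<Rightarrow> 'e::euclidean_space) \<Rightarrow> bool" where
  "normalized_inner G T \<iota> \<longleftrightarrow>
     (\<forall>n\<in>normalizer G T. \<forall>\<phi>\<in>characters T. \<forall>\<psi>\<in>characters T.
        \<iota> (weyl_act n \<phi>) \<bullet> \<iota> (weyl_act n \<psi>) = \<iota> \<phi> \<bullet> \<iota> \<psi>) \<and>
     (\<forall>u\<in>roots G T. (\<forall>v\<in>roots G T. \<iota> v \<bullet> \<iota> v \<le> \<iota> u \<bullet> \<iota> u) \<longrightarrow> \<iota> u \<bullet> \<iota> u = 2)"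

section \<open>Root systems, alcoves and the counting function\<close>

definition positive_system :: "'e::euclidean_space set \<Rightarrow> 'e set \<Rightarrow> bool" where
  "positive_system \<Phi> P \<longleftrightarrow> (\<exists>v. (\<forall>\<alpha>\<in>\<Phi>. v \<bullet> \<alpha> \<noteq> 0) \<and> P = {\<alpha>\<in>\<Phi>. v \<bullet> \<alpha> > 0})"

definition highest_root :: "'e::euclidean_space set \<Rightarrow> 'e set \<Rightarrow> 'e" where
  "highest_root \<Phi> P =
     (THE \<theta>. \<theta> \<in> \<Phi> \<and> (\<forall>\<beta>\<in>\<Phi>. \<exists>c::'e \<Rightarrow> nat. \<theta> - \<beta> = (\<Sum>\<alpha>\<in>P. real (c \<alpha>) *\<^sub>R \<alpha>)))"

definition weyl_chamber :: "'e::euclidean_space set \<Rightarrow> 'e set" where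
  "weyl_chamber P = {x. \<forall>\<alpha>\<in>P. \<alpha> \<bullet> x \<ge> 0}"

definition alcove :: "'e::euclidean_space set \<Rightarrow> 'e set \<Rightarrow> nat \<Rightarrow> 'e set" where
  "alcove \<Phi> P m = {x \<in> weyl_chamber P. highest_root \<Phi> P \<bullet> x \<le> real m}"

definition regular_weights ::
  "(real^'n^'n) set \<Rightarrow> (real^'n^'n) set \<Rightarrow>
   ((real^'n^'n \<Rightarrow> complex) \<Rightarrow> 'e::euclidean_space) \<Rightarrow> 'e set \<Rightarrow> nat \<Rightarrow> 'e set" where
  "regular_weights G T \<iota> P m =
     \<iota> ` characters T \<inter> interior (alcove (\<iota> ` roots G T) P m)"

text \<open>The denominator in lowest terms of the real number \<open>x\<close> (which has to be rational) is a
  power of \<open>p\<close>.\<close>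

definition denominator_power_of :: "nat \<Rightarrow> real \<Rightarrow> bool" where
  "denominator_power_of p x \<longleftrightarrow>
     (\<exists>r::rat. x = of_rat r \<and> (\<exists>k::nat. snd (quotient_of r) = int p ^ k))"

text \<open>\<open>N(G,m,p)\<close>, computed with the maximal torus \<open>T\<close>, the Euclidean space given by
  \<open>\<iota>\<close> and the set \<open>P\<close> of positive roots.\<close>

definition weight_count ::
  "(real^'n^'n) set \<Rightarrow> (real^'n^'n) set \<Rightarrow>
   ((real^'n^'n \<Rightarrow> complex) \<Rightarrow> 'e::euclidean_space) \<Rightarrow> 'e set \<Rightarrow> nat \<Rightarrow> nat \<Rightarrow> nat" where
  "weight_count G T \<iota> P m p =
     card {a \<in> regular_weights G T \<iota> P m.
             \<forall>w\<in>\<iota> ` characters T. denominator_power_of p ((w \<bullet> a) / real m)}"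

section \<open>Type $F_4$\<close>

text \<open>The root system $F_4$: the vectors \<open>\<plusminus>e\<^sub>i\<close>, \<open>\<plusminus>e\<^sub>i \<plusminus> e\<^sub>j\<close> (\<open>i \<noteq> j\<close>) and
  \<open>(\<plusminus>e\<^sub>1 \<plusminus> e\<^sub>2 \<plusminus> e\<^sub>3 \<plusminus> e\<^sub>4)/2\<close>.\<close>

definition F4_roots :: "(real^4) set" where
  "F4_roots =
     {x. (\<forall>i. x $ i \<in> \<int>) \<and> (x \<bullet> x = 1 \<or> x \<bullet> x = 2)} \<union> {x. \<forall>i. \<bar>x $ i\<bar> = 1/2}"

text \<open>Isomorphism of root systems: a linear bijection matching the roots and preserving the
  Cartan integers.\<close>

definition type_F4 :: "'e::euclidean_space set \<Rightarrow> bool" where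
  "type_F4 \<Phi> \<longleftrightarrow>
     (\<exists>f::'e \<Rightarrow> real^4. linear f \<and> bij f \<and> f ` \<Phi> = F4_roots \<and>
        (\<forall>\<alpha>\<in>\<Phi>. \<forall>\<beta>\<in>\<Phi>. 2 * (f \<alpha> \<bullet> f \<beta>) / (f \<beta> \<bullet> f \<beta>) = 2 * (\<alpha> \<bullet> \<beta>) / (\<beta> \<bullet> \<beta>)))"

end

theory Submission
  imports Defs
begin

text \<open>Once the weight lattice is known to equal the root lattice of $F_4$, in suitable coordinates
  \<open>\<int>\<^sup>4 \<union> (\<int> + 1/2)\<^sup>4\<close>, the count is arithmetic: the weights in question are
  the multiples \<open>m' b\<close> with \<open>b\<close> in this lattice if \<open>p = 2\<close>, and in its dual, the integer
  vectors with even coordinate sum, if \<open>p\<close> is odd; the two lattices differ only at the prime 2.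

  The Lie-theoretic point is the integrality of \<open>2\<langle>\<psi>, \<phi>\<rangle> / \<langle>\<phi>, \<phi>\<rangle>\<close> for a weight
  \<open>\<psi>\<close> and a root \<open>\<phi>\<close>. A root vector \<open>X + \<i>Y\<close> generates, after rescaling, a copy of $su(2)$ with
  \<open>[X, Y] = Z\<close>, \<open>[Y, Z] = X\<close>, \<open>[Z, X] = Y\<close> and \<open>exp (s Z)\<close> in the maximal torus. Then
  \<open>exp (4 \<pi> Z) = 1\<close>, so that \<open>\<psi>\<close> takes the values \<open>exp (\<i> k s / 2)\<close>, \<open>k\<close> an integer, on
  \<open>exp (s Z)\<close>; and conjugation by \<open>exp (\<pi> X)\<close> maps \<open>\<psi>\<close> to \<open>\<psi> \<phi>\<^sup>k\<close>. Invariance of the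
  inner product under this element of the Weyl group identifies \<open>- k\<close> with the Cartan number.\<close>

section \<open>One-parameter subgroups in a Banach algebra\<close>

text \<open>Two sublattices enclose the weight lattice: it contains the roots, and its Cartan
  numbers against the roots are integers. For $F_4$ the two bounds agree, since the Cartan matrix
  has determinant 1, so integrality determines the lattice. The rescaling to $su(2)$ depends on a
  sign: a priori the root vectors and their bracket could span a Heisenberg algebra or $sl(2,R)$.
  The trace form excludes both; it is invariant, and negative definite on skew matrices. Pairings of
  weights lie in $Z/2$. That such a pairing divided by $m$ has a $p$-power denominator forces $m'$
  to divide it up to the factor 2. If $p$ is odd, no denominator 2 can survive, so pairings with all
  weights become integral, whence the dual lattice; for $p = 2$ the factor 1/2 is absorbed. The
  positive system is arbitrary while the inequalities of the theorem describe one chamber, so a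
  symmetry of $F_4$ has to be built into the coordinates.\<close>

lemma power_diff_norm_bound:
  fixes a b :: "'a::real_normed_algebra_1"
  assumes a: "\<And>j. norm (a ^ j) \<le> C" and b: "\<And>j. j \<le> k \<Longrightarrow> norm (b ^ j) \<le> D"
  shows "norm (a ^ k - b ^ k) \<le> real k * C * D * norm (a - b)"
proof -
  have C0: "C \<ge> 0" using a[of 0] by simp
  have D0: "D \<ge> 0" using b[of 0] by simp
  \<comment> \<open>Telescoping through the mixed products \<open>a ^ j * b ^ (k - j)\<close>: each
    step exchanges one factor \<open>b\<close> for \<open>a\<close>, so the estimate involves
    uniform bounds on powers and not powers of norms.\<close>
  have "j \<le> k \<Longrightarrow> norm ((a ^ j - b ^ j) * b ^ (k - j)) \<le> real j * C * D * norm (a - b)" for j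
  proof (induction j)
    case 0 then show ?case by simp
  next
    case (Suc j)
    have e: "b ^ (k - j) = b * b ^ (k - Suc j)"
      using Suc.prems by (metis Suc_diff_le Suc_le_lessD diff_Suc_Suc power_Suc)
    have "(a ^ Suc j - b ^ Suc j) * b ^ (k - Suc j)
        = a ^ j * (a - b) * b ^ (k - Suc j) + (a ^ j - b ^ j) * b ^ (k - j)"
      unfolding e power_Suc2 by (simp add: algebra_simps)
    moreover have "norm (a ^ j * (a - b) * b ^ (k - Suc j)) \<le> C * norm (a - b) * D"
    proof -
      have "norm (a ^ j * (a - b)) \<le> C * norm (a - b)"
        by (rule order_trans[OF norm_mult_ineq]) (simp add: a mult_right_mono)
      moreover have "norm (b ^ (k - Suc j)) \<le> D" using b by simp
      ultimately have "norm (a ^ j * (a - b)) * norm (b ^ (k - Suc j)) \<le> C * norm (a - b) * D"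
        using C0 by (intro mult_mono) auto
      then show ?thesis by (rule order_trans[OF norm_mult_ineq])
    qed
    moreover have "norm ((a ^ j - b ^ j) * b ^ (k - j)) \<le> real j * C * D * norm (a - b)"
      using Suc by simp
    ultimately have "norm ((a ^ Suc j - b ^ Suc j) * b ^ (k - Suc j))
        \<le> C * norm (a - b) * D + real j * C * D * norm (a - b)"
      using norm_triangle_mono by metis
    then show ?case by (simp add: algebra_simps)
  qed
  from this[of k] show ?thesis by simp
qed

lemma exp_scaleR_add:
  fixes X :: "'a::{real_normed_algebra_1,banach}"
  shows "exp ((s + t) *\<^sub>R X) = exp (s *\<^sub>R X) * exp (t *\<^sub>R X)"
  by (simp add: scaleR_add_left exp_add_commuting)

lemma exp_scaleR_power:
  fixes X :: "'a::{real_normed_algebra_1,banach}"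
  shows "exp (t *\<^sub>R X) ^ j = exp ((real j * t) *\<^sub>R X)"
proof (induction j)
  case (Suc j)
  have "real (Suc j) * t = t + real j * t" by (simp add: algebra_simps)
  then show ?case unfolding power_Suc Suc by (simp only: exp_scaleR_add)
qed simp

text \<open>\<open>exp (s X)\<close> is the limit of the group elements
  \<open>\<gamma> (s / (k + 1)) ^ (k + 1)\<close>. The curve agrees with \<open>exp (u X)\<close> up
  to o(u), and by \<open>power_diff_norm_bound\<close> the power multiplies this error only by a
  constant times \<open>k + 1\<close>.\<close>

lemma exp_mem_if_tangent:
  fixes G :: "'a::{real_normed_algebra_1,banach} set"
  assumes cl: "closed G" and bd: "bounded G" and one: "1 \<in> G"
    and mult: "\<And>x y. x \<in> G \<Longrightarrow> y \<in> G \<Longrightarrow> x * y \<in> G"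
    and \<gamma>: "\<And>s. \<gamma> s \<in> G" "\<gamma> 0 = 1" and der: "(\<gamma> has_vector_derivative X) (at (0::real))"
  shows "exp (s *\<^sub>R X) \<in> G"
proof -
  have pw: "x ^ j \<in> G" if "x \<in> G" for x j
    by (induction j) (use that one mult in auto)
  obtain C where C: "\<And>x. x \<in> G \<Longrightarrow> norm x \<le> C" using bd bounded_iff by blast
  define D where "D = exp (norm (s *\<^sub>R X))"
  define h where "h k = s / real (Suc k)" for k
  define a where "a k = \<gamma> (h k)" for k
  define b where "b k = exp (h k *\<^sub>R X)" for k
  \<comment> \<open>Powers of \<open>a k\<close> are bounded because they stay in the bounded set
    \<open>G\<close>; those of \<open>b k\<close> because the exponents up to \<open>Suc k\<close>
    keep the parameter between 0 and \<open>s\<close>.\<close>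
  have b_pow: "norm (b k ^ j) \<le> D" if "j \<le> Suc k" for j k
  proof -
    have "b k ^ j = exp ((real j * h k) *\<^sub>R X)"
      unfolding b_def by (rule exp_scaleR_power)
    moreover have "norm ((real j * h k) *\<^sub>R X) \<le> norm (s *\<^sub>R X)"
    proof -
      have "real j * \<bar>s\<bar> \<le> real (Suc k) * \<bar>s\<bar>"
        using that by (intro mult_right_mono) (simp_all del: of_nat_Suc)
      then have "real j * \<bar>h k\<bar> \<le> \<bar>s\<bar>"
        by (simp add: h_def abs_divide pos_divide_le_eq mult.commute del: of_nat_Suc)
      then show ?thesis by (simp add: abs_mult mult_right_mono)
    qed
    ultimately show ?thesis unfolding D_def
      using norm_exp[of "(real j * h k) *\<^sub>R X"] by (metis exp_le_cancel_iff order_trans)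
  qed
  have b_exp: "b k ^ Suc k = exp (s *\<^sub>R X)" for k
    unfolding b_def exp_scaleR_power by (simp add: h_def del: of_nat_Suc)
  have bound: "norm (a k ^ Suc k - exp (s *\<^sub>R X)) \<le> C * D * (real (Suc k) * norm (a k - b k))" for k
  proof -
    have "norm (a k ^ Suc k - b k ^ Suc k) \<le> real (Suc k) * C * D * norm (a k - b k)"
      by (intro power_diff_norm_bound b_pow C pw) (simp_all add: a_def \<gamma>)
    then show ?thesis unfolding b_exp by (simp only: mult_ac)
  qed
  have "((\<lambda>u. \<gamma> u - exp (u *\<^sub>R X)) has_vector_derivative X - X) (at 0)"
    using has_vector_derivative_diff[OF der exp_scaleR_has_vector_derivative_right[of X 0 UNIV]]
    by simp
  then have "((\<lambda>u. \<gamma> u - exp (u *\<^sub>R X)) has_derivative (\<lambda>x. 0)) (at 0)"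
    by (simp add: has_vector_derivative_def)
  then have lim: "((\<lambda>u. norm (\<gamma> u - exp (u *\<^sub>R X)) / \<bar>u\<bar>) \<longlongrightarrow> 0) (at 0)"
    by (simp add: has_derivative_at \<gamma>)
  have lim2: "(\<lambda>k. real (Suc k) * norm (a k - b k)) \<longlonglongrightarrow> 0"
  proof (cases "s = 0")
    case True then show ?thesis by (simp add: a_def b_def h_def \<gamma>)
  next
    case False
    have "filterlim h (at 0) sequentially"
      unfolding filterlim_at
    proof
      show "h \<longlonglongrightarrow> 0" unfolding h_def
        using LIMSEQ_Suc[OF lim_const_over_n[of s]] by simp
      show "\<forall>\<^sub>F x in sequentially. h x \<in> UNIV \<and> h x \<noteq> 0" using False by (simp add: h_def)
    qed
    from filterlim_compose[OF lim this]
    have "(\<lambda>k. \<bar>s\<bar> * (norm (a k - b k) / \<bar>h k\<bar>)) \<longlonglongrightarrow> \<bar>s\<bar> * 0"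
      unfolding a_def b_def by (rule tendsto_mult_left)
    moreover have "\<bar>s\<bar> * (norm (a k - b k) / \<bar>h k\<bar>) = real (Suc k) * norm (a k - b k)" for k
      using False by (simp add: h_def abs_divide del: of_nat_Suc)
    ultimately show ?thesis by simp
  qed
  have "(\<lambda>k. a k ^ Suc k - exp (s *\<^sub>R X)) \<longlonglongrightarrow> 0"
  proof (rule Lim_null_comparison)
    show "\<forall>\<^sub>F k in sequentially. norm (a k ^ Suc k - exp (s *\<^sub>R X)) \<le> C * D * (real (Suc k) * norm (a k - b k))"
      using bound by simp
    show "(\<lambda>k. C * D * (real (Suc k) * norm (a k - b k))) \<longlonglongrightarrow> 0"
      using tendsto_mult_left[OF lim2, of "C * D"] by simp
  qed
  then have "(\<lambda>k. a k ^ Suc k) \<longlonglongrightarrow> exp (s *\<^sub>R X)" by (rule LIM_zero_cancel)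
  moreover have "a k ^ Suc k \<in> G" for k unfolding a_def by (intro pw \<gamma>)
  ultimately show ?thesis by (rule closed_sequentially[OF cl, rotated])
qed

lemma exp_conjugate:
  fixes g h :: "'a::{real_normed_algebra_1,banach}"
  assumes "h * g = 1" and that: "g * h = 1"
  shows "exp (g * X * h) = g * exp X * h"
proof -
  have pw: "(g * X * h) ^ n = g * X ^ n * h" for n
  proof (induction n)
    case (Suc n)
    have "(g * X * h) ^ Suc n = g * X * h * (g * X ^ n * h)" by (simp add: Suc)
    also have "\<dots> = g * X * (h * g) * X ^ n * h" by (simp only: mult.assoc)
    finally have "(g * X * h) ^ Suc n = g * X * (h * g) * X ^ n * h" .
    then show ?case by (simp add: assms mult.assoc)
  qed (simp add: that)
  have "(\<lambda>n. g * (X ^ n /\<^sub>R fact n) * h) sums (g * exp X * h)"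
    by (intro sums_mult sums_mult2 exp_converges)
  then have "(\<lambda>n. (g * X * h) ^ n /\<^sub>R fact n) sums (g * exp X * h)"
    by (simp add: pw)
  then show ?thesis using exp_converges sums_unique2 by blast
qed

lemma exp_minus_inverse':
  fixes X :: "'a::{real_normed_algebra_1,banach}"
  shows "exp (- X) * exp X = 1"
  using exp_minus_inverse[of "- X"] by simp

lemma exp_commute:
  fixes X :: "'a::{real_normed_algebra_1,banach}"
  assumes "g * X = X * g"
  shows "g * exp X = exp X * g"
proof -
  have "g * X ^ n = X ^ n * g" for n
    by (rule power_commuting_commutes[symmetric]) (simp add: assms)
  then have "(\<lambda>n. g * (X ^ n /\<^sub>R fact n)) = (\<lambda>n. (X ^ n /\<^sub>R fact n) * g)" by simp
  moreover have "(\<lambda>n. g * (X ^ n /\<^sub>R fact n)) sums (g * exp X)"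
    by (intro sums_mult exp_converges)
  moreover have "(\<lambda>n. (X ^ n /\<^sub>R fact n) * g) sums (exp X * g)"
    by (intro sums_mult2 exp_converges)
  ultimately show ?thesis using sums_unique2 by metis
qed

text \<open>\<open>W\<close> solves the linear equation W' = [Z, W]. Conjugating \<open>W s\<close>
  back by \<open>exp (s Z)\<close> therefore gives a constant, the value \<open>X\<close> at
  0.\<close>

lemma exp_rotation:
  fixes X Y Z :: "'a::{real_normed_algebra_1,banach}"
  assumes ZX: "Z * X - X * Z = \<kappa> *\<^sub>R Y" and ZY: "Z * Y - Y * Z = - (\<kappa> *\<^sub>R X)"
  shows "exp (s *\<^sub>R Z) * X = (cos (\<kappa> * s) *\<^sub>R X + sin (\<kappa> * s) *\<^sub>R Y) * exp (s *\<^sub>R Z)"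
proof -
  define W where "W s = cos (\<kappa> * s) *\<^sub>R X + sin (\<kappa> * s) *\<^sub>R Y" for s
  define W' where "W' s = \<kappa> *\<^sub>R (cos (\<kappa> * s) *\<^sub>R Y - sin (\<kappa> * s) *\<^sub>R X)" for s
  define F where "F s = exp (s *\<^sub>R (- Z)) * W s * exp (s *\<^sub>R Z)" for s
  have dW: "(W has_vector_derivative W' s) (at s)" for s
    unfolding W_def W'_def
    by (auto intro!: derivative_eq_intros simp: has_real_derivative_iff_has_vector_derivative[symmetric]
        algebra_simps)
  have br: "Z * W s - W s * Z = W' s" for s
  proof -
    have "Z * W s - W s * Z = cos (\<kappa> * s) *\<^sub>R (Z * X - X * Z) + sin (\<kappa> * s) *\<^sub>R (Z * Y - Y * Z)"
      by (simp add: W_def algebra_simps)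
    then show ?thesis unfolding ZX ZY by (simp add: W'_def algebra_simps)
  qed
  have "(F has_vector_derivative 0) (at s)" for s
  proof -
    have "(F has_vector_derivative
       exp (s *\<^sub>R (- Z)) * W s * (Z * exp (s *\<^sub>R Z))
       + (exp (s *\<^sub>R (- Z)) * W' s + exp (s *\<^sub>R (- Z)) * (- Z) * W s) * exp (s *\<^sub>R Z)) (at s)"
      unfolding F_def
      by (intro has_vector_derivative_mult dW exp_scaleR_has_vector_derivative_right exp_scaleR_has_vector_derivative_left)
    moreover have "exp (s *\<^sub>R (- Z)) * W s * (Z * exp (s *\<^sub>R Z))
       + (exp (s *\<^sub>R (- Z)) * W' s + exp (s *\<^sub>R (- Z)) * (- Z) * W s) * exp (s *\<^sub>R Z) = 0"
      unfolding br[symmetric] by (simp add: algebra_simps)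
    ultimately show ?thesis by simp
  qed
  then obtain c where "\<And>u. F u = c"
    using has_vector_derivative_zero_constant[of UNIV F] by auto
  then have "F s = F 0" by simp
  then have F: "exp (- (s *\<^sub>R Z)) * W s * exp (s *\<^sub>R Z) = X" by (simp add: F_def W_def)
  have "exp (s *\<^sub>R Z) * X = (exp (s *\<^sub>R Z) * exp (- (s *\<^sub>R Z))) * W s * exp (s *\<^sub>R Z)"
    unfolding F[symmetric] by (simp only: mult.assoc)
  then show ?thesis by (simp add: exp_minus_inverse W_def)
qed

text \<open>The element \<open>c = exp (2 \<pi> X)\<close> is central, hence equal to its conjugate \<open>exp (2 \<pi> Z)\<close> and to
  its inverse, which is conjugate to it as well.\<close>

lemma su2_relations:
  fixes X Y Z :: "'a::{real_normed_algebra_1,banach}"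
  assumes XY: "X * Y - Y * X = Z" and YZ: "Y * Z - Z * Y = X" and ZX: "Z * X - X * Z = Y"
  shows "exp ((4 * pi) *\<^sub>R Z) = 1"
    and "exp (pi *\<^sub>R X) * Z = - Z * exp (pi *\<^sub>R X)"
proof -
  have rotX_Z: "exp (s *\<^sub>R X) * Z = (cos s *\<^sub>R Z + sin s *\<^sub>R (- Y)) * exp (s *\<^sub>R X)" for s
    using exp_rotation[of X Z 1 "- Y" s] XY ZX by (simp add: algebra_simps)
  have rotX_Y: "exp (s *\<^sub>R X) * Y = (cos s *\<^sub>R Y + sin s *\<^sub>R Z) * exp (s *\<^sub>R X)" for s
    using exp_rotation[of X Y 1 Z s] XY ZX by (simp add: algebra_simps)
  have rotY_Z: "exp (s *\<^sub>R Y) * Z = (cos s *\<^sub>R Z + sin s *\<^sub>R X) * exp (s *\<^sub>R Y)" for s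
    using exp_rotation[of Y Z 1 X s] YZ XY by (simp add: algebra_simps)
  show XZ: "exp (pi *\<^sub>R X) * Z = - Z * exp (pi *\<^sub>R X)" using rotX_Z[of pi] by simp
  define u v w w' c where "u = exp (pi *\<^sub>R X)" and "v = exp (- (pi *\<^sub>R X))"
    and "w = exp ((pi/2) *\<^sub>R Y)" and "w' = exp (- ((pi/2) *\<^sub>R Y))" and "c = exp ((2 * pi) *\<^sub>R X)"
  have inv: "u * v = 1" "v * u = 1" "w * w' = 1" "w' * w = 1"
    unfolding u_def v_def w_def w'_def by (rule exp_minus_inverse exp_minus_inverse')+
  \<comment> \<open>A quarter turn about \<open>Y\<close> carries \<open>Z\<close> to
    \<open>X\<close>; this is the conjugation between \<open>exp (2 \<pi> Z)\<close> and
    \<open>c\<close>.\<close>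
  have "w * ((2 * pi) *\<^sub>R Z) * w' = (2 * pi) *\<^sub>R X"
    using rotY_Z[of "pi/2"] inv by (simp add: w_def[symmetric] mult.assoc)
  then have c1: "c = w * exp ((2 * pi) *\<^sub>R Z) * w'"
    using exp_conjugate[of w' w "(2 * pi) *\<^sub>R Z"] inv by (simp add: c_def)
  have "c * Y = Y * c" using rotX_Y[of "2 * pi"] by (simp add: c_def)
  then have cw: "c * w = w * c" unfolding w_def by (intro exp_commute) simp
  have "exp ((2 * pi) *\<^sub>R Z) = (w' * w) * exp ((2 * pi) *\<^sub>R Z) * (w' * w)" by (simp add: inv)
  also have "\<dots> = w' * c * w" unfolding c1 by (simp add: mult.assoc)
  also have "\<dots> = w' * w * c" by (simp add: mult.assoc cw)
  finally have c2: "exp ((2 * pi) *\<^sub>R Z) = c" by (simp add: inv)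
  have uc: "u * c = c * u" unfolding c_def u_def by (intro exp_commute exp_commute[symmetric]) simp
  have "u * ((2 * pi) *\<^sub>R Z) * v = - ((2 * pi) *\<^sub>R Z)"
    using XZ inv by (simp add: u_def[symmetric] mult.assoc)
  then have "exp (- ((2 * pi) *\<^sub>R Z)) = u * c * v"
    using exp_conjugate[of v u "(2 * pi) *\<^sub>R Z"] inv c2 by simp
  then have "exp (- ((2 * pi) *\<^sub>R Z)) = c" by (simp add: uc mult.assoc inv)
  then have "exp ((2 * pi) *\<^sub>R Z) * exp ((2 * pi) *\<^sub>R Z) = 1"
    using exp_minus_inverse[of "(2 * pi) *\<^sub>R Z"] c2 by simp
  then show "exp ((4 * pi) *\<^sub>R Z) = 1"
    using exp_scaleR_add[of "2 * pi" "2 * pi" Z] by simp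
qed

section \<open>Continuity of the exponential and homomorphisms from the line to the circle\<close>

lemma has_vector_derivative_shift:
  assumes "(f has_vector_derivative d) (at (x + a))"
  shows "((\<lambda>x. f (x + a)) has_vector_derivative d) (at (x::real))"
proof -
  have "((\<lambda>x. x + a) has_vector_derivative 1) (at x)"
    by (auto intro!: derivative_eq_intros simp: has_real_derivative_iff_has_vector_derivative[symmetric])
  from vector_diff_chain_at[OF this assms] show ?thesis by (simp add: o_def)
qed

text \<open>The exponential series converges uniformly on balls. Continuity makes \<open>lie\<close>
  closed, which brackets, being limits of difference quotients, rely on.\<close>

lemma isCont_exp_banach:
  fixes X :: "'a::{real_normed_algebra_1,banach}"
  shows "isCont exp X"
proof -
  define R where "R = norm X + 1"
  have "continuous_on (cball 0 R) (exp :: 'a \<Rightarrow> 'a)"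
  proof (rule uniform_limit_theorem[OF always_eventually])
    show "\<forall>n. continuous_on (cball 0 R) (\<lambda>Y::'a. \<Sum>i<n. Y ^ i /\<^sub>R fact i)"
      by (intro allI continuous_intros)
    show "uniform_limit (cball 0 R) (\<lambda>n Y::'a. \<Sum>i<n. Y ^ i /\<^sub>R fact i) exp sequentially"
      unfolding exp_def
    proof (rule Weierstrass_m_test)
      show "norm (Y ^ n /\<^sub>R fact n) \<le> R ^ n /\<^sub>R fact n" if "Y \<in> cball 0 R" for n and Y :: 'a
        using that order_trans[OF norm_power_ineq[of Y n] power_mono[of "norm Y" R n]]
        by (simp add: divide_right_mono field_simps)
      show "summable (\<lambda>n. R ^ n /\<^sub>R fact n)" by (rule summable_exp_generic)
    qed
  qed simp
  moreover have "X \<in> interior (cball 0 R)" by (simp add: R_def)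
  ultimately show ?thesis using continuous_on_interior by blast
qed

text \<open>Smoothing by integration: with an antiderivative \<open>G\<close>, the functional
  equation integrates to \<open>\<psi> s * (G a - G 0) = G (s + a) - G s\<close>, whose right side
  is differentiable in \<open>s\<close>. Some \<open>a\<close> has \<open>G a \<noteq> G 0\<close>
  because the derivative of \<open>G\<close> at 0 is 1.\<close>

lemma circle_hom_differentiable:
  fixes \<psi> :: "real \<Rightarrow> complex"
  assumes cont: "continuous_on UNIV \<psi>" and add: "\<And>s t. \<psi> (s + t) = \<psi> s * \<psi> t"
    and one: "\<psi> 0 = 1"
  obtains c where "(\<psi> has_vector_derivative c) (at 0)"
proof -
  \<comment> \<open>The interval is large enough that \<open>s + a\<close> stays in its interior for
    \<open>\<bar>s\<bar> < 1\<close> and \<open>a\<close> in [0, 1].\<close>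
  obtain G where G: "\<And>x. x \<in> {-3..3} \<Longrightarrow> (G has_vector_derivative \<psi> x) (at x within {-3..3})"
    using antiderivative_continuous[of "-3" 3 \<psi>] continuous_on_subset[OF cont subset_UNIV] by metis
  have G': "(G has_vector_derivative \<psi> x) (at x)" if "\<bar>x\<bar> < 3" for x
    using G[of x] that has_vector_derivative_within_open[of x "{-3<..<3}" G "\<psi> x"]
      has_vector_derivative_within_subset[of G "\<psi> x" x "{-3..3}" "{-3<..<3}"] by force
  have shift: "\<psi> s * (G a - G 0) = G (s + a) - G s" if s: "\<bar>s\<bar> < 1" and a: "a \<in> {0..1}" for s a
  proof -
    have "((\<lambda>x. \<psi> s * (G x - G 0) - (G (s + x) - G s)) has_vector_derivative 0) (at x within {0..1})"
      if "x \<in> {0..1}" for x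
    proof -
      have sh: "((\<lambda>x. G (s + x)) has_vector_derivative \<psi> (s + x)) (at x)"
      proof -
        have "\<bar>x + s\<bar> < 3" using s that by auto
        from has_vector_derivative_shift[OF G'[OF this]] show ?thesis by (simp add: add.commute)
      qed
      have "((\<lambda>x. \<psi> s * (G x - G 0) - (G (s + x) - G s)) has_vector_derivative
          (\<psi> s * (\<psi> x - 0) + 0 * (G x - G 0) - (\<psi> (s + x) - 0))) (at x)"
        using that by (intro has_vector_derivative_diff has_vector_derivative_mult sh G' has_vector_derivative_const) auto
      then show ?thesis by (simp add: add has_vector_derivative_at_within)
    qed
    then obtain k where "\<And>x. x \<in> {0..1} \<Longrightarrow> \<psi> s * (G x - G 0) - (G (s + x) - G s) = k"
      using has_vector_derivative_zero_constant[of "{0..1::real}"] convex_real_interval(5) by blast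
    from this[of 0] this[of a] show ?thesis using a by simp
  qed
  have "\<exists>a\<in>{0..1}. G a \<noteq> G 0"
  proof (rule ccontr)
    assume "\<not> (\<exists>a\<in>{0..1}. G a \<noteq> G 0)"
    then have eq: "\<And>x. x \<in> {0..1} \<Longrightarrow> G x = G 0" by blast
    have "(G has_vector_derivative 0) (at 0 within {0..1})"
      by (rule has_vector_derivative_transform[where f = "\<lambda>_. G 0", OF _ eq has_vector_derivative_const]) simp_all
    moreover have "(G has_vector_derivative \<psi> 0) (at 0 within {0..1})"
      by (rule has_vector_derivative_at_within[OF G']) simp
    ultimately have "0 = \<psi> 0"
      using vector_derivative_unique_within_closed_interval[of 0 "1::real" 0 G 0 "\<psi> 0"]
      unfolding box_real by simp
    then show False using one by simp
  qed
  then obtain a where a: "a \<in> {0..1}" "G a \<noteq> G 0" by blast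
  have "((\<lambda>s. G (s + a)) has_vector_derivative \<psi> a) (at 0)"
    by (rule has_vector_derivative_shift) (use G'[of a] a in simp)
  then have "((\<lambda>s. (G (s + a) - G s) / (G a - G 0)) has_vector_derivative (\<psi> a - \<psi> 0) / (G a - G 0)) (at 0)"
    using G'[of 0] by (intro has_vector_derivative_divide has_vector_derivative_diff) auto
  then have "(\<psi> has_vector_derivative (\<psi> a - \<psi> 0) / (G a - G 0)) (at 0)"
  proof (rule has_vector_derivative_transform_within_open[of _ _ _ "{-1<..<1}"])
    fix s :: real assume "s \<in> {-1<..<1}"
    show "(G (s + a) - G s) / (G a - G 0) = \<psi> s"
    proof -
      have "\<bar>s\<bar> < 1" using \<open>s \<in> {-1<..<1}\<close> by auto
      from shift[OF this a(1)] show ?thesis using a(2) by (simp add: nonzero_divide_eq_eq)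
    qed
  qed auto
  then show ?thesis using that by blast
qed

text \<open>Translation spreads differentiability at 0 to the equation \<psi>' = c \<psi>, so \<psi>
  is exponential; modulus 1 makes the rate \<open>c\<close> imaginary.\<close>

lemma circle_hom_eq_cis:
  fixes \<psi> :: "real \<Rightarrow> complex"
  assumes cont: "continuous_on UNIV \<psi>" and add: "\<And>s t. \<psi> (s + t) = \<psi> s * \<psi> t"
    and unit: "\<And>s. cmod (\<psi> s) = 1"
  obtains \<kappa> where "\<And>s. \<psi> s = cis (\<kappa> * s)"
proof -
  have "\<psi> 0 = \<psi> 0 * \<psi> 0" using add[of 0 0] by simp
  moreover have nz: "\<psi> s \<noteq> 0" for s using unit[of s] by auto
  ultimately have one: "\<psi> 0 = 1" by simp
  obtain c where c: "(\<psi> has_vector_derivative c) (at 0)"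
    using circle_hom_differentiable[OF cont add one] by blast
  have d: "(\<psi> has_vector_derivative \<psi> s * c) (at s)" for s
  proof -
    have "((\<lambda>x. \<psi> (x - s)) has_vector_derivative c) (at s)"
      using has_vector_derivative_shift[of \<psi> c s "- s"] c by simp
    then have "((\<lambda>x. \<psi> s * \<psi> (x - s)) has_vector_derivative \<psi> s * c) (at s)"
      by (rule has_vector_derivative_mult_right)
    then show ?thesis by (simp add: add[symmetric])
  qed
  have "((\<lambda>s. \<psi> s * exp (s *\<^sub>R (- c))) has_vector_derivative 0) (at s)" for s
  proof -
    have "((\<lambda>s. \<psi> s * exp (s *\<^sub>R (- c))) has_vector_derivative
        (\<psi> s * (exp (s *\<^sub>R (- c)) * (- c)) + \<psi> s * c * exp (s *\<^sub>R (- c)))) (at s)"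
      by (intro has_vector_derivative_mult d exp_scaleR_has_vector_derivative_right)
    then show ?thesis by (simp add: algebra_simps)
  qed
  then obtain k where k: "\<And>s. \<psi> s * exp (s *\<^sub>R (- c)) = k"
    using has_vector_derivative_zero_constant[of UNIV "\<lambda>s. \<psi> s * exp (s *\<^sub>R (- c))"] by auto
  from k[of 0] have "k = 1" by (simp add: one)
  have e: "\<psi> s = exp (s *\<^sub>R c)" for s
    using k[of s] \<open>k = 1\<close> by (simp add: exp_minus field_simps)
  have "Re c = 0" using unit[of 1] unfolding e by simp
  then have "c = \<i> * of_real (Im c)" by (simp add: complex_eq_iff)
  then have "\<psi> s = cis (Im c * s)" for s unfolding e cis_conv_exp
    by (metis mult.assoc mult.commute of_real_mult scaleR_conv_of_real)
  then show ?thesis using that by blast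
qed

section \<open>Closed linear groups and root vectors\<close>

locale closed_matrix_monoid =
  fixes G :: "'a::{real_normed_algebra_1,banach} set"
  assumes closed: "closed G" and bounded: "bounded G" and one: "1 \<in> G"
    and mult: "\<And>x y. x \<in> G \<Longrightarrow> y \<in> G \<Longrightarrow> x * y \<in> G"
begin

text \<open>One-parameter groups instead of tangent vectors of curves: scaling, conjugation and
  closedness are then direct, and \<open>lieI_tangent\<close> recovers the tangent vectors. Since
  \<open>s\<close> may be negative, inverses of exponentials stay in \<open>G\<close>.\<close>

definition lie :: "'a set" where "lie = {X. \<forall>s. exp (s *\<^sub>R X) \<in> G}"

lemma lieI_tangent:
  assumes "\<And>s. \<gamma> s \<in> G" "\<gamma> 0 = 1" "(\<gamma> has_vector_derivative X) (at (0::real))"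
  shows "X \<in> lie"
proof -
  have "exp (s *\<^sub>R X) \<in> G" for s
    by (rule exp_mem_if_tangent[OF closed bounded one _ assms]) (rule mult)
  then show ?thesis by (simp add: lie_def)
qed

lemma lie_scaleR: "X \<in> lie \<Longrightarrow> r *\<^sub>R X \<in> lie"
  by (simp add: lie_def)

lemma lie_exp: "X \<in> lie \<Longrightarrow> exp (s *\<^sub>R X) \<in> G"
  by (simp add: lie_def)

text \<open>The product of two one-parameter groups is in general only a curve with velocity
  \<open>X + Y\<close> at 0, which is why \<open>lieI_tangent\<close> admits arbitrary
  curves.\<close>

lemma lie_add:
  assumes "X \<in> lie" "Y \<in> lie" shows "X + Y \<in> lie"
proof (rule lieI_tangent)
  show "((\<lambda>s. exp (s *\<^sub>R X) * exp (s *\<^sub>R Y)) has_vector_derivative X + Y) (at 0)"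
    using has_vector_derivative_mult[OF exp_scaleR_has_vector_derivative_right[of X 0 UNIV]
      exp_scaleR_has_vector_derivative_right[of Y 0 UNIV]] by (simp add: add.commute)
qed (use assms in \<open>auto intro: mult lie_exp\<close>)

lemma closed_lie: "closed lie"
proof -
  have "isCont (\<lambda>X. exp (s *\<^sub>R X)) X" for s and X :: 'a
    using isCont_o2[OF _ isCont_exp_banach, of X "\<lambda>X. s *\<^sub>R X"] by simp
  then have "closed ((\<lambda>X. exp (s *\<^sub>R X)) -` G)" for s
    by (rule continuous_closed_vimage[OF closed])
  moreover have "lie = (\<Inter>s. (\<lambda>X. exp (s *\<^sub>R X)) -` G)" by (auto simp: lie_def)
  ultimately show ?thesis by (metis closed_INT)
qed

lemma lie_Ad:
  assumes X: "X \<in> lie" and Y: "Y \<in> lie" shows "exp X * Y * exp (- X) \<in> lie"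
proof -
  have "exp (s *\<^sub>R (exp X * Y * exp (- X))) \<in> G" for s
  proof -
    have "exp (s *\<^sub>R (exp X * Y * exp (- X))) = exp X * exp (s *\<^sub>R Y) * exp (- X)"
      using exp_conjugate[of "exp (- X)" "exp X" "s *\<^sub>R Y"] by (simp add: exp_minus_inverse exp_minus_inverse')
    moreover have "exp X \<in> G" "exp (- X) \<in> G" "exp (s *\<^sub>R Y) \<in> G"
      using lie_exp[OF X, of 1] lie_exp[OF X, of "-1"] lie_exp[OF Y] by auto
    ultimately show ?thesis by (simp add: mult)
  qed
  then show ?thesis by (simp add: lie_def)
qed

text \<open>The bracket is the velocity at 0 of the conjugates
  \<open>exp (s X) * Y * exp (- s X)\<close>. These lie in the closed subspace \<open>lie\<close>,
  and so do the difference quotients and their limit.\<close>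

lemma lie_bracket_closed:
  assumes X: "X \<in> lie" and Y: "Y \<in> lie" shows "X * Y - Y * X \<in> lie"
proof -
  define D where "D s = exp (s *\<^sub>R X) * Y * exp (s *\<^sub>R (- X))" for s
  have "(D has_vector_derivative
      exp (0 *\<^sub>R X) * Y * (exp (0 *\<^sub>R (- X)) * (- X)) + (exp (0 *\<^sub>R X) * 0 + exp (0 *\<^sub>R X) * X * Y) * exp (0 *\<^sub>R (- X))) (at 0)"
    unfolding D_def
    by (intro has_vector_derivative_mult exp_scaleR_has_vector_derivative_right has_vector_derivative_const)
  then have "(D has_vector_derivative X * Y - Y * X) (at 0)" by simp
  then have lim: "((\<lambda>s. norm (D s - D 0 - s *\<^sub>R (X * Y - Y * X)) / \<bar>s\<bar>) \<longlongrightarrow> 0) (at 0)"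
    by (simp add: has_vector_derivative_def has_derivative_at)
  have "((\<lambda>s. inverse s *\<^sub>R (D s - D 0)) \<longlongrightarrow> X * Y - Y * X) (at 0)"
  proof (rule LIM_zero_cancel, rule Lim_null_comparison[OF _ lim])
    have "norm (inverse s *\<^sub>R (D s - D 0) - (X * Y - Y * X)) = norm (D s - D 0 - s *\<^sub>R (X * Y - Y * X)) / \<bar>s\<bar>"
      if "s \<noteq> 0" for s
    proof -
      have "inverse s *\<^sub>R (D s - D 0) - (X * Y - Y * X) = inverse s *\<^sub>R (D s - D 0 - s *\<^sub>R (X * Y - Y * X))"
        using that by (simp add: algebra_simps)
      then show ?thesis by (simp add: divide_inverse mult.commute)
    qed
    then show "\<forall>\<^sub>F s in at 0. norm (inverse s *\<^sub>R (D s - D 0) - (X * Y - Y * X))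
        \<le> norm (D s - D 0 - s *\<^sub>R (X * Y - Y * X)) / \<bar>s\<bar>"
      by (auto simp: eventually_at_filter)
  qed
  moreover have "inverse s *\<^sub>R (D s - D 0) \<in> lie" for s
  proof -
    have "D s \<in> lie" unfolding D_def using lie_Ad[OF lie_scaleR[OF X] Y] by simp
    moreover have "- D 0 \<in> lie" using lie_scaleR[OF Y, of "-1"] by (simp add: D_def)
    ultimately show ?thesis using lie_scaleR lie_add by (metis uminus_add_conv_diff add.commute)
  qed
  ultimately show ?thesis
    by (intro Lim_in_closed_set[OF closed_lie]) auto
qed

end

text \<open>\<open>T_max\<close> is the form in which maximality enters: a one-parameter group of
  \<open>G\<close> that centralizes \<open>T\<close> lies in \<open>T\<close>. \<open>\<tau>\<close>
  will be the trace, and \<open>\<tau>_neg\<close> records that the Lie algebra consists of skew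
  matrices.\<close>

locale matrix_torus = closed_matrix_monoid G for G :: "'a::{real_normed_algebra_1,banach} set" +
  fixes T :: "'a set" and \<tau> :: "'a \<Rightarrow> real"
  assumes T_sub: "T \<subseteq> G" and T_conn: "connected T" and T_one: "1 \<in> T"
    and T_mult: "\<And>s t. s \<in> T \<Longrightarrow> t \<in> T \<Longrightarrow> s * t \<in> T"
    and T_comm: "\<And>s t. s \<in> T \<Longrightarrow> t \<in> T \<Longrightarrow> s * t = t * s"
    and T_inv: "\<And>t. t \<in> T \<Longrightarrow> \<exists>t'\<in>T. t * t' = 1"
    and T_max: "\<And>Z s. Z \<in> lie \<Longrightarrow> (\<And>t. t \<in> T \<Longrightarrow> t * Z = Z * t) \<Longrightarrow> exp (s *\<^sub>R Z) \<in> T"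
    and \<tau>_lin: "bounded_linear \<tau>" and \<tau>_comm: "\<And>x y. \<tau> (x * y) = \<tau> (y * x)"
    and \<tau>_neg: "\<And>X. X \<in> lie \<Longrightarrow> X \<noteq> 0 \<Longrightarrow> \<tau> (X * X) < 0"
begin

section \<open>Characters of the torus and their root vectors\<close>

definition unitary_char :: "('a \<Rightarrow> complex) \<Rightarrow> bool" where
  "unitary_char \<phi> \<longleftrightarrow> continuous_on T \<phi> \<and> (\<forall>t\<in>T. cmod (\<phi> t) = 1) \<and>
     (\<forall>s\<in>T. \<forall>t\<in>T. \<phi> (s * t) = \<phi> s * \<phi> t)"

lemma unitary_char_one: "unitary_char \<phi> \<Longrightarrow> \<phi> 1 = 1"
  unfolding unitary_char_def using T_one
  by (metis mult.right_neutral mult_cancel_left norm_zero zero_neq_one)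

text \<open>Translating by an inverse turns triviality near 1 into local constancy at every point,
  and \<open>T\<close> is connected.\<close>

lemma unitary_char_locally_trivial:
  assumes \<phi>: "unitary_char \<phi>" and e: "e > 0"
    and triv: "\<And>t. t \<in> T \<Longrightarrow> dist t 1 < e \<Longrightarrow> \<phi> t = 1"
    and t: "t \<in> T"
  shows "\<phi> t = 1"
proof -
  have "\<phi> constant_on T"
  proof (rule locally_constant_imp_constant[OF T_conn])
    fix a assume a: "a \<in> T"
    then obtain a' where a': "a' \<in> T" "a * a' = 1" using T_inv by blast
    define U where "U = T \<inter> (\<lambda>x. x * a') -` ball 1 e"
    have "open ((\<lambda>x. x * a') -` ball 1 e)"
      by (intro open_vimage open_ball continuous_intros)
    then have "openin (top_of_set T) U" unfolding U_def by (rule openin_open_Int)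
    moreover have "a \<in> U" using a a' e by (simp add: U_def)
    moreover have "\<phi> x = \<phi> a" if "x \<in> U" for x
    proof -
      have x: "x \<in> T" "dist (x * a') 1 < e" using that by (auto simp: U_def dist_commute)
      then have "\<phi> (x * a') = 1" using triv a' T_mult by blast
      moreover have "\<phi> (a * a') = 1" using unitary_char_one[OF \<phi>] a' by simp
      moreover have "\<phi> (x * a') = \<phi> x * \<phi> a'" "\<phi> (a * a') = \<phi> a * \<phi> a'"
        using \<phi> x a a' unfolding unitary_char_def by blast+
      ultimately have "\<phi> x * \<phi> a' = \<phi> a * \<phi> a'" by simp
      moreover have "\<phi> a' \<noteq> 0" using \<phi> a' by (force simp: unitary_char_def)
      ultimately show ?thesis by simp
    qed
    ultimately show "\<exists>U. openin (top_of_set T) U \<and> a \<in> U \<and> (\<forall>x\<in>U. \<phi> x = \<phi> a)" by blast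
  qed
  then show ?thesis using T_one t unitary_char_one[OF \<phi>] unfolding constant_on_def by metis
qed

text \<open>Real and imaginary part of the eigenvector equation for \<open>X + \<i>Y\<close>, with
  the inverse of \<open>t\<close> multiplied across so that no inverse has to be named.\<close>

definition root_pair :: "('a \<Rightarrow> complex) \<Rightarrow> 'a \<Rightarrow> 'a \<Rightarrow> bool" where
  "root_pair \<phi> X Y \<longleftrightarrow> X \<in> lie \<and> Y \<in> lie \<and> (X \<noteq> 0 \<or> Y \<noteq> 0) \<and>
     (\<forall>t\<in>T. t * X = (Re (\<phi> t) *\<^sub>R X - Im (\<phi> t) *\<^sub>R Y) * t \<and>
            t * Y = (Im (\<phi> t) *\<^sub>R X + Re (\<phi> t) *\<^sub>R Y) * t)"

text \<open>\<open>t\<close> acts on the pair \<open>X\<close>, \<open>Y\<close> by a rotation, and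
  the bracket, being alternating, is multiplied by its determinant, which is the square of the
  modulus of \<open>\<phi> t\<close>, hence 1.\<close>

lemma root_pair_bracket_commutes:
  assumes \<phi>: "unitary_char \<phi>" and XY: "root_pair \<phi> X Y" and t: "t \<in> T"
  shows "t * (X * Y - Y * X) = (X * Y - Y * X) * t"
proof -
  obtain t' where t': "t' \<in> T" "t * t' = 1" using T_inv t by blast
  define c s where "c = Re (\<phi> t)" and "s = Im (\<phi> t)"
  have cs: "c * c + s * s = 1"
    using \<phi> t cmod_power2[of "\<phi> t"] by (simp add: unitary_char_def c_def s_def power2_eq_square)
  have X: "t * X = (c *\<^sub>R X - s *\<^sub>R Y) * t" and Y: "t * Y = (s *\<^sub>R X + c *\<^sub>R Y) * t"
    using XY t by (auto simp: root_pair_def c_def s_def)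
  have "t * (X * Y) = (c *\<^sub>R X - s *\<^sub>R Y) * (s *\<^sub>R X + c *\<^sub>R Y) * t"
    using X Y by (metis mult.assoc)
  moreover have "t * (Y * X) = (s *\<^sub>R X + c *\<^sub>R Y) * (c *\<^sub>R X - s *\<^sub>R Y) * t"
    using X Y by (metis mult.assoc)
  ultimately have "t * (X * Y - Y * X) =
    ((c *\<^sub>R X - s *\<^sub>R Y) * (s *\<^sub>R X + c *\<^sub>R Y) - (s *\<^sub>R X + c *\<^sub>R Y) * (c *\<^sub>R X - s *\<^sub>R Y)) * t"
    by (simp only: right_diff_distrib left_diff_distrib)
  also have "(c *\<^sub>R X - s *\<^sub>R Y) * (s *\<^sub>R X + c *\<^sub>R Y) - (s *\<^sub>R X + c *\<^sub>R Y) * (c *\<^sub>R X - s *\<^sub>R Y)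
      = (c * c + s * s) *\<^sub>R (X * Y - Y * X)"
    by (simp add: algebra_simps)
  finally show ?thesis by (simp add: cs)
qed

text \<open>If \<open>X\<close> and \<open>Y\<close> commuted, \<open>\<tau> (t (X\<^sup>2 + Y\<^sup>2))\<close> would vanish whenever \<open>\<phi> t \<noteq> 1\<close>;
  such \<open>t\<close> exist arbitrarily close to 1.\<close>

lemma root_pair_bracket_nonzero:
  assumes \<phi>: "unitary_char \<phi>" and XY: "root_pair \<phi> X Y" and nontriv: "\<exists>t\<in>T. \<phi> t \<noteq> 1"
  shows "X * Y - Y * X \<noteq> 0"
proof
  assume "X * Y - Y * X = 0"
  then have comm: "X * Y = Y * X" by simp
  interpret \<tau>: bounded_linear \<tau> by (rule \<tau>_lin)
  define W where "W = X * X + Y * Y"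
  have vanish: "\<tau> (t * W) = 0" if t: "t \<in> T" "\<phi> t \<noteq> 1" for t
  proof -
    define c s where "c = Re (\<phi> t)" and "s = Im (\<phi> t)"
    have cs: "c * c + s * s = 1"
      using \<phi> t cmod_power2[of "\<phi> t"] by (simp add: unitary_char_def c_def s_def power2_eq_square)
    have "c \<noteq> 1"
    proof
      assume "c = 1"
      then have "s = 0" using cs by simp
      then show False using \<open>c = 1\<close> t(2) by (simp add: c_def s_def complex_eq_iff)
    qed
    have X: "t * X = (c *\<^sub>R X - s *\<^sub>R Y) * t" and Y: "t * Y = (s *\<^sub>R X + c *\<^sub>R Y) * t"
      using XY t by (auto simp: root_pair_def c_def s_def)
    have sw: "\<tau> (A * t * B) = \<tau> (t * (B * A))" for A B
      using \<tau>_comm[of A "t * B"] by (simp add: mult.assoc)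
    \<comment> \<open>Moving \<open>t\<close> past one factor and using cyclicity of
      \<open>\<tau>\<close> relates \<open>p\<close> and \<open>q\<close> to the mixed term
      \<open>r\<close>. The two occurrences of \<open>r\<close> cancel in the sum, which leaves
      \<open>(1 - c) * (p + q) = 0\<close>.\<close>
    define p q r where "p = \<tau> (t * (X * X))" and "q = \<tau> (t * (Y * Y))" and "r = \<tau> (t * (X * Y))"
    have "p = \<tau> ((c *\<^sub>R X - s *\<^sub>R Y) * t * X)" unfolding p_def by (metis X mult.assoc)
    also have "\<dots> = c * p - s * r"
      unfolding sw by (simp add: p_def r_def algebra_simps \<tau>.add \<tau>.diff \<tau>.scaleR comm)
    finally have p: "p = c * p - s * r" .
    have "q = \<tau> ((s *\<^sub>R X + c *\<^sub>R Y) * t * Y)" unfolding q_def by (metis Y mult.assoc)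
    also have "\<dots> = s * r + c * q"
      unfolding sw by (simp add: q_def r_def algebra_simps \<tau>.add \<tau>.diff \<tau>.scaleR comm)
    finally have "(1 - c) * (p + q) = 0" using p by (simp add: algebra_simps)
    then have "p + q = 0" using \<open>c \<noteq> 1\<close> by simp
    then show ?thesis by (simp add: W_def p_def q_def distrib_left \<tau>.add)
  qed
  have "\<tau> W = 0"
  proof (rule ccontr)
    assume nz: "\<tau> W \<noteq> 0"
    have "isCont (\<lambda>t. \<tau> (t * W)) 1" by (intro \<tau>.isCont continuous_intros)
    then have "\<forall>\<^sub>F t in nhds 1. \<tau> (t * W) \<noteq> 0"
      using nz tendsto_imp_eventually_ne[of "\<lambda>t. \<tau> (t * W)" "\<tau> W" "at 1" 0]
      by (simp add: isCont_def eventually_nhds_conv_at)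
    then obtain e where e: "e > 0" "\<And>t. dist t 1 < e \<Longrightarrow> \<tau> (t * W) \<noteq> 0"
      unfolding eventually_nhds_metric by blast
    have "\<phi> t = 1" if "t \<in> T" for t
      using unitary_char_locally_trivial[OF \<phi> e(1) _ that] vanish e(2) by blast
    then show False using nontriv by blast
  qed
  then have "\<tau> (X * X) + \<tau> (Y * Y) = 0" by (simp add: W_def \<tau>.add)
  moreover have "\<tau> (X * X) \<le> 0" "\<tau> (Y * Y) \<le> 0" "\<tau> (X * X) < 0 \<or> \<tau> (Y * Y) < 0"
    using \<tau>_neg XY \<tau>.zero by (force simp: root_pair_def)+
  ultimately show False by linarith
qed

lemma unitary_char_one_parameter:
  assumes \<phi>: "unitary_char \<phi>" and Z: "\<And>s. exp (s *\<^sub>R Z) \<in> T"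
  obtains \<kappa> where "\<And>s. \<phi> (exp (s *\<^sub>R Z)) = cis (\<kappa> * s)"
proof -
  have "continuous_on UNIV (\<lambda>s. exp (s *\<^sub>R Z))"
    using exp_scaleR_has_vector_derivative_right has_vector_derivative_continuous
    by (metis continuous_at_imp_continuous_on)
  then have 1: "continuous_on UNIV (\<lambda>s. \<phi> (exp (s *\<^sub>R Z)))"
    using \<phi> Z continuous_on_compose2[of T \<phi> UNIV "\<lambda>s. exp (s *\<^sub>R Z)"]
    by (auto simp: unitary_char_def)
  have 2: "\<phi> (exp ((s + t) *\<^sub>R Z)) = \<phi> (exp (s *\<^sub>R Z)) * \<phi> (exp (t *\<^sub>R Z))" for s t
    using \<phi> Z by (simp add: exp_scaleR_add unitary_char_def)
  have 3: "cmod (\<phi> (exp (s *\<^sub>R Z))) = 1" for s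
    using \<phi> Z by (simp add: unitary_char_def)
  show ?thesis using circle_hom_eq_cis[OF 1 2 3] that by blast
qed

text \<open>The brackets of \<open>Z = [X, Y]\<close> with \<open>X\<close> and \<open>Y\<close> are
  governed by the speed \<open>\<mu>\<close> of \<open>\<phi>\<close> along
  \<open>exp (s Z)\<close>. Only a negative \<open>\<mu>\<close> gives $su(2)$, and the trace form
  supplies this sign.\<close>

lemma root_su2:
  assumes \<phi>: "unitary_char \<phi>" and XY: "root_pair \<phi> X Y" and nontriv: "\<exists>t\<in>T. \<phi> t \<noteq> 1"
  obtains X' Z' where "X' \<in> lie" "\<And>s. exp (s *\<^sub>R Z') \<in> T" "\<And>s. \<phi> (exp (s *\<^sub>R Z')) = cis (- s)"
    "exp ((4 * pi) *\<^sub>R Z') = 1"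
    "exp (pi *\<^sub>R X') * Z' = - Z' * exp (pi *\<^sub>R X')"
    "\<And>t. t \<in> T \<Longrightarrow> \<phi> t = 1 \<Longrightarrow> t * X' = X' * t"
proof -
  interpret \<tau>: bounded_linear \<tau> by (rule \<tau>_lin)
  define Z where "Z = X * Y - Y * X"
  have X: "X \<in> lie" and Y: "Y \<in> lie"
    and rX: "\<And>t. t \<in> T \<Longrightarrow> t * X = (Re (\<phi> t) *\<^sub>R X - Im (\<phi> t) *\<^sub>R Y) * t"
    and rY: "\<And>t. t \<in> T \<Longrightarrow> t * Y = (Im (\<phi> t) *\<^sub>R X + Re (\<phi> t) *\<^sub>R Y) * t"
    using XY by (auto simp: root_pair_def)
  have Z: "Z \<in> lie" unfolding Z_def by (rule lie_bracket_closed[OF X Y])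
  have Z0: "Z \<noteq> 0" unfolding Z_def by (rule root_pair_bracket_nonzero[OF \<phi> XY nontriv])
  have ZT: "exp (s *\<^sub>R Z) \<in> T" for s
    using T_max[OF Z] root_pair_bracket_commutes[OF \<phi> XY] unfolding Z_def by blast
  obtain \<mu> where \<mu>: "\<And>s. \<phi> (exp (s *\<^sub>R Z)) = cis (\<mu> * s)"
    using unitary_char_one_parameter[OF \<phi> ZT] by blast
  have brackets: "Z * X - X * Z = - (\<mu> *\<^sub>R Y)" "Z * Y - Y * Z = \<mu> *\<^sub>R X"
  proof -
    \<comment> \<open>Both sides of the eigenvector equation at \<open>t = exp (s Z)\<close> are
      differentiated at \<open>s = 0\<close>.\<close>
    have dl: "((\<lambda>s. exp (s *\<^sub>R Z) * A) has_vector_derivative Z * A) (at 0)" for A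
      using has_vector_derivative_mult[OF exp_scaleR_has_vector_derivative_right[of Z 0 UNIV]
          has_vector_derivative_const[of A]] by simp
    have dc: "((\<lambda>s. cos (\<mu> * s)) has_vector_derivative 0) (at 0)"
      and ds: "((\<lambda>s. sin (\<mu> * s)) has_vector_derivative \<mu>) (at 0)"
      by (auto intro!: derivative_eq_intros simp: has_real_derivative_iff_has_vector_derivative[symmetric])
    have dr: "((\<lambda>s. (cos (\<mu> * s) *\<^sub>R A + sin (\<mu> * s) *\<^sub>R B) * exp (s *\<^sub>R Z)) has_vector_derivative
        A * Z + \<mu> *\<^sub>R B) (at 0)" for A B
    proof -
      have "((\<lambda>s. cos (\<mu> * s) *\<^sub>R A + sin (\<mu> * s) *\<^sub>R B) has_vector_derivative \<mu> *\<^sub>R B) (at 0)"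
        by (auto intro!: derivative_eq_intros simp: has_real_derivative_iff_has_vector_derivative[symmetric])
      from has_vector_derivative_mult[OF this exp_scaleR_has_vector_derivative_right[of Z 0 UNIV]]
      show ?thesis by simp
    qed
    have "(\<lambda>s. exp (s *\<^sub>R Z) * X) = (\<lambda>s. (cos (\<mu> * s) *\<^sub>R X + sin (\<mu> * s) *\<^sub>R (- Y)) * exp (s *\<^sub>R Z))"
      using rX[OF ZT] by (simp add: \<mu>)
    with dl[of X] dr[of X "- Y"] have "Z * X = X * Z + \<mu> *\<^sub>R (- Y)"
      using vector_derivative_unique_at by metis
    then show "Z * X - X * Z = - (\<mu> *\<^sub>R Y)" by simp
    have "(\<lambda>s. exp (s *\<^sub>R Z) * Y) = (\<lambda>s. (cos (\<mu> * s) *\<^sub>R Y + sin (\<mu> * s) *\<^sub>R X) * exp (s *\<^sub>R Z))"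
      using rY[OF ZT] by (simp add: \<mu> add.commute)
    with dl[of Y] dr[of Y X] have "Z * Y = Y * Z + \<mu> *\<^sub>R X"
      using vector_derivative_unique_at by metis
    then show "Z * Y - Y * Z = \<mu> *\<^sub>R X" by simp
  qed
  \<comment> \<open>Invariance of the trace form: the pairing of [X, Y] with Z equals that of [Z, X]
    with Y. Both \<open>\<tau> (Z * Z)\<close> and \<open>\<tau> (Y * Y)\<close> being non-positive,
    the sign of \<open>\<mu>\<close> follows.\<close>
  have "\<tau> (Z * Z) = \<tau> (Z * (X * Y)) - \<tau> (Z * (Y * X))"
    by (simp add: Z_def \<tau>.diff[symmetric] algebra_simps)
  also have "\<tau> (Z * (Y * X)) = \<tau> (X * Z * Y)" using \<tau>_comm[of "Z * Y" X] by (simp add: mult.assoc)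
  also have "\<tau> (Z * (X * Y)) - \<tau> (X * Z * Y) = \<tau> ((Z * X - X * Z) * Y)"
    by (simp add: \<tau>.diff[symmetric] algebra_simps)
  also have "\<dots> = - \<mu> * \<tau> (Y * Y)" unfolding brackets by (simp add: \<tau>.neg \<tau>.scaleR)
  finally have pos: "- \<mu> * \<tau> (Y * Y) < 0" using \<tau>_neg[OF Z Z0] by simp
  moreover have "\<tau> (Y * Y) \<le> 0" using \<tau>_neg[OF Y] \<tau>.zero by (cases "Y = 0") auto
  ultimately have "\<mu> < 0" by (smt (verit, best) mult_minus_left mult_nonneg_nonpos2 mult_nonneg_nonpos)
  define \<kappa> where "\<kappa> = - \<mu>"
  have \<kappa>: "\<kappa> > 0" using \<open>\<mu> < 0\<close> by (simp add: \<kappa>_def)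
  \<comment> \<open>Dividing \<open>Z\<close> by \<open>\<kappa>\<close> turns its brackets with
    \<open>X\<close> and \<open>Y\<close> into unit rotations; \<open>[X, Y] = Z\<close> is then
    preserved if \<open>X\<close> and \<open>Y\<close> are scaled by a number with square
    \<open>1 / \<kappa>\<close>.\<close>
  define a where "a = 1 / sqrt \<kappa>"
  have aa: "a * a = 1 / \<kappa>" using \<kappa> by (simp add: a_def)
  define X' Y' Z' where "X' = a *\<^sub>R X" and "Y' = a *\<^sub>R Y" and "Z' = (1 / \<kappa>) *\<^sub>R Z"
  have r1: "X' * Y' - Y' * X' = Z'"
    by (simp add: X'_def Y'_def Z'_def Z_def aa scaleR_diff_right)
  have r2: "Y' * Z' - Z' * Y' = X'"
  proof -
    have "Y' * Z' - Z' * Y' = (- a / \<kappa>) *\<^sub>R (Z * Y - Y * Z)"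
      by (simp add: X'_def Y'_def Z'_def scaleR_diff_right)
    also have "\<dots> = X'" unfolding brackets X'_def \<kappa>_def using \<open>\<mu> < 0\<close> by simp
    finally show ?thesis .
  qed
  have r3: "Z' * X' - X' * Z' = Y'"
  proof -
    have "Z' * X' - X' * Z' = (a / \<kappa>) *\<^sub>R (Z * X - X * Z)"
      by (simp add: X'_def Y'_def Z'_def scaleR_diff_right)
    also have "\<dots> = Y'" unfolding brackets Y'_def \<kappa>_def using \<open>\<mu> < 0\<close> by simp
    finally show ?thesis .
  qed
  show ?thesis
  proof (rule that[of X' Z'])
    show "X' \<in> lie" unfolding X'_def by (rule lie_scaleR[OF X])
    show "exp (s *\<^sub>R Z') \<in> T" for s using ZT[of "s / \<kappa>"] by (simp add: Z'_def)
    show "\<phi> (exp (s *\<^sub>R Z')) = cis (- s)" for s using \<mu>[of "s / \<kappa>"] \<kappa> by (simp add: Z'_def \<kappa>_def)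
    show "exp ((4 * pi) *\<^sub>R Z') = 1" "exp (pi *\<^sub>R X') * Z' = - Z' * exp (pi *\<^sub>R X')"
      using su2_relations[OF r1 r2 r3] by auto
    show "t * X' = X' * t" if "t \<in> T" "\<phi> t = 1" for t
      using rX[OF that(1)] that(2) by (simp add: X'_def)
  qed
qed

text \<open>Write \<open>t = r z\<close> with \<open>z = exp (s Z')\<close> and \<open>\<phi> r = 1\<close>. Then \<open>r\<close> commutes with \<open>n = exp (\<pi> X')\<close>,
  while conjugation by \<open>n\<close> inverts \<open>z\<close>.\<close>

lemma root_reflection:
  assumes \<phi>: "unitary_char \<phi>" and XY: "root_pair \<phi> X Y" and nontriv: "\<exists>t\<in>T. \<phi> t \<noteq> 1"
  obtains n n' where "n \<in> G" "n' \<in> G" "n * n' = 1" "n' * n = 1"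
    "\<And>t. t \<in> T \<Longrightarrow> n * t * n' \<in> T" "\<And>t. t \<in> T \<Longrightarrow> n' * t * n \<in> T"
    "\<And>t. t \<in> T \<Longrightarrow> \<phi> (n' * t * n) * \<phi> t = 1"
    "\<And>\<psi>. unitary_char \<psi> \<Longrightarrow> \<exists>k::int. \<forall>t\<in>T. \<psi> (n' * t * n) = \<psi> t * \<phi> t powi k"
proof -
  obtain X' Z' where X': "X' \<in> lie" and ZT: "\<And>s. exp (s *\<^sub>R Z') \<in> T"
    and \<phi>Z: "\<And>s. \<phi> (exp (s *\<^sub>R Z')) = cis (- s)"
    and per: "exp ((4 * pi) *\<^sub>R Z') = 1"
    and neg: "exp (pi *\<^sub>R X') * Z' = - Z' * exp (pi *\<^sub>R X')"
    and comm: "\<And>t. t \<in> T \<Longrightarrow> \<phi> t = 1 \<Longrightarrow> t * X' = X' * t"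
    using root_su2[OF assms] by blast
  define n n' where "n = exp (pi *\<^sub>R X')" and "n' = exp (- (pi *\<^sub>R X'))"
  have inv: "n * n' = 1" "n' * n = 1"
    unfolding n_def n'_def by (rule exp_minus_inverse exp_minus_inverse')+
  have nZ: "n * Z' * n' = - Z'" using neg inv by (simp add: n_def[symmetric] mult.assoc)
  have n'Z: "n' * Z' * n = - Z'"
  proof -
    have "n' * Z' * n = - (n' * (n * Z' * n') * n)" unfolding nZ by simp
    also have "\<dots> = - ((n' * n) * Z' * (n' * n))" by (simp only: mult.assoc)
    finally show ?thesis by (simp add: inv)
  qed
  \<comment> \<open>Conjugation by \<open>n\<close> replaces the factor \<open>z\<close> of
    \<open>t = r * z\<close> by its inverse, that is, multiplies \<open>t\<close> by the inverse
    square of \<open>z\<close>. The reflection is an involution on \<open>T\<close>, so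
    \<open>n'\<close> acts in the same way.\<close>
  have key: "\<exists>s. \<phi> t = cis (- s) \<and> n * t * n' = t * exp ((- (2 * s)) *\<^sub>R Z')
      \<and> n' * t * n = t * exp ((- (2 * s)) *\<^sub>R Z')" if t: "t \<in> T" for t
  proof -
    have "cmod (\<phi> t) = 1" using \<phi> t by (simp add: unitary_char_def)
    then obtain u where u: "\<phi> t = cis u" by (metis complex_norm_eq_1_exp_eq cis_conv_exp)
    \<comment> \<open>The sign matches \<open>\<phi>Z\<close>, so that
      \<open>\<phi> z = \<phi> t\<close> and the remaining factor \<open>r\<close> lies in the
      kernel of \<open>\<phi>\<close>.\<close>
    define s where "s = - u"
    define z z' where "z = exp (s *\<^sub>R Z')" and "z' = exp ((- s) *\<^sub>R Z')"
    have zT: "z \<in> T" "z' \<in> T" by (auto simp: z_def z'_def ZT simp del: scaleR_minus_left)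
    have zz: "z' * z = 1" unfolding z_def z'_def by (simp add: exp_minus_inverse')
    define r where "r = t * z'"
    have rT: "r \<in> T" unfolding r_def using t zT T_mult by blast
    have "\<phi> r = \<phi> t * \<phi> z'" unfolding r_def using \<phi> t zT by (simp add: unitary_char_def)
    also have "\<dots> = 1" unfolding z'_def \<phi>Z u s_def by (simp add: cis_mult)
    finally have r1: "r * X' = X' * r" using comm rT by blast
    have t_eq: "t = r * z" unfolding r_def by (simp add: mult.assoc zz)
    have rn: "r * n = n * r" "r * n' = n' * r"
      unfolding n_def n'_def by (intro exp_commute; simp add: r1)+
    have nzn: "n * z * n' = z'" "n' * z * n = z'"
    proof -
      show "n * z * n' = z'"
        using exp_conjugate[of n' n "s *\<^sub>R Z'"] inv nZ by (simp add: z_def z'_def)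
      show "n' * z * n = z'"
        using exp_conjugate[of n n' "s *\<^sub>R Z'"] inv n'Z by (simp add: z_def z'_def)
    qed
    have e: "z' * z' = exp ((- (2 * s)) *\<^sub>R Z')"
      using exp_scaleR_add[of "- s" "- s" Z'] by (simp add: z'_def)
    have "n * t * n' = r * (n * z * n')" unfolding t_eq by (metis mult.assoc rn(1))
    then have 1: "n * t * n' = t * (z' * z')" unfolding nzn r_def by (simp add: mult.assoc)
    have "n' * t * n = r * (n' * z * n)" unfolding t_eq by (metis mult.assoc rn(2))
    then have 2: "n' * t * n = t * (z' * z')" unfolding nzn r_def by (simp add: mult.assoc)
    show ?thesis using 1 2 u unfolding e s_def by (intro exI[of _ "- u"]) simp
  qed
  show ?thesis
  proof (rule that[of n n'])
    show "n \<in> G" "n' \<in> G"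
      using lie_exp[OF X', of pi] lie_exp[OF X', of "- pi"] by (simp_all add: n_def n'_def)
    show "n * n' = 1" "n' * n = 1" by (fact inv)+
    show "n * t * n' \<in> T" "n' * t * n \<in> T" if "t \<in> T" for t
      using key[OF that] T_mult[OF that ZT] by metis+
    show "\<phi> (n' * t * n) * \<phi> t = 1" if t: "t \<in> T" for t
    proof -
      obtain s where s: "\<phi> t = cis (- s)" "n' * t * n = t * exp ((- (2 * s)) *\<^sub>R Z')"
        using key[OF t] by blast
      have "\<phi> (n' * t * n) = \<phi> t * \<phi> (exp ((- (2 * s)) *\<^sub>R Z'))"
        unfolding s(2) using \<phi> t ZT by (simp add: unitary_char_def del: scaleR_minus_left)
      then show ?thesis unfolding \<phi>Z s(1) by (simp add: cis_mult)
    qed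
    show "\<exists>k::int. \<forall>t\<in>T. \<psi> (n' * t * n) = \<psi> t * \<phi> t powi k" if \<psi>: "unitary_char \<psi>" for \<psi>
    proof -
      obtain \<kappa> where \<kappa>: "\<And>s. \<psi> (exp (s *\<^sub>R Z')) = cis (\<kappa> * s)"
        using unitary_char_one_parameter[OF \<psi> ZT] by blast
      \<comment> \<open>Period \<open>4 * pi\<close> makes \<open>\<kappa>\<close> only
        half-integral. The factor 2 in the parameter \<open>- (2 * s)\<close> compensates, which is
        why the exponent \<open>k = 2 * \<kappa>\<close> is an integer.\<close>
      have "cis (\<kappa> * (4 * pi)) = 1" using \<kappa>[of "4 * pi"] per unitary_char_one[OF \<psi>] by simp
      then have "cos (\<kappa> * (4 * pi)) = 1" by (simp add: complex_eq_iff)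
      then obtain k :: int where "\<kappa> * (4 * pi) = of_int k * 2 * pi"
        using cos_one_2pi_int by blast
      then have k: "2 * \<kappa> = of_int k" by simp
      have "\<psi> (n' * t * n) = \<psi> t * \<phi> t powi k" if t: "t \<in> T" for t
      proof -
        obtain s where s: "\<phi> t = cis (- s)" "n' * t * n = t * exp ((- (2 * s)) *\<^sub>R Z')"
          using key[OF t] by blast
        have "\<psi> (n' * t * n) = \<psi> t * cis (\<kappa> * (- (2 * s)))"
          unfolding s(2) \<kappa>[symmetric] using \<psi> t ZT by (simp add: unitary_char_def del: scaleR_minus_left)
        also have "\<kappa> * (- (2 * s)) = of_int k * (- s)" using k by (simp add: algebra_simps)
        also have "cis (of_int k * (- s)) = \<phi> t powi k" unfolding s(1) by (rule cis_power_int[symmetric])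
        finally show ?thesis .
      qed
      then show ?thesis by blast
    qed
  qed
qed

end

section \<open>Matrices\<close>

text \<open>The product on \<open>real^'n^'n\<close> provided by the library is componentwise, so the Banach
  algebra of matrices (in which the exponential series is available) is a type of its own.\<close>

typedef 'n sqmat = "UNIV :: ((real^'n::finite) \<Rightarrow>\<^sub>L (real^'n)) set" ..

setup_lifting type_definition_sqmat

instantiation sqmat :: (finite) real_algebra_1
begin

lift_definition zero_sqmat :: "'a sqmat" is 0 .
lift_definition one_sqmat :: "'a sqmat" is id_blinfun .
lift_definition plus_sqmat :: "'a sqmat \<Rightarrow> 'a sqmat \<Rightarrow> 'a sqmat" is "(+)" .
lift_definition minus_sqmat :: "'a sqmat \<Rightarrow> 'a sqmat \<Rightarrow> 'a sqmat" is "(-)" .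
lift_definition uminus_sqmat :: "'a sqmat \<Rightarrow> 'a sqmat" is uminus .
lift_definition times_sqmat :: "'a sqmat \<Rightarrow> 'a sqmat \<Rightarrow> 'a sqmat" is blinfun_compose .
lift_definition scaleR_sqmat :: "real \<Rightarrow> 'a sqmat \<Rightarrow> 'a sqmat" is scaleR .

instance
proof
  have "(0 :: (real^'a) \<Rightarrow>\<^sub>L (real^'a)) \<noteq> id_blinfun"
  proof
    assume "(0 :: (real^'a) \<Rightarrow>\<^sub>L (real^'a)) = id_blinfun"
    then have "norm (id_blinfun :: (real^'a) \<Rightarrow>\<^sub>L (real^'a)) = 0" using norm_zero by metis
    then show False by simp
  qed
  then show "(0 :: 'a sqmat) \<noteq> 1" by transfer
qed (transfer; auto simp: algebra_simps blinfun.bilinear_simps intro!: blinfun_eqI)+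

end

instantiation sqmat :: (finite) real_normed_algebra_1
begin

lift_definition norm_sqmat :: "'a sqmat \<Rightarrow> real" is norm .
definition dist_sqmat :: "'a sqmat \<Rightarrow> 'a sqmat \<Rightarrow> real" where "dist_sqmat x y = norm (x - y)"
definition sgn_sqmat :: "'a sqmat \<Rightarrow> 'a sqmat" where "sgn_sqmat x = x /\<^sub>R norm x"
definition uniformity_sqmat :: "('a sqmat \<times> 'a sqmat) filter" where
  "uniformity_sqmat = (INF e\<in>{0<..}. principal {(x, y). dist x y < e})"
definition open_sqmat :: "'a sqmat set \<Rightarrow> bool" where
  "open_sqmat U = (\<forall>x\<in>U. \<forall>\<^sub>F (x', y) in uniformity. x' = x \<longrightarrow> y \<in> U)"

instance
proof
  fix x y :: "'a sqmat" and r :: real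
  show "dist x y = norm (x - y)" by (rule dist_sqmat_def)
  show "sgn x = x /\<^sub>R norm x" by (rule sgn_sqmat_def)
  show "uniformity = (INF e\<in>{0<..}. principal {(x, y :: 'a sqmat). dist x y < e})"
    by (rule uniformity_sqmat_def)
  show "open U = (\<forall>x\<in>U. \<forall>\<^sub>F (x', y) in uniformity. x' = x \<longrightarrow> y \<in> U)" for U :: "'a sqmat set"
    by (rule open_sqmat_def)
  show "norm x = 0 \<longleftrightarrow> x = 0" by transfer simp
  show "norm (x + y) \<le> norm x + norm y" by transfer (rule norm_triangle_ineq)
  show "norm (r *\<^sub>R x) = \<bar>r\<bar> * norm x" by transfer simp
  show "norm (x * y) \<le> norm x * norm y" by transfer (rule norm_blinfun_compose)
  show "norm (1 :: 'a sqmat) = 1" by transfer (rule norm_blinfun_id)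
qed

end

lemma dist_Rep_sqmat: "dist x y = dist (Rep_sqmat x) (Rep_sqmat y)"
  by (simp add: dist_norm norm_sqmat.rep_eq minus_sqmat.rep_eq)

instance sqmat :: (finite) banach
proof
  fix X :: "nat \<Rightarrow> 'a sqmat" assume "Cauchy X"
  then have "Cauchy (\<lambda>n. Rep_sqmat (X n))"
    unfolding Cauchy_def by (simp add: dist_Rep_sqmat)
  then obtain L where "(\<lambda>n. Rep_sqmat (X n)) \<longlonglongrightarrow> L" using Cauchy_convergent convergent_def by blast
  then have "X \<longlonglongrightarrow> Abs_sqmat L"
    unfolding tendsto_iff by (simp add: dist_Rep_sqmat Abs_sqmat_inverse)
  then show "convergent X" by (auto simp: convergent_def)
qed

section \<open>Dictionary between matrices and the Banach algebra\<close>

definition of_mat :: "real^'n^'n \<Rightarrow> 'n::finite sqmat" where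
  "of_mat A = Abs_sqmat (Blinfun ((*v) A))"

definition to_mat :: "'n::finite sqmat \<Rightarrow> real^'n^'n" where
  "to_mat f = matrix (blinfun_apply (Rep_sqmat f))"

lemma apply_of_mat [simp]: "blinfun_apply (Rep_sqmat (of_mat A)) = (*v) A"
  by (simp add: of_mat_def Abs_sqmat_inverse bounded_linear_Blinfun_apply)

lemma sqmat_eqI: "(\<And>x. blinfun_apply (Rep_sqmat f) x = blinfun_apply (Rep_sqmat g) x) \<Longrightarrow> f = g"
  by (metis Rep_sqmat_inject blinfun_eqI)

lemma to_of_mat [simp]: "to_mat (of_mat A) = A"
  by (simp add: to_mat_def)

lemma of_to_mat [simp]: "of_mat (to_mat f) = f"
  by (rule sqmat_eqI) (simp add: to_mat_def matrix_works blinfun.bounded_linear_right bounded_linear.linear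
      linear_matrix_vector_mul_eq[symmetric])

lemma of_mat_mult: "of_mat (A ** B) = of_mat A * of_mat B"
  by (rule sqmat_eqI) (simp add: times_sqmat.rep_eq matrix_vector_mul_assoc)

lemma to_mat_mult: "to_mat (f * g) = to_mat f ** to_mat g"
  by (metis of_mat_mult of_to_mat to_of_mat)

lemma of_mat_one: "of_mat (mat 1) = 1"
  by (rule sqmat_eqI) (simp add: one_sqmat.rep_eq)

lemma to_mat_one: "to_mat 1 = mat 1"
  by (metis of_mat_one to_of_mat)

lemma of_mat_inject: "of_mat A = of_mat B \<longleftrightarrow> A = B"
  by (metis to_of_mat)

lemma linear_of_mat: "linear of_mat"
  by (rule linearI; rule sqmat_eqI)
    (simp_all add: plus_sqmat.rep_eq scaleR_sqmat.rep_eq blinfun.bilinear_simps matrix_vector_mult_add_rdistrib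
      scaleR_matrix_vector_assoc)

lemma bounded_linear_of_mat: "bounded_linear of_mat"
  using linear_of_mat linear_conv_bounded_linear by blast

lemma bounded_linear_to_mat: "bounded_linear (to_mat :: 'n::finite sqmat \<Rightarrow> _)"
proof (rule bounded_linear_intro)
  show "to_mat (f + g) = to_mat f + to_mat g" for f g :: "'n sqmat"
    using arg_cong[OF linear_add[OF linear_of_mat, of "to_mat f" "to_mat g"], of to_mat] by simp
  show "to_mat (r *\<^sub>R f) = r *\<^sub>R to_mat f" for r and f :: "'n sqmat"
    using arg_cong[OF linear_cmul[OF linear_of_mat, of r "to_mat f"], of to_mat] by simp
  show "norm (to_mat f) \<le> norm f * (\<Sum>i\<in>(UNIV::'n set). \<Sum>j\<in>(UNIV::'n set). 1)" for f :: "'n sqmat"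
  proof -
    have e: "\<bar>to_mat f $ i $ j\<bar> \<le> norm f" for i j
    proof -
      have "\<bar>to_mat f $ i $ j\<bar> \<le> norm (blinfun_apply (Rep_sqmat f) (axis j 1))"
        by (simp add: to_mat_def matrix_def component_le_norm_cart)
      also have "\<dots> \<le> norm f" using norm_blinfun[of "Rep_sqmat f" "axis j 1"] by (simp add: norm_sqmat.rep_eq)
      finally show ?thesis .
    qed
    have "norm (to_mat f) \<le> (\<Sum>i\<in>UNIV. norm (to_mat f $ i))"
      unfolding norm_vec_def by (rule L2_set_le_sum) simp
    also have "\<dots> \<le> (\<Sum>i\<in>(UNIV::'n set). \<Sum>j\<in>(UNIV::'n set). norm f)"
      by (intro sum_mono order_trans[OF norm_le_l1_cart] e)
    finally show ?thesis by (simp add: sum_distrib_left mult_ac)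
  qed
qed

section \<open>Back to compact groups of orthogonal matrices\<close>

lemma bounded_bilinear_matrix_mult:
  "bounded_bilinear ((**) :: real^'n^'n \<Rightarrow> real^'n^'n \<Rightarrow> real^'n^'n)"
proof -
  have "bilinear ((**) :: real^'n^'n \<Rightarrow> real^'n^'n \<Rightarrow> real^'n^'n)"
    unfolding bilinear_def
    by (auto intro!: linearI simp: vec_eq_iff matrix_matrix_mult_def sum.distrib sum_distrib_left algebra_simps)
  then show ?thesis by (simp add: bilinear_conv_bounded_bilinear)
qed

text \<open>\<open>T\<close> and \<open>r\<close> generate a connected abelian group. It may fail to
  be closed, but its closure \<open>S\<close> is a torus in \<open>G\<close> containing
  \<open>T\<close>, so \<open>S = T\<close> by maximality.\<close>

lemma torus_extension:
  fixes G T :: "(real^'n^'n) set"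
  assumes G: "compact_lie_group G" and max: "maximal_torus G T"
    and r: "\<And>s. r s \<in> G" "continuous_on UNIV r" "r 0 = mat 1" "\<And>s u. r (s + u) = r s ** r u"
    and comm: "\<And>t s. t \<in> T \<Longrightarrow> t ** r s = r s ** t"
  shows "r (s::real) \<in> T"
proof -
  interpret mm: bounded_bilinear "(**) :: real^'n^'n \<Rightarrow> real^'n^'n \<Rightarrow> real^'n^'n"
    by (rule bounded_bilinear_matrix_mult)
  have T: "compact T" "mat 1 \<in> T" "\<And>t. t \<in> T \<Longrightarrow> transpose t \<in> T" "\<And>s t. s \<in> T \<Longrightarrow> t \<in> T \<Longrightarrow> s ** t \<in> T"
    "connected T" "\<And>s t. s \<in> T \<Longrightarrow> t \<in> T \<Longrightarrow> s ** t = t ** s" "T \<subseteq> G"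
    using max by (auto simp: maximal_torus_def torus_def compact_lie_group_def)
  define K where "K = (\<lambda>(t, s). t ** r s) ` (T \<times> (UNIV :: real set))"
  define S where "S = closure K"
  have Kc: "t ** r s \<in> K" if "t \<in> T" for t s using that by (auto simp: K_def)
  have Kmult: "x ** y \<in> K" and Kcomm: "x ** y = y ** x" if x: "x \<in> K" and y: "y \<in> K" for x y
  proof -
    obtain t s t' s' where x: "x = t ** r s" "t \<in> T" and y: "y = t' ** r s'" "t' \<in> T"
      using x y by (auto simp: K_def)
    have prod: "(t ** r s) ** (t' ** r s') = (t ** t') ** r (s + s')" if "t' \<in> T" for t t' s s'
    proof -
      have "(t ** r s) ** (t' ** r s') = t ** (r s ** t') ** r s'" by (simp add: matrix_mul_assoc)
      also have "r s ** t' = t' ** r s" using comm[OF that] by simp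
      finally show ?thesis by (simp add: matrix_mul_assoc r(4))
    qed
    show "x ** y \<in> K" unfolding x y prod[OF y(2)] using T(4) x y by (intro Kc)
    show "x ** y = y ** x" unfolding x y prod[OF y(2)] prod[OF x(2)] using T(6) x y by (simp add: add.commute)
  qed
  have rinv: "transpose (r s) = r (- s)" for s
  proof -
    have o: "transpose (r s) ** r s = mat 1" using r(1) G by (simp add: compact_lie_group_def orthogonal_matrix_def)
    have "transpose (r s) = transpose (r s) ** (r s ** r (- s))" by (simp add: r(3) r(4)[symmetric])
    then show ?thesis by (simp add: matrix_mul_assoc o)
  qed
  have Ktrans: "transpose x \<in> K" if K: "x \<in> K" for x
  proof -
    obtain t s where x: "x = t ** r s" "t \<in> T" using K by (auto simp: K_def)
    then have "transpose x = transpose t ** r (- s)" using comm[OF T(3)] by (simp add: matrix_transpose_mul rinv)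
    then show ?thesis using Kc T(3) x by simp
  qed
  have "K \<subseteq> G" using T(7) r(1) G by (auto simp: K_def compact_lie_group_def)
  moreover have "closed G" using G by (simp add: compact_lie_group_def compact_imp_closed)
  ultimately have SG: "S \<subseteq> G" unfolding S_def by (rule closure_minimal)
  have compS: "compact S"
    using G SG unfolding S_def by (metis closed_closure compact_Int_closed compact_lie_group_def inf.absorb_iff2)
  have "connected K" unfolding K_def
  proof (rule connected_continuous_image)
    show "connected (T \<times> (UNIV :: real set))" using T(5) by (simp add: connected_Times)
    show "continuous_on (T \<times> UNIV) (\<lambda>(t, s). t ** r s)"
      unfolding case_prod_beta
      by (intro mm.continuous_on continuous_intros continuous_on_compose2[OF r(2)]) auto
  qed
  then have connS: "connected S" unfolding S_def by (rule connected_imp_connected_closure)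
  \<comment> \<open>Products and commutators are jointly continuous, so passing to the closure of
    \<open>K \<times> K\<close> extends closure under products and commutativity to
    \<open>S\<close>.\<close>
  have pair: "(x, y) \<in> closure (K \<times> K)" if "x \<in> S" "y \<in> S" for x y
    using that by (simp add: S_def closure_Times)
  have Smult: "x ** y \<in> S" if "x \<in> S" "y \<in> S" for x y
  proof -
    have "(\<lambda>p. fst p ** snd p) ` closure (K \<times> K) \<subseteq> S"
      unfolding S_def
      by (rule image_closure_subset) (auto intro!: mm.continuous_on continuous_intros closure_subset[THEN subsetD] Kmult)
    from subsetD[OF this imageI[OF pair[OF that]]] show ?thesis by simp
  qed
  have Scomm: "x ** y = y ** x" if "x \<in> S" "y \<in> S" for x y
  proof -
    have "(\<lambda>p. fst p ** snd p - snd p ** fst p) ` closure (K \<times> K) \<subseteq> {0}"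
      by (rule image_closure_subset) (auto intro!: mm.continuous_on continuous_intros Kcomm)
    from subsetD[OF this imageI[OF pair[OF that]]] show ?thesis by simp
  qed
  have "continuous_on (closure K) (transpose :: real^'n^'n \<Rightarrow> real^'n^'n)"
    by (intro linear_continuous_on linear_conv_bounded_linear[THEN iffD1] linearI)
      (simp_all add: transpose_def vec_eq_iff)
  then have "transpose ` closure K \<subseteq> S"
    unfolding S_def by (rule image_closure_subset) (auto intro!: closure_subset[THEN subsetD] Ktrans)
  then have Strans: "transpose x \<in> S" if "x \<in> S" for x using that by (auto simp: S_def)
  have TS: "T \<subseteq> S"
    using Kc[of _ 0] r(3) closure_subset unfolding S_def by fastforce
  have "torus S"
    unfolding torus_def compact_lie_group_def
    using compS connS Smult Scomm Strans SG TS T(2) G by (auto simp: compact_lie_group_def)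
  then have "S = T" using max TS SG by (simp add: maximal_torus_def)
  moreover have "r s \<in> S" using Kc[OF T(2), of s] closure_subset unfolding S_def by fastforce
  ultimately show ?thesis by simp
qed

text \<open>The reflection constructed in the Banach algebra, carried back to matrices. Its inverse
  there is unique and must be the transpose, so the reflecting element normalizes \<open>T\<close>
  in the sense of \<open>normalizer\<close>.\<close>

lemma weyl_reflection_exists:
  fixes G T :: "(real^'n^'n) set"
  assumes G: "compact_lie_group G" and max: "maximal_torus G T" and \<phi>: "\<phi> \<in> roots G T"
  obtains n where "n \<in> normalizer G T"
    "\<And>t. t \<in> T \<Longrightarrow> \<phi> (transpose n ** t ** n) * \<phi> t = 1"
    "\<And>\<psi>. \<psi> \<in> characters T \<Longrightarrow> \<exists>k::int. \<forall>t\<in>T. \<psi> (transpose n ** t ** n) = \<psi> t * \<phi> t powi k"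
proof -
  have T: "compact T" "mat 1 \<in> T" "\<And>t. t \<in> T \<Longrightarrow> transpose t \<in> T" "\<And>s t. s \<in> T \<Longrightarrow> t \<in> T \<Longrightarrow> s ** t \<in> T"
    "connected T" "\<And>s t. s \<in> T \<Longrightarrow> t \<in> T \<Longrightarrow> s ** t = t ** s" "T \<subseteq> G"
    using max by (auto simp: maximal_torus_def torus_def compact_lie_group_def)
  have G': "compact G" "mat 1 \<in> G" "\<And>g. g \<in> G \<Longrightarrow> transpose g ** g = mat 1" "\<And>g. g \<in> G \<Longrightarrow> g ** transpose g = mat 1"
    "\<And>g h. g \<in> G \<Longrightarrow> h \<in> G \<Longrightarrow> g ** h \<in> G" "\<And>g. g \<in> G \<Longrightarrow> transpose g \<in> G"
    using G by (auto simp: compact_lie_group_def orthogonal_matrix_def orthogonal_matrix)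
  have cont_of: "continuous_on U of_mat" for U :: "(real^'n^'n) set"
    by (intro linear_continuous_on bounded_linear_of_mat)
  have cont_to: "continuous_on U to_mat" for U :: "'n sqmat set"
    by (intro linear_continuous_on bounded_linear_to_mat)
  define tr where "tr x = trace (to_mat x)" for x :: "'n sqmat"
  interpret M: closed_matrix_monoid "of_mat ` G"
  proof
    have "compact (of_mat ` G)" by (intro compact_continuous_image cont_of G')
    then show "closed (of_mat ` G)" "bounded (of_mat ` G)" by (auto intro: compact_imp_closed compact_imp_bounded)
    show "1 \<in> of_mat ` G" using G'(2) of_mat_one by (metis imageI)
    show "x * y \<in> of_mat ` G" if "x \<in> of_mat ` G" "y \<in> of_mat ` G" for x y
      using that G'(5) by (auto simp: of_mat_mult[symmetric])
  qed
  have expG: "to_mat (exp (s *\<^sub>R Z)) \<in> G" if "Z \<in> M.lie" for s Z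
    using M.lie_exp[OF that, of s] by auto
  have exp_cont: "continuous_on UNIV (\<lambda>s. exp (s *\<^sub>R Z))" for Z :: "'n sqmat"
    using exp_scaleR_has_vector_derivative_right has_vector_derivative_continuous
    by (metis continuous_at_imp_continuous_on)
  \<comment> \<open>Transpose and inverse agree on \<open>G\<close>; differentiating this along
    \<open>exp (s Z)\<close> at 0 gives skewness. The trace of \<open>Z * Z\<close> is then minus
    the sum of the squared entries.\<close>
  have skew: "transpose (to_mat Z) = - to_mat Z" if Z: "Z \<in> M.lie" for Z
  proof -
    have lt: "bounded_linear (\<lambda>x::'n sqmat. transpose (to_mat x))"
    proof -
      have "bounded_linear (transpose :: real^'n^'n \<Rightarrow> real^'n^'n)"
        by (intro linear_conv_bounded_linear[THEN iffD1] linearI) (simp_all add: transpose_def vec_eq_iff)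
      from bounded_linear_compose[OF this bounded_linear_to_mat] show ?thesis .
    qed
    have "transpose (to_mat (exp (s *\<^sub>R Z))) = to_mat (exp (s *\<^sub>R (- Z)))" for s
    proof -
      have "to_mat (exp (s *\<^sub>R Z)) ** to_mat (exp (s *\<^sub>R (- Z))) = mat 1"
        by (simp add: to_mat_mult[symmetric] exp_minus_inverse to_mat_one)
      then have "transpose (to_mat (exp (s *\<^sub>R Z))) ** (to_mat (exp (s *\<^sub>R Z)) ** to_mat (exp (s *\<^sub>R (- Z))))
          = transpose (to_mat (exp (s *\<^sub>R Z)))" by simp
      then show ?thesis using G'(3)[OF expG[OF Z]] by (simp add: matrix_mul_assoc)
    qed
    then have "(\<lambda>s. transpose (to_mat (exp (s *\<^sub>R Z)))) = (\<lambda>s. to_mat (exp (s *\<^sub>R (- Z))))" by blast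
    moreover have "((\<lambda>s. transpose (to_mat (exp (s *\<^sub>R Z)))) has_vector_derivative transpose (to_mat Z)) (at 0)"
      using bounded_linear.has_vector_derivative[OF lt exp_scaleR_has_vector_derivative_right[of Z 0 UNIV]] by simp
    moreover have "((\<lambda>s. to_mat (exp (s *\<^sub>R (- Z)))) has_vector_derivative to_mat (- Z)) (at 0)"
      using bounded_linear.has_vector_derivative[OF bounded_linear_to_mat exp_scaleR_has_vector_derivative_right[of "- Z" 0 UNIV]]
      by simp
    ultimately have "transpose (to_mat Z) = to_mat (- Z)" using vector_derivative_unique_at by metis
    then show ?thesis using linear_neg[OF bounded_linear.linear[OF bounded_linear_to_mat], of Z] by metis
  qed
  interpret R: matrix_torus "of_mat ` G" "of_mat ` T" tr
  proof (intro matrix_torus.intro matrix_torus_axioms.intro)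
    show "closed_matrix_monoid (of_mat ` G)" by (rule M.closed_matrix_monoid_axioms)
    show "of_mat ` T \<subseteq> of_mat ` G" using T(7) by blast
    show "connected (of_mat ` T)" by (intro connected_continuous_image cont_of T)
    show "1 \<in> of_mat ` T" using T(2) of_mat_one by (metis imageI)
    show "s * t \<in> of_mat ` T" if "s \<in> of_mat ` T" "t \<in> of_mat ` T" for s t
      using that T(4) by (auto simp: of_mat_mult[symmetric])
    show "s * t = t * s" if "s \<in> of_mat ` T" "t \<in> of_mat ` T" for s t
      using that T(6) by (auto simp: of_mat_mult[symmetric] of_mat_inject)
    show "\<exists>t'\<in>of_mat ` T. t * t' = 1" if t: "t \<in> of_mat ` T" for t
    proof -
      obtain u where u: "t = of_mat u" "u \<in> T" using t by blast
      then have "t * of_mat (transpose u) = 1" using G'(4) T(7) by (simp add: of_mat_mult[symmetric] of_mat_one subset_iff)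
      then show ?thesis using T(3) u by blast
    qed
    show "exp (s *\<^sub>R Z) \<in> of_mat ` T" if Z: "Z \<in> M.lie" and c: "\<And>t. t \<in> of_mat ` T \<Longrightarrow> t * Z = Z * t" for Z s
    proof -
      have "to_mat (exp (s *\<^sub>R Z)) \<in> T"
      proof (rule torus_extension[OF G max, where r = "\<lambda>s. to_mat (exp (s *\<^sub>R Z))"])
        show "to_mat (exp (s *\<^sub>R Z)) \<in> G" for s by (rule expG[OF Z])
        show "continuous_on UNIV (\<lambda>s. to_mat (exp (s *\<^sub>R Z)))"
          by (rule continuous_on_compose2[OF cont_to exp_cont]) auto
        show "to_mat (exp (0 *\<^sub>R Z)) = mat 1" by (simp add: to_mat_one)
        show "to_mat (exp ((s + u) *\<^sub>R Z)) = to_mat (exp (s *\<^sub>R Z)) ** to_mat (exp (u *\<^sub>R Z))" for s u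
          by (simp add: exp_scaleR_add to_mat_mult)
        show "t ** to_mat (exp (s *\<^sub>R Z)) = to_mat (exp (s *\<^sub>R Z)) ** t" if "t \<in> T" for t s
        proof -
          have "of_mat t * exp (s *\<^sub>R Z) = exp (s *\<^sub>R Z) * of_mat t"
            using c[of "of_mat t"] that by (intro exp_commute) simp
          then show ?thesis by (metis to_mat_mult to_of_mat)
        qed
      qed
      then show ?thesis by (metis imageI of_to_mat)
    qed
    have "bounded_linear (trace :: real^'n^'n \<Rightarrow> real)"
      by (intro linear_conv_bounded_linear[THEN iffD1] linearI)
        (simp_all add: trace_def sum.distrib sum_distrib_left)
    from bounded_linear_compose[OF this bounded_linear_to_mat] show "bounded_linear tr"
      by (simp add: tr_def[abs_def] o_def)
    show "tr (x * y) = tr (y * x)" for x y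
      unfolding tr_def to_mat_mult by (rule trace_mul_sym)
    show "tr (Z * Z) < 0" if Z: "Z \<in> M.lie" "Z \<noteq> 0" for Z
    proof -
      define A where "A = to_mat Z"
      have "of_mat A \<noteq> 0" using Z(2) by (simp add: A_def)
      then have "A \<noteq> 0" using linear_0[OF linear_of_mat] by auto
      have "A $ i $ k * A $ k $ i = - (A $ i $ k * A $ i $ k)" for i k
        using arg_cong[OF skew[OF Z(1)], of "\<lambda>B. B $ i $ k"] by (simp add: A_def transpose_def)
      then have "tr (Z * Z) = (\<Sum>i\<in>UNIV. \<Sum>k\<in>UNIV. - (A $ i $ k * A $ i $ k))"
        unfolding tr_def to_mat_mult A_def[symmetric] trace_def matrix_matrix_mult_def by simp
      also have "\<dots> = - (A \<bullet> A)" by (simp add: inner_vec_def sum_negf)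
      finally show ?thesis using \<open>A \<noteq> 0\<close> by simp
    qed
  qed
  have uc: "R.unitary_char (\<lambda>x. \<psi> (to_mat x))" if "\<psi> \<in> characters T" for \<psi>
  proof -
    have "to_mat ` of_mat ` T \<subseteq> T" by auto
    then show ?thesis unfolding R.unitary_char_def
    using that continuous_on_compose2[of T \<psi> "of_mat ` T" to_mat] cont_to
    by (auto simp: characters_def of_mat_mult[symmetric])
  qed
  have \<phi>c: "\<phi> \<in> characters T" using \<phi> by (simp add: roots_def)
  obtain X Y where X: "X \<in> lie_algebra G" and Y: "Y \<in> lie_algebra G" and XY0: "X \<noteq> 0 \<or> Y \<noteq> 0"
    and XY: "\<And>t. t \<in> T \<Longrightarrow> t ** X ** transpose t = Re (\<phi> t) *\<^sub>R X - Im (\<phi> t) *\<^sub>R Y"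
      "\<And>t. t \<in> T \<Longrightarrow> t ** Y ** transpose t = Im (\<phi> t) *\<^sub>R X + Re (\<phi> t) *\<^sub>R Y"
    using \<phi> by (auto simp: roots_def)
  have lie: "of_mat A \<in> M.lie" if "A \<in> lie_algebra G" for A
  proof -
    obtain \<gamma> where \<gamma>: "\<And>s. \<gamma> s \<in> G" "\<gamma> 0 = mat 1" "(\<gamma> has_vector_derivative A) (at (0::real))"
      using \<open>A \<in> lie_algebra G\<close> unfolding lie_algebra_def by blast
    have "((\<lambda>s. of_mat (\<gamma> s)) has_vector_derivative of_mat A) (at 0)"
      by (rule bounded_linear.has_vector_derivative[OF bounded_linear_of_mat \<gamma>(3)])
    then show ?thesis by (intro M.lieI_tangent[of "\<lambda>s. of_mat (\<gamma> s)"]) (auto simp: \<gamma> of_mat_one)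
  qed
  have conj: "of_mat t * of_mat A = of_mat B * of_mat t" if "t \<in> T" "t ** A ** transpose t = B" for t A B
  proof -
    have "B ** t = t ** A ** (transpose t ** t)" using that(2) by (simp add: matrix_mul_assoc)
    also have "transpose t ** t = mat 1" using G'(3) T(7) that(1) by blast
    finally show ?thesis by (simp add: of_mat_mult[symmetric])
  qed
  have "R.root_pair (\<lambda>x. \<phi> (to_mat x)) (of_mat X) (of_mat Y)"
    unfolding R.root_pair_def
  proof (intro conjI ballI)
    show "of_mat X \<in> M.lie" "of_mat Y \<in> M.lie" using lie X Y by auto
    show "of_mat X \<noteq> 0 \<or> of_mat Y \<noteq> 0" using XY0 by (metis linear_0 linear_of_mat to_of_mat)
    fix x assume "x \<in> of_mat ` T"
    then obtain t where t: "x = of_mat t" "t \<in> T" by blast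
    show "x * of_mat X = (Re (\<phi> (to_mat x)) *\<^sub>R of_mat X - Im (\<phi> (to_mat x)) *\<^sub>R of_mat Y) * x"
      using conj[OF t(2) XY(1)[OF t(2)]]
      by (simp add: t linear_diff[OF linear_of_mat] linear_cmul[OF linear_of_mat])
    show "x * of_mat Y = (Im (\<phi> (to_mat x)) *\<^sub>R of_mat X + Re (\<phi> (to_mat x)) *\<^sub>R of_mat Y) * x"
      using conj[OF t(2) XY(2)[OF t(2)]]
      by (simp add: t linear_add[OF linear_of_mat] linear_cmul[OF linear_of_mat])
  qed
  moreover have "\<exists>t\<in>of_mat ` T. \<phi> (to_mat t) \<noteq> 1"
  proof -
    have "\<phi> \<noteq> (\<lambda>t. 1)" using \<phi> by (simp add: roots_def)
    then obtain t where "\<phi> t \<noteq> 1" by auto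
    moreover from this have "t \<in> T" using \<phi>c by (auto simp: characters_def)
    ultimately show ?thesis by auto
  qed
  ultimately obtain n n' where n: "n \<in> of_mat ` G" "n' \<in> of_mat ` G" "n * n' = 1" "n' * n = 1"
    "\<And>t. t \<in> of_mat ` T \<Longrightarrow> n * t * n' \<in> of_mat ` T" "\<And>t. t \<in> of_mat ` T \<Longrightarrow> n' * t * n \<in> of_mat ` T"
    "\<And>t. t \<in> of_mat ` T \<Longrightarrow> \<phi> (to_mat (n' * t * n)) * \<phi> (to_mat t) = 1"
    "\<And>\<psi>. R.unitary_char \<psi> \<Longrightarrow> \<exists>k::int. \<forall>t\<in>of_mat ` T. \<psi> (n' * t * n) = \<psi> t * \<phi> (to_mat t) powi k"
    using R.root_reflection[OF uc[OF \<phi>c]] by blast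
  obtain g where g: "n = of_mat g" "g \<in> G" using n(1) by blast
  have n': "n' = of_mat (transpose g)"
  proof -
    have "of_mat (transpose g) * n = 1" using G'(3)[OF g(2)] by (simp add: g(1) of_mat_mult[symmetric] of_mat_one)
    then have "of_mat (transpose g) * n * n' = n'" by simp
    then show ?thesis using n(3) by (simp add: mult.assoc)
  qed
  have in1: "g ** t ** transpose g \<in> T" and in2: "transpose g ** t ** g \<in> T" if "t \<in> T" for t
    using n(5)[of "of_mat t"] n(6)[of "of_mat t"] that
    unfolding g n' of_mat_mult[symmetric] by (auto simp: of_mat_inject)
  show ?thesis
  proof (rule that[of g])
    have "t \<in> (\<lambda>t. g ** t ** transpose g) ` T" if "t \<in> T" for t
    proof (rule image_eqI[OF _ in2[OF that]])
      have "g ** (transpose g ** t ** g) ** transpose g = (g ** transpose g) ** t ** (g ** transpose g)"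
        by (simp add: matrix_mul_assoc)
      then show "t = g ** (transpose g ** t ** g) ** transpose g" using G'(4)[OF g(2)] by simp
    qed
    then show "g \<in> normalizer G T" unfolding normalizer_def using g(2) in1 by blast
    show "\<phi> (transpose g ** t ** g) * \<phi> t = 1" if "t \<in> T" for t
      using n(7)[of "of_mat t"] that unfolding g n' of_mat_mult[symmetric] by simp
    show "\<exists>k::int. \<forall>t\<in>T. \<psi> (transpose g ** t ** g) = \<psi> t * \<phi> t powi k" if "\<psi> \<in> characters T" for \<psi>
      using n(8)[OF uc[OF that]] unfolding g n' by (simp add: of_mat_mult[symmetric])
  qed
qed

section \<open>The lattice and the root system $F_4$\<close>

definition vec4 :: "real \<Rightarrow> real \<Rightarrow> real \<Rightarrow> real \<Rightarrow> real^4" where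
  "vec4 a b c d = vector [a, b, c, d]"

lemma vec4_nth [simp]:
  "vec4 a b c d $ 1 = a" "vec4 a b c d $ 2 = b" "vec4 a b c d $ 3 = c" "vec4 a b c d $ 4 = d"
  by (simp_all add: vec4_def vector_def)

lemma vec4_eq_iff: "x = y \<longleftrightarrow> x $ 1 = y $ 1 \<and> x $ 2 = y $ 2 \<and> x $ 3 = y $ 3 \<and> x $ 4 = y $ 4"
  for x y :: "real^4"
  by (simp add: vec_eq_iff forall_4)

lemma inner4: "x \<bullet> y = x $ 1 * y $ 1 + x $ 2 * y $ 2 + x $ 3 * y $ 3 + x $ 4 * y $ 4"
  for x y :: "real^4"
  by (simp add: inner_vec_def sum_4)

text \<open>The integer vectors together with the vectors all of whose coordinates are half-odd. The
  four conditions are the integrality of the Cartan numbers against \<open>e\<^sub>1\<close> and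
  \<open>e\<^sub>j - e\<^sub>1\<close> for \<open>j = 2, 3, 4\<close>.\<close>

definition F4_lattice :: "(real^4) set" where
  "F4_lattice = {x. 2 * x $ 1 \<in> \<int> \<and> x $ 2 - x $ 1 \<in> \<int> \<and> x $ 3 - x $ 1 \<in> \<int> \<and> x $ 4 - x $ 1 \<in> \<int>}"

lemma F4_lattice_cases:
  assumes "x \<in> F4_lattice"
  obtains a b c d :: int where "x = vec4 a b c d"
  | a b c d :: int where "x = vec4 (a + 1/2) (b + 1/2) (c + 1/2) (d + 1/2)"
proof -
  from assms obtain a b c d :: int where
    e: "2 * x $ 1 = a" "x $ 2 - x $ 1 = b" "x $ 3 - x $ 1 = c" "x $ 4 - x $ 1 = d"
    unfolding F4_lattice_def Ints_def by auto
  show ?thesis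
  proof (cases "even a")
    case True
    then obtain k where "a = 2 * k" by blast
    then have "x = vec4 k (of_int (b + k)) (of_int (c + k)) (of_int (d + k))"
      using e by (auto simp: vec4_eq_iff)
    then show ?thesis using that(1) by blast
  next
    case False
    then obtain k where "a = 2 * k + 1" by (elim oddE)
    then have "x = vec4 (of_int k + 1/2) (of_int (b + k) + 1/2) (of_int (c + k) + 1/2) (of_int (d + k) + 1/2)"
      using e by (auto simp: vec4_eq_iff)
    then show ?thesis using that(2) by blast
  qed
qed

lemma vec4_int_in_F4_lattice: "vec4 (of_int a) (of_int b) (of_int c) (of_int d) \<in> F4_lattice"
  by (simp add: F4_lattice_def Ints_mult)

lemma vec4_half_in_F4_lattice:
  "vec4 (of_int a + 1/2) (of_int b + 1/2) (of_int c + 1/2) (of_int d + 1/2) \<in> F4_lattice"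
  by (simp add: F4_lattice_def distrib_left Ints_mult)

lemma F4_roots_eq: "F4_roots = {x \<in> F4_lattice. x \<bullet> x = 1 \<or> x \<bullet> x = 2}"
proof (intro equalityI subsetI)
  fix x :: "real^4" assume x: "x \<in> F4_roots"
  show "x \<in> {x \<in> F4_lattice. x \<bullet> x = 1 \<or> x \<bullet> x = 2}"
  proof (cases "\<forall>i. \<bar>x $ i\<bar> = 1/2")
    case True
    then have pm: "x $ i = 1/2 \<or> x $ i = -1/2" for i
      using abs_eq_iff[of "x $ i" "1/2"] by simp
    have 2: "2 * x $ i \<in> \<int>" and d: "x $ i - x $ j \<in> \<int>" and q: "x $ i * x $ i = 1/4" for i j :: 4
    proof -
      have "2 * t \<in> \<int> \<and> t * t = 1/4" if "t = 1/2 \<or> t = -1/2" for t :: real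
        by (rule disjE[OF that]; hypsubst; simp)
      then show "2 * x $ i \<in> \<int>" "x $ i * x $ i = 1/4" using pm[of i] by blast+
      have "x $ i - x $ j = -1 \<or> x $ i - x $ j = 0 \<or> x $ i - x $ j = 1"
        using pm[of i] pm[of j] by linarith
      then show "x $ i - x $ j \<in> \<int>" by auto
    qed
    have "x \<bullet> x = 1" unfolding inner4 q by simp
    then show ?thesis using 2 d by (simp add: F4_lattice_def)
  next
    case False
    then have "\<forall>i. x $ i \<in> \<int>" "x \<bullet> x = 1 \<or> x \<bullet> x = 2" using x by (auto simp: F4_roots_def)
    then show ?thesis by (simp add: F4_lattice_def Ints_mult)
  qed
next
  fix x :: "real^4" assume x: "x \<in> {x \<in> F4_lattice. x \<bullet> x = 1 \<or> x \<bullet> x = 2}"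
  then have L: "x \<in> F4_lattice" and n: "x \<bullet> x = 1 \<or> x \<bullet> x = 2" by auto
  from L show "x \<in> F4_roots"
  proof (cases rule: F4_lattice_cases)
    case (1 a b c d)
    then have "\<forall>i. x $ i \<in> \<int>" by (simp add: forall_4)
    then show ?thesis using n by (simp add: F4_roots_def)
  next
    case (2 a b c d)
    \<comment> \<open>A half-odd vector has square norm \<open>1 + S\<close>, with \<open>S\<close>
      a sum of products of consecutive integers. \<open>S\<close> is even, which excludes norm 2;
      norm 1 makes every product vanish, so all coordinates are 1/2 or -1/2.\<close>
    have sq: "(of_int k + 1/2) * (of_int k + 1/2) = (1/4 :: real) + of_int (k * (k + 1))" for k :: int
      by (simp add: field_simps)
    define S where "S = a * (a + 1) + b * (b + 1) + c * (c + 1) + d * (d + 1)"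
    have xx: "x \<bullet> x = 1 + of_int S"
      unfolding 2 inner4 vec4_nth sq S_def by simp
    have "even S" by (simp add: S_def)
    moreover have "S = 0 \<or> S = 1" using n unfolding xx by linarith
    ultimately have S0: "S = 0" by auto
    have nn: "k * (k + 1) \<ge> 0" for k :: int by (cases "k \<ge> 0") (auto simp: mult_nonpos_nonpos)
    have "k = 0 \<or> k = - 1" if "k * (k + 1) = 0" for k :: int using that by auto
    moreover have "a * (a + 1) = 0" "b * (b + 1) = 0" "c * (c + 1) = 0" "d * (d + 1) = 0"
      using S0 nn[of a] nn[of b] nn[of c] nn[of d] unfolding S_def by linarith+
    ultimately have "a = 0 \<or> a = -1" "b = 0 \<or> b = -1" "c = 0 \<or> c = -1" "d = 0 \<or> d = -1" by blast+
    then have "\<forall>i. \<bar>x $ i\<bar> = 1/2" unfolding 2 forall_4 by auto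
    then show ?thesis by (simp add: F4_roots_def)
  qed
qed

lemma F4_roots_nonzero: "\<alpha> \<in> F4_roots \<Longrightarrow> \<alpha> \<bullet> \<alpha> > 0"
  by (auto simp: F4_roots_eq)

lemma F4_root_coordinates:
  assumes "x \<in> F4_roots"
  shows "(\<forall>i. x $ i \<in> {-1, 0, 1}) \<and> (x \<bullet> x = 1 \<or> x \<bullet> x = 2) \<or> (\<forall>i. x $ i \<in> {-1/2, 1/2})"
proof (cases "\<forall>i. \<bar>x $ i\<bar> = 1/2")
  case True
  have "t \<in> {-1/2, 1/2}" if "\<bar>t\<bar> = 1/2" for t :: real using that by (auto simp: abs_if split: if_splits)
  then show ?thesis using True by blast
next
  case False
  then have x: "\<And>i. x $ i \<in> \<int>" "x \<bullet> x = 1 \<or> x \<bullet> x = 2" using assms by (auto simp: F4_roots_def)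
  have "x $ i \<in> {-1, 0, 1}" for i
  proof -
    obtain k :: int where k: "x $ i = k" using x(1)[of i] by (auto elim: Ints_cases)
    have "x $ i * x $ i \<le> x \<bullet> x"
      unfolding inner_vec_def inner_real_def by (rule member_le_sum) auto
    then have "of_int (k * k) \<le> (2::real)" using x(2) k by auto
    then have "k * k \<le> 2" by linarith
    have "\<bar>k\<bar> < 2"
    proof (rule ccontr)
      assume "\<not> \<bar>k\<bar> < 2"
      then have "2 * 2 \<le> \<bar>k\<bar> * \<bar>k\<bar>" by (intro mult_mono) auto
      then show False using \<open>k * k \<le> 2\<close> by simp
    qed
    then have "k = -1 \<or> k = 0 \<or> k = 1" by auto
    then show ?thesis using k by auto
  qed
  then show ?thesis using x(2) by blast
qed

lemma finite_F4_roots: "finite F4_roots"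
proof -
  define A where "A = {-1, -1/2, 0, 1/2, 1 :: real}"
  have "x \<in> (\<lambda>(a, b, c, d). vec4 a b c d) ` (A \<times> A \<times> A \<times> A)" if "x \<in> F4_roots" for x
  proof -
    have "\<forall>i. x $ i \<in> A" using F4_root_coordinates[OF that] by (auto simp: A_def)
    then show ?thesis
      by (intro image_eqI[of _ _ "(x $ 1, x $ 2, x $ 3, x $ 4)"]) (auto simp: vec4_eq_iff)
  qed
  moreover have "finite A" by (simp add: A_def)
  ultimately show ?thesis by (meson finite_SigmaI finite_imageI finite_subset subsetI)
qed

section \<open>Simple roots (in Bourbaki's labelling), reflections and chambers of $F_4$\<close>

definition simple1 where "simple1 = vec4 0 1 (-1) 0"
definition simple2 where "simple2 = vec4 0 0 1 (-1)"
definition simple3 where "simple3 = vec4 0 0 0 1"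
definition simple4 where "simple4 = vec4 (1/2) (-1/2) (-1/2) (-1/2)"

lemmas simple_defs = simple1_def simple2_def simple3_def simple4_def

definition F4_simple :: "(real^4) set" where
  "F4_simple = {simple1, simple2, simple3, simple4}"

lemma half_vec4_F4_roots: "\<bar>a\<bar> = 1/2 \<Longrightarrow> \<bar>b\<bar> = 1/2 \<Longrightarrow> \<bar>c\<bar> = 1/2 \<Longrightarrow> \<bar>d\<bar> = 1/2 \<Longrightarrow> vec4 a b c d \<in> F4_roots"
  by (simp add: F4_roots_def forall_4)

lemma int_vec4_F4_roots: "a \<in> \<int> \<Longrightarrow> b \<in> \<int> \<Longrightarrow> c \<in> \<int> \<Longrightarrow> d \<in> \<int> \<Longrightarrow>
  a * a + b * b + c * c + d * d = 1 \<or> a * a + b * b + c * c + d * d = 2 \<Longrightarrow> vec4 a b c d \<in> F4_roots"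
  by (simp add: F4_roots_def forall_4 inner4)

lemma F4_simple_roots: "F4_simple \<subseteq> F4_roots"
proof -
  have "simple1 \<in> F4_roots" "simple2 \<in> F4_roots" "simple3 \<in> F4_roots"
    unfolding simple_defs by (rule int_vec4_F4_roots; simp)+
  moreover have "simple4 \<in> F4_roots" unfolding simple_defs by (rule half_vec4_F4_roots; simp)
  ultimately show ?thesis by (simp add: F4_simple_def)
qed

definition open_chamber :: "(real^4) set" where
  "open_chamber = {x. x $ 2 > x $ 3 \<and> x $ 3 > x $ 4 \<and> x $ 4 > 0 \<and> x $ 1 > x $ 2 + x $ 3 + x $ 4}"

lemma open_chamber_iff: "x \<in> open_chamber \<longleftrightarrow> (\<forall>\<alpha>\<in>F4_simple. \<alpha> \<bullet> x > 0)"
  by (auto simp: open_chamber_def F4_simple_def simple_defs inner4)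

text \<open>The coefficients are the inner products with the basis dual to the simple roots:
  (1,1,0,0), (2,1,1,0), (3,1,1,1), (2,0,0,0).\<close>

lemma simple_expansion:
  "x = (x$1 + x$2) *\<^sub>R simple1 + (2 * x$1 + x$2 + x$3) *\<^sub>R simple2
     + (3 * x$1 + x$2 + x$3 + x$4) *\<^sub>R simple3 + (2 * x$1) *\<^sub>R simple4"
  by (simp add: vec4_eq_iff simple_defs)

text \<open>Each coefficient is an integral combination of the four integers defining
  \<open>F4_lattice\<close>. Signs and bounds are checked on the finitely many coordinate patterns
  of a root; the bounds 2, 3, 4, 2 are the coefficients of the highest root
  \<open>e\<^sub>1 + e\<^sub>2\<close>.\<close>

lemma F4_root_coefficients:
  assumes "x \<in> F4_roots"
  obtains k1 k2 k3 k4 :: int where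
    "x = of_int k1 *\<^sub>R simple1 + of_int k2 *\<^sub>R simple2 + of_int k3 *\<^sub>R simple3 + of_int k4 *\<^sub>R simple4"
    "k1 \<ge> 0 \<and> k2 \<ge> 0 \<and> k3 \<ge> 0 \<and> k4 \<ge> 0 \<or> k1 \<le> 0 \<and> k2 \<le> 0 \<and> k3 \<le> 0 \<and> k4 \<le> 0"
    "k1 \<le> 2" "k2 \<le> 3" "k3 \<le> 4" "k4 \<le> 2"
proof -
  define k1 k2 k3 k4 where "k1 = x$1 + x$2" and "k2 = 2 * x$1 + x$2 + x$3"
    and "k3 = 3 * x$1 + x$2 + x$3 + x$4" and "k4 = 2 * x$1"
  have L: "x \<in> F4_lattice" using assms F4_roots_eq by blast
  then have "k4 \<in> \<int>" by (simp add: k4_def F4_lattice_def)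
  moreover have "k1 \<in> \<int>"
  proof -
    have "k1 = 2 * x$1 + (x$2 - x$1)" by (simp add: k1_def)
    then show ?thesis using L by (simp only: F4_lattice_def mem_Collect_eq Ints_add)
  qed
  moreover have "k2 \<in> \<int>"
  proof -
    have "k2 = 2 * x$1 + 2 * x$1 + (x$2 - x$1) + (x$3 - x$1)" by (simp add: k2_def)
    then show ?thesis using L by (simp only: F4_lattice_def mem_Collect_eq Ints_add)
  qed
  moreover have "k3 \<in> \<int>"
  proof -
    have "k3 = 2 * x$1 + 2 * x$1 + 2 * x$1 + (x$2 - x$1) + (x$3 - x$1) + (x$4 - x$1)" by (simp add: k3_def)
    then show ?thesis using L by (simp only: F4_lattice_def mem_Collect_eq Ints_add)
  qed
  ultimately obtain l1 l2 l3 l4 :: int where l: "k1 = l1" "k2 = l2" "k3 = l3" "k4 = l4"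
    by (auto elim!: Ints_cases)
  have b: "(k1 \<ge> 0 \<and> k2 \<ge> 0 \<and> k3 \<ge> 0 \<and> k4 \<ge> 0 \<or> k1 \<le> 0 \<and> k2 \<le> 0 \<and> k3 \<le> 0 \<and> k4 \<le> 0)
      \<and> k1 \<le> 2 \<and> k2 \<le> 3 \<and> k3 \<le> 4 \<and> k4 \<le> 2"
    using F4_root_coordinates[OF assms]
  proof (elim disjE)
    assume "\<forall>i. x $ i \<in> {- 1 / 2, 1 / 2}"
    then have "x$1 = -1/2 \<or> x$1 = 1/2" "x$2 = -1/2 \<or> x$2 = 1/2" "x$3 = -1/2 \<or> x$3 = 1/2" "x$4 = -1/2 \<or> x$4 = 1/2"
      by (simp_all add: forall_4)
    then show ?thesis unfolding k1_def k2_def k3_def k4_def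
      by (elim disjE; simp)
  next
    assume "(\<forall>i. x $ i \<in> {- 1, 0, 1}) \<and> (x \<bullet> x = 1 \<or> x \<bullet> x = 2)"
    then have "x$1 = -1 \<or> x$1 = 0 \<or> x$1 = 1" "x$2 = -1 \<or> x$2 = 0 \<or> x$2 = 1"
      "x$3 = -1 \<or> x$3 = 0 \<or> x$3 = 1" "x$4 = -1 \<or> x$4 = 0 \<or> x$4 = 1"
      "x$1 * x$1 + x$2 * x$2 + x$3 * x$3 + x$4 * x$4 \<in> {1, 2}"
      by (simp_all add: forall_4 inner4)
    then show ?thesis unfolding k1_def k2_def k3_def k4_def
      by (elim disjE; simp)
  qed
  show ?thesis
    by (rule that[of l1 l2 l3 l4]) (use simple_expansion[of x] b l in \<open>auto simp: k1_def k2_def k3_def k4_def\<close>)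
qed

definition reflect :: "'a::euclidean_space \<Rightarrow> 'a \<Rightarrow> 'a" where
  "reflect \<alpha> x = x - (2 * (x \<bullet> \<alpha>) / (\<alpha> \<bullet> \<alpha>)) *\<^sub>R \<alpha>"

lemma orthogonal_reflect: "\<alpha> \<noteq> 0 \<Longrightarrow> orthogonal_transformation (reflect \<alpha>)"
  unfolding orthogonal_transformation_def
proof
  assume "\<alpha> \<noteq> 0"
  show "linear (reflect \<alpha>)"
    by (rule linearI) (simp_all add: reflect_def inner_add_left algebra_simps add_divide_distrib)
  show "\<forall>v w. reflect \<alpha> v \<bullet> reflect \<alpha> w = v \<bullet> w"
    using \<open>\<alpha> \<noteq> 0\<close> by (auto simp: reflect_def inner_diff_left inner_diff_right inner_commute field_simps)
qed

lemma reflect_involution: "\<alpha> \<noteq> 0 \<Longrightarrow> reflect \<alpha> (reflect \<alpha> x) = x"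
  by (simp add: reflect_def inner_diff_left field_simps)

lemma reflect_simple_F4_lattice:
  assumes "\<alpha> \<in> F4_simple" "x \<in> F4_lattice" shows "reflect \<alpha> x \<in> F4_lattice"
proof -
  have L: "2 * x $ 1 \<in> \<int>" "x $ 2 - x $ 1 \<in> \<int>" "x $ 3 - x $ 1 \<in> \<int>" "x $ 4 - x $ 1 \<in> \<int>"
    using assms(2) by (auto simp: F4_lattice_def)
  have "reflect simple1 x = vec4 (x$1) (x$3) (x$2) (x$4)"
    by (simp add: reflect_def simple_defs vec4_eq_iff inner4 field_simps)
  moreover have "reflect simple2 x = vec4 (x$1) (x$2) (x$4) (x$3)"
    by (simp add: reflect_def simple_defs vec4_eq_iff inner4 field_simps)
  moreover have "reflect simple3 x = vec4 (x$1) (x$2) (x$3) (- x$4)"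
    by (simp add: reflect_def simple_defs vec4_eq_iff inner4)
  moreover have "- x$4 - x$1 = - ((x$4 - x$1) + 2 * x$1)" by simp
  then have "- x$4 - x$1 \<in> \<int>" using L by (simp only: Ints_add Ints_minus)
  \<comment> \<open>\<open>t\<close> is the inner product with \<open>simple4\<close>, a root of
    norm 1. It may be half-integral, but the lattice conditions on the reflected vector involve only
    \<open>2 * t\<close>.\<close>
  moreover define t where "t = (x$1 - x$2 - x$3 - x$4) / 2"
  have "reflect simple4 x = vec4 (x$1 - t) (x$2 + t) (x$3 + t) (x$4 + t)"
    by (simp add: reflect_def simple_defs vec4_eq_iff inner4 t_def field_simps)
  moreover have "2 * t \<in> \<int>"
  proof -
    have "2 * t = - (2 * x$1 + (x$2 - x$1) + (x$3 - x$1) + (x$4 - x$1))" by (simp add: t_def)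
    then show ?thesis using L by (simp only: Ints_add Ints_minus)
  qed
  then have "2 * (x$1 - t) \<in> \<int>" "x$2 + t - (x$1 - t) \<in> \<int>" "x$3 + t - (x$1 - t) \<in> \<int>" "x$4 + t - (x$1 - t) \<in> \<int>"
    using Ints_diff[OF L(1), of "2 * t"] Ints_add[OF L(2), of "2 * t"] Ints_add[OF L(3), of "2 * t"] Ints_add[OF L(4), of "2 * t"]
    by (simp_all add: algebra_simps)
  ultimately show ?thesis using assms(1) L by (auto simp: F4_simple_def F4_lattice_def)
qed

lemma reflect_simple_F4_roots:
  assumes "\<alpha> \<in> F4_simple" shows "reflect \<alpha> ` F4_roots = F4_roots"
proof -
  have nz: "\<alpha> \<noteq> 0" using assms F4_simple_roots F4_roots_nonzero by force
  have "reflect \<alpha> x \<in> F4_roots" if "x \<in> F4_roots" for x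
    using that reflect_simple_F4_lattice[OF assms, of x] orthogonal_reflect[OF nz]
    by (auto simp: F4_roots_eq orthogonal_transformation_def)
  then show ?thesis using reflect_involution[OF nz] by (metis image_subsetI image_eqI subsetI subset_antisym)
qed

text \<open>Any chamber can be moved to the standard one: a symmetry \<open>h\<close> of the root system that
  maximizes \<open>v \<bullet> h \<rho>\<close>, with \<open>\<rho>\<close> in the standard open chamber, has \<open>v \<bullet> h \<alpha> \<ge> 0\<close>
  for all simple \<open>\<alpha>\<close>, since composing it with a simple reflection does not increase the value.\<close>

lemma F4_chamber_transitive:
  assumes v: "\<And>\<alpha>. \<alpha> \<in> F4_roots \<Longrightarrow> v \<bullet> \<alpha> \<noteq> 0"
  obtains h where "orthogonal_transformation h" "h ` F4_roots = F4_roots"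
    "\<And>\<alpha>. \<alpha> \<in> F4_simple \<Longrightarrow> v \<bullet> h \<alpha> > 0"
proof -
  define H where "H = {h :: real^4 \<Rightarrow> real^4. orthogonal_transformation h \<and> h ` F4_roots = F4_roots}"
  \<comment> \<open>Twice the half-sum of the positive roots; what matters is that it lies in the
    open chamber.\<close>
  define \<rho> where "\<rho> = vec4 11 5 3 1"
  define S where "S = (\<lambda>h. v \<bullet> h \<rho>) ` H"
  have "finite S"
  proof -
    \<comment> \<open>The unit vectors are roots, so \<open>h \<rho>\<close> is a fixed combination
      of four roots. There are finitely many such values, hence the maximum is attained.\<close>
    have "v \<bullet> h \<rho> \<in> (\<lambda>(a, b, c, d). v \<bullet> (11 *\<^sub>R a + 5 *\<^sub>R b + 3 *\<^sub>R c + 1 *\<^sub>R d))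
        ` (F4_roots \<times> F4_roots \<times> F4_roots \<times> F4_roots)" if h: "h \<in> H" for h
    proof (rule image_eqI)
      have lin: "linear h" using h by (simp add: H_def orthogonal_transformation_linear)
      have \<rho>: "\<rho> = 11 *\<^sub>R vec4 1 0 0 0 + 5 *\<^sub>R vec4 0 1 0 0 + 3 *\<^sub>R vec4 0 0 1 0 + 1 *\<^sub>R vec4 0 0 0 1"
        by (simp add: \<rho>_def vec4_eq_iff)
      show "v \<bullet> h \<rho> = (\<lambda>(a, b, c, d). v \<bullet> (11 *\<^sub>R a + 5 *\<^sub>R b + 3 *\<^sub>R c + 1 *\<^sub>R d))
          (h (vec4 1 0 0 0), h (vec4 0 1 0 0), h (vec4 0 0 1 0), h (vec4 0 0 0 1))"
        unfolding \<rho> by (simp only: prod.case linear_add[OF lin] linear_cmul[OF lin])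
      have "h r \<in> F4_roots" if "r \<in> F4_roots" for r using h that by (auto simp: H_def)
      then show "(h (vec4 1 0 0 0), h (vec4 0 1 0 0), h (vec4 0 0 1 0), h (vec4 0 0 0 1))
          \<in> F4_roots \<times> F4_roots \<times> F4_roots \<times> F4_roots"
        by (simp add: int_vec4_F4_roots)
    qed
    then have "S \<subseteq> (\<lambda>(a, b, c, d). v \<bullet> (11 *\<^sub>R a + 5 *\<^sub>R b + 3 *\<^sub>R c + 1 *\<^sub>R d))
        ` (F4_roots \<times> F4_roots \<times> F4_roots \<times> F4_roots)" unfolding S_def by blast
    then show ?thesis using finite_F4_roots by (meson finite_SigmaI finite_imageI finite_subset)
  qed
  moreover have "id \<in> H" by (simp add: H_def orthogonal_transformation_id[unfolded id_def[symmetric]] )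
  then have "S \<noteq> {}" by (auto simp: S_def)
  ultimately have M: "Max S \<in> S" "\<And>y. y \<in> S \<Longrightarrow> y \<le> Max S" by (auto intro: Max_in)
  from M(1) obtain h where h: "h \<in> H" "Max S = v \<bullet> h \<rho>" by (auto simp: S_def)
  have max: "v \<bullet> h' \<rho> \<le> v \<bullet> h \<rho>" if "h' \<in> H" for h'
    using M(2)[of "v \<bullet> h' \<rho>"] that by (simp add: S_def h(2)[unfolded S_def])
  have orth: "orthogonal_transformation h" and img: "h ` F4_roots = F4_roots"
    using h(1) by (auto simp: H_def)
  have lin: "linear h" using orth by (rule orthogonal_transformation_linear)
  have "v \<bullet> h \<alpha> > 0" if \<alpha>: "\<alpha> \<in> F4_simple" for \<alpha>
  proof -
    have aa: "\<alpha> \<bullet> \<alpha> > 0" using \<alpha> F4_simple_roots F4_roots_nonzero by blast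
    then have nz: "\<alpha> \<noteq> 0" by auto
    have "\<rho> \<in> open_chamber" by (simp add: \<rho>_def open_chamber_def)
    then have pos: "\<rho> \<bullet> \<alpha> > 0" using \<alpha> open_chamber_iff by (metis inner_commute)
    have "(h \<circ> reflect \<alpha>) ` F4_roots = F4_roots"
      by (simp only: image_comp[symmetric] reflect_simple_F4_roots[OF \<alpha>] img)
    then have "h \<circ> reflect \<alpha> \<in> H"
      using orth orthogonal_reflect[OF nz] by (simp add: H_def orthogonal_transformation_compose)
    from max[OF this] have "(2 * (\<rho> \<bullet> \<alpha>) / (\<alpha> \<bullet> \<alpha>)) * (v \<bullet> h \<alpha>) \<ge> 0"
      by (simp add: reflect_def linear_diff[OF lin] linear_cmul[OF lin] inner_diff_right)
    then have "v \<bullet> h \<alpha> \<ge> 0" using pos aa by (simp add: zero_le_mult_iff zero_le_divide_iff)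
    moreover have "v \<bullet> h \<alpha> \<noteq> 0" using v img \<alpha> F4_simple_roots by blast
    ultimately show ?thesis by simp
  qed
  then show ?thesis using that orth img by blast
qed

section \<open>Rigidity of the root system and of the weight lattice\<close>

lemma axis_F4_roots: "axis i 1 \<in> F4_roots"
  by (simp add: F4_roots_def axis_def inner_axis_axis[unfolded axis_def])

text \<open>Equal Cartan integers fix inner products up to a factor, which is the same for two
  non-orthogonal roots. The root with all coordinates 1/2 is orthogonal to no unit vector, so one
  factor \<open>c\<close> serves a whole basis; the norm 2 of long roots gives
  \<open>c = 1\<close>.\<close>

lemma type_F4_isometry:
  fixes \<Phi> :: "'e::euclidean_space set"
  assumes "type_F4 \<Phi>" and long: "\<And>u. u \<in> \<Phi> \<Longrightarrow> (\<And>v. v \<in> \<Phi> \<Longrightarrow> v \<bullet> v \<le> u \<bullet> u) \<Longrightarrow> u \<bullet> u = 2"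
  obtains g :: "real^4 \<Rightarrow> 'e" where "linear g" "bij g" "g ` F4_roots = \<Phi>" "\<And>x y. g x \<bullet> g y = x \<bullet> y"
proof -
  obtain f :: "'e \<Rightarrow> real^4" where f: "linear f" "bij f" "f ` \<Phi> = F4_roots"
    and cartan: "\<And>\<alpha> \<beta>. \<alpha> \<in> \<Phi> \<Longrightarrow> \<beta> \<in> \<Phi> \<Longrightarrow> 2 * (f \<alpha> \<bullet> f \<beta>) / (f \<beta> \<bullet> f \<beta>) = 2 * (\<alpha> \<bullet> \<beta>) / (\<beta> \<bullet> \<beta>)"
    using assms(1) unfolding type_F4_def by blast
  define g where "g = inv f"
  have fg: "f (g x) = x" and gf: "g (f y) = y" for x y
    using f(2) by (simp_all add: g_def bij_is_surj surj_f_inv_f bij_is_inj inv_f_f)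
  have lin: "linear g"
  proof (rule linearI)
    show "g (x + y) = g x + g y" for x y
      using gf[of "g x + g y"] by (simp add: linear_add[OF f(1)] fg)
    show "g (r *\<^sub>R x) = r *\<^sub>R g x" for r x
      using gf[of "r *\<^sub>R g x"] by (simp add: linear_cmul[OF f(1)] fg)
  qed
  have bij: "bij g" unfolding g_def using f(2) by (rule bij_imp_bij_inv)
  have img: "g ` F4_roots = \<Phi>" unfolding f(3)[symmetric] by (simp add: image_image gf)
  define r where "r \<alpha> = (g \<alpha> \<bullet> g \<alpha>) / (\<alpha> \<bullet> \<alpha>)" for \<alpha>
  have gpos: "g \<alpha> \<bullet> g \<alpha> > 0" if "\<alpha> \<in> F4_roots" for \<alpha>
    using F4_roots_nonzero[OF that] fg linear_0[OF f(1)] by (metis inner_gt_zero_iff)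
  have ratio: "g \<alpha> \<bullet> g \<beta> = r \<beta> * (\<alpha> \<bullet> \<beta>)" if "\<alpha> \<in> F4_roots" "\<beta> \<in> F4_roots" for \<alpha> \<beta>
  proof -
    have "2 * (\<alpha> \<bullet> \<beta>) / (\<beta> \<bullet> \<beta>) = 2 * (g \<alpha> \<bullet> g \<beta>) / (g \<beta> \<bullet> g \<beta>)"
      using cartan[of "g \<alpha>" "g \<beta>"] that img by (auto simp: fg)
    then show ?thesis using gpos[OF that(2)] F4_roots_nonzero[OF that(2)] by (simp add: r_def field_simps)
  qed
  have r_eq: "r \<alpha> = r \<beta>" if "\<alpha> \<in> F4_roots" "\<beta> \<in> F4_roots" "\<alpha> \<bullet> \<beta> \<noteq> 0" for \<alpha> \<beta>
    using ratio[OF that(1,2)] ratio[OF that(2,1)] that(3) by (simp add: inner_commute)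
  define w :: "real^4" where "w = (\<chi> i. 1/2)"
  have w: "w \<in> F4_roots" by (simp add: w_def F4_roots_def)
  define c where "c = r w"
  have r_axis: "r (axis i 1) = c" for i
    unfolding c_def by (rule r_eq[OF axis_F4_roots w]) (simp add: inner_axis' w_def)
  have scale: "g x \<bullet> g y = c * (x \<bullet> y)" for x y
  proof -
    have gx: "g x = (\<Sum>i\<in>UNIV. x $ i *\<^sub>R g (axis i 1))" for x
    proof -
      have "x = (\<Sum>i\<in>UNIV. x $ i *\<^sub>R axis i 1)"
        using basis_expansion[of x] by (simp add: scalar_mult_eq_scaleR)
      then have "g x = g (\<Sum>i\<in>UNIV. x $ i *\<^sub>R axis i 1)" by (rule arg_cong)
      then show ?thesis by (simp add: linear_sum[OF lin] linear_cmul[OF lin])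
    qed
    have "g x \<bullet> g y = (\<Sum>i\<in>UNIV. \<Sum>j\<in>UNIV. x $ i * (y $ j * (g (axis i 1) \<bullet> g (axis j 1))))"
      unfolding gx[of x] gx[of y]
      by (subst inner_sum_left) (simp add: inner_sum_right sum_distrib_left mult.left_commute)
    also have "\<dots> = (\<Sum>i\<in>UNIV. \<Sum>j\<in>UNIV. if i = j then x $ i * (y $ j * c) else 0)"
      by (intro sum.cong refl) (simp add: ratio axis_F4_roots r_axis inner_axis_axis)
    also have "\<dots> = c * (x \<bullet> y)"
      by (simp add: inner_vec_def sum_distrib_left mult_ac)
    finally show ?thesis .
  qed
  have "c > 0" unfolding c_def r_def using gpos[OF w] F4_roots_nonzero[OF w] by simp
  define u where "u = vec4 1 1 0 0"
  have u: "u \<in> F4_roots" "u \<bullet> u = 2" by (simp_all add: u_def int_vec4_F4_roots inner4)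
  have "g u \<bullet> g u = 2"
  proof (rule long)
    show "g u \<in> \<Phi>" using img u by blast
    fix v assume "v \<in> \<Phi>"
    then obtain x where x: "v = g x" "x \<in> F4_roots" using img by blast
    have "x \<bullet> x \<le> u \<bullet> u" using x(2) u(2) by (auto simp: F4_roots_eq)
    then show "v \<bullet> v \<le> g u \<bullet> g u" using \<open>c > 0\<close> unfolding x scale by simp
  qed
  then have "c = 1" by (simp add: scale u)
  then show ?thesis using that[OF lin bij img] scale by simp
qed

text \<open>From above, the Cartan numbers against four roots are the conditions defining
  \<open>F4_lattice\<close>; from below, four roots generate it over the integers.\<close>

lemma F4_weight_lattice_eq_root_lattice:
  assumes roots: "F4_roots \<subseteq> L" and diff: "\<And>x y. x \<in> L \<Longrightarrow> y \<in> L \<Longrightarrow> x - y \<in> L"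
    and int: "\<And>x \<alpha>. x \<in> L \<Longrightarrow> \<alpha> \<in> F4_roots \<Longrightarrow> 2 * (x \<bullet> \<alpha>) / (\<alpha> \<bullet> \<alpha>) \<in> \<int>"
  shows "L = F4_lattice"
proof (intro equalityI subsetI)
  fix x assume x: "x \<in> L"
  have "vec4 1 0 0 0 \<in> F4_roots" "vec4 (-1) 1 0 0 \<in> F4_roots" "vec4 (-1) 0 1 0 \<in> F4_roots" "vec4 (-1) 0 0 1 \<in> F4_roots"
    by (simp_all add: int_vec4_F4_roots)
  from this[THEN int[OF x]] show "x \<in> F4_lattice"
    by (simp add: F4_lattice_def inner4 diff_divide_distrib)
next
  have zero: "0 \<in> L" using diff roots axis_F4_roots by (metis diff_self subsetD)
  have neg: "- x \<in> L" if "x \<in> L" for x using diff[OF zero that] by simp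
  have add: "x + y \<in> L" if "x \<in> L" "y \<in> L" for x y using diff[OF that(1) neg[OF that(2)]] by simp
  have mult: "of_int k *\<^sub>R x \<in> L" if x: "x \<in> L" for x and k :: int
  proof (induction k rule: int_induct[of _ 0])
    case (step1 i)
    have "of_int (i + 1) *\<^sub>R x = of_int i *\<^sub>R x + x" by (simp add: algebra_simps)
    then show ?case using add[OF step1(2) x] by simp
  next
    case (step2 i)
    have "of_int (i - 1) *\<^sub>R x = of_int i *\<^sub>R x - x" by (simp add: algebra_simps)
    then show ?case using diff[OF step2(2) x] by simp
  qed (simp add: zero)
  fix x assume "x \<in> F4_lattice"
  then obtain a b c d :: int where
    e: "2 * x $ 1 = a" "x $ 2 - x $ 1 = b" "x $ 3 - x $ 1 = c" "x $ 4 - x $ 1 = d"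
    unfolding F4_lattice_def Ints_def by auto
  have "x = of_int a *\<^sub>R vec4 (1/2) (1/2) (1/2) (1/2) + of_int b *\<^sub>R vec4 0 1 0 0
      + of_int c *\<^sub>R vec4 0 0 1 0 + of_int d *\<^sub>R vec4 0 0 0 1"
    by (simp add: vec4_eq_iff e[symmetric])
  moreover have "vec4 (1/2) (1/2) (1/2) (1/2) \<in> L" "vec4 0 1 0 0 \<in> L" "vec4 0 0 1 0 \<in> L" "vec4 0 0 0 1 \<in> L"
    using roots by (auto simp: int_vec4_F4_roots half_vec4_F4_roots)
  ultimately show "x \<in> L" by (simp only: add mult)
qed

subsection \<open>Integrality of weights\<close>

lemma real_extension_mult:
  fixes \<iota> :: "(real^'n^'n \<Rightarrow> complex) \<Rightarrow> 'e::euclidean_space"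
  assumes "real_extension T \<iota>" "\<phi> \<in> characters T" "\<psi> \<in> characters T"
  shows "\<iota> (\<lambda>t. \<phi> t * \<psi> t) = \<iota> \<phi> + \<iota> \<psi>"
proof -
  have "\<forall>\<phi>\<in>characters T. \<forall>\<psi>\<in>characters T. \<iota> (\<lambda>t. \<phi> t * \<psi> t) = \<iota> \<phi> + \<iota> \<psi>"
    using assms(1) unfolding real_extension_def by (rule conjunct1)
  from bspec[OF bspec[OF this assms(2)] assms(3)] show ?thesis .
qed

lemma character_power:
  fixes \<iota> :: "(real^'n^'n \<Rightarrow> complex) \<Rightarrow> 'e::euclidean_space"
  assumes ext: "real_extension T \<iota>" and \<phi>: "\<phi> \<in> characters T"
  shows "(\<lambda>t. \<phi> t ^ j) \<in> characters T \<and> \<iota> (\<lambda>t. \<phi> t ^ j) = real j *\<^sub>R \<iota> \<phi>"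
proof (induction j)
  have one: "(\<lambda>t. 1) \<in> characters T" by (simp add: characters_def)
  case 0
  \<comment> \<open>The trivial character is its own square, so its image is 0.\<close>
  have "\<iota> (\<lambda>t. 1 * 1) = \<iota> (\<lambda>t. 1) + \<iota> (\<lambda>t. 1)"
    by (rule real_extension_mult[OF ext one one])
  then show ?case using one by simp
next
  case (Suc j)
  then have "\<iota> (\<lambda>t. \<phi> t * \<phi> t ^ j) = \<iota> \<phi> + \<iota> (\<lambda>t. \<phi> t ^ j)"
    by (intro real_extension_mult[OF ext \<phi>]) simp
  moreover have "(\<lambda>t. \<phi> t * \<phi> t ^ j) \<in> characters T"
    using Suc \<phi> by (auto simp: characters_def norm_mult norm_power intro!: continuous_intros)
  ultimately show ?case using Suc by (simp add: algebra_simps)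
qed

lemma character_inverse:
  fixes \<iota> :: "(real^'n^'n \<Rightarrow> complex) \<Rightarrow> 'e::euclidean_space"
  assumes ext: "real_extension T \<iota>" and \<phi>: "\<phi> \<in> characters T"
  shows "(\<lambda>t. inverse (\<phi> t)) \<in> characters T \<and> \<iota> (\<lambda>t. inverse (\<phi> t)) = - \<iota> \<phi>"
proof -
  have nz: "\<phi> t \<noteq> 0" for t using \<phi> by (cases "t \<in> T") (auto simp: characters_def)
  then have c: "(\<lambda>t. inverse (\<phi> t)) \<in> characters T"
    using \<phi> by (auto simp: characters_def norm_inverse intro!: continuous_intros)
  have "\<iota> (\<lambda>t. \<phi> t * inverse (\<phi> t)) = \<iota> \<phi> + \<iota> (\<lambda>t. inverse (\<phi> t))"
    by (rule real_extension_mult[OF ext \<phi> c])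
  moreover have "\<iota> (\<lambda>t. \<phi> t * inverse (\<phi> t)) = 0"
    using character_power[OF ext \<phi>, of 0] nz by simp
  ultimately show ?thesis using c by (simp add: eq_neg_iff_add_eq_0 add.commute)
qed

lemma character_powi:
  fixes \<iota> :: "(real^'n^'n \<Rightarrow> complex) \<Rightarrow> 'e::euclidean_space"
  assumes ext: "real_extension T \<iota>" and \<phi>: "\<phi> \<in> characters T"
  shows "(\<lambda>t. \<phi> t powi k) \<in> characters T \<and> \<iota> (\<lambda>t. \<phi> t powi k) = of_int k *\<^sub>R \<iota> \<phi>"
proof (cases "k \<ge> 0")
  case True
  then show ?thesis using character_power[OF ext \<phi>, of "nat k"] by (simp add: power_int_def)
next
  case False
  then show ?thesis
    using character_power[OF ext character_inverse[OF ext \<phi>, THEN conjunct1], of "nat (- k)"]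
      character_inverse[OF ext \<phi>] by (simp add: power_int_def)
qed

lemma weight_integrality:
  fixes G T :: "(real^'n^'n) set" and \<iota> :: "(real^'n^'n \<Rightarrow> complex) \<Rightarrow> 'e::euclidean_space"
  assumes G: "compact_lie_group G" and max: "maximal_torus G T"
    and ext: "real_extension T \<iota>" and ni: "normalized_inner G T \<iota>"
    and \<phi>: "\<phi> \<in> roots G T" and \<psi>: "\<psi> \<in> characters T"
  shows "2 * (\<iota> \<psi> \<bullet> \<iota> \<phi>) / (\<iota> \<phi> \<bullet> \<iota> \<phi>) \<in> \<int>"
proof -
  have \<phi>c: "\<phi> \<in> characters T" using \<phi> by (simp add: roots_def)
  obtain n where n: "n \<in> normalizer G T" "\<And>t. t \<in> T \<Longrightarrow> \<phi> (transpose n ** t ** n) * \<phi> t = 1"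
    "\<And>\<psi>. \<psi> \<in> characters T \<Longrightarrow> \<exists>k::int. \<forall>t\<in>T. \<psi> (transpose n ** t ** n) = \<psi> t * \<phi> t powi k"
    using weyl_reflection_exists[OF G max \<phi>] by blast
  \<comment> \<open>Characters are normalized to 1 off \<open>T\<close>, so the identities for
    \<open>weyl_act n\<close> hold as equalities of functions only because conjugation by
    \<open>n\<close> also preserves the complement of \<open>T\<close>.\<close>
  have out: "transpose n ** t ** n \<notin> T" if "t \<notin> T" for t
  proof
    assume "transpose n ** t ** n \<in> T"
    then have "n ** (transpose n ** t ** n) ** transpose n \<in> T" using n(1) by (auto simp: normalizer_def)
    moreover have "n ** (transpose n ** t ** n) ** transpose n = (n ** transpose n) ** t ** (n ** transpose n)"
      by (simp add: matrix_mul_assoc)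
    moreover have "n ** transpose n = mat 1"
      using n(1) G by (auto simp: normalizer_def compact_lie_group_def orthogonal_matrix_def)
    ultimately show False using that by simp
  qed
  have off: "\<psi> t = 1" if "\<psi> \<in> characters T" "t \<notin> T" for \<psi> t using that by (simp add: characters_def)
  obtain k :: int where k: "\<And>t. t \<in> T \<Longrightarrow> \<psi> (transpose n ** t ** n) = \<psi> t * \<phi> t powi k"
    using n(3)[OF \<psi>] by blast
  have "weyl_act n \<psi> = (\<lambda>t. \<psi> t * \<phi> t powi k)"
  proof
    show "weyl_act n \<psi> t = \<psi> t * \<phi> t powi k" for t
      using k[of t] off[OF \<psi>] off[OF \<phi>c] out[of t] by (cases "t \<in> T") (simp_all add: weyl_act_def)
  qed
  then have w\<psi>: "\<iota> (weyl_act n \<psi>) = \<iota> \<psi> + of_int k *\<^sub>R \<iota> \<phi>"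
    using real_extension_mult[OF ext \<psi>, of "\<lambda>t. \<phi> t powi k"] character_powi[OF ext \<phi>c, of k] by simp
  have "weyl_act n \<phi> = (\<lambda>t. inverse (\<phi> t))"
  proof
    show "weyl_act n \<phi> t = inverse (\<phi> t)" for t
      using n(2)[of t] off[OF \<phi>c] out[of t] inverse_unique[of "\<phi> t" "weyl_act n \<phi> t"]
      by (cases "t \<in> T") (simp_all add: weyl_act_def mult.commute)
  qed
  then have w\<phi>: "\<iota> (weyl_act n \<phi>) = - \<iota> \<phi>" using character_inverse[OF ext \<phi>c] by simp
  have "\<iota> (weyl_act n \<psi>) \<bullet> \<iota> (weyl_act n \<phi>) = \<iota> \<psi> \<bullet> \<iota> \<phi>"
    using ni n(1) \<psi> \<phi>c by (simp add: normalized_inner_def)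
  then have "2 * (\<iota> \<psi> \<bullet> \<iota> \<phi>) = of_int (- k) * (\<iota> \<phi> \<bullet> \<iota> \<phi>)"
    unfolding w\<psi> w\<phi> by (simp add: inner_add_left)
  \<comment> \<open>If the denominator is 0, the quotient is 0 by the convention for division;
    otherwise it is \<open>- k\<close>.\<close>
  then show ?thesis by (cases "\<iota> \<phi> \<bullet> \<iota> \<phi> = 0") (simp_all add: Ints_minus)
qed

lemma weight_lattice_coordinates:
  fixes G T :: "(real^'n^'n) set" and \<iota> :: "(real^'n^'n \<Rightarrow> complex) \<Rightarrow> 'e::euclidean_space"
  assumes G: "compact_lie_group G" and max: "maximal_torus G T"
    and ext: "real_extension T \<iota>" and ni: "normalized_inner G T \<iota>"
    and g: "linear g" "bij g" "g ` F4_roots = \<iota> ` roots G T" "\<And>x y. g x \<bullet> g y = x \<bullet> y"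
  shows "g ` F4_lattice = \<iota> ` characters T"
proof -
  define L where "L = g -` (\<iota> ` characters T)"
  have "L = F4_lattice"
  proof (rule F4_weight_lattice_eq_root_lattice)
    show "F4_roots \<subseteq> L" using g(3) unfolding L_def roots_def by blast
    obtain B where B: "\<iota> ` characters T = {\<Sum>b\<in>B. real_of_int (c b) *\<^sub>R b | c. True}"
      using ext unfolding real_extension_def by blast
    have "u - v \<in> \<iota> ` characters T" if uv: "u \<in> \<iota> ` characters T" "v \<in> \<iota> ` characters T" for u v
    proof -
      obtain c d where "u = (\<Sum>b\<in>B. real_of_int (c b) *\<^sub>R b)" "v = (\<Sum>b\<in>B. real_of_int (d b) *\<^sub>R b)"
        using uv unfolding B by blast
      then have "u - v = (\<Sum>b\<in>B. real_of_int (c b - d b) *\<^sub>R b)"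
        by (simp add: sum_subtractf[symmetric] algebra_simps)
      then show ?thesis unfolding B by (intro CollectI exI[of _ "\<lambda>b. c b - d b"]) simp
    qed
    then show "x - y \<in> L" if "x \<in> L" "y \<in> L" for x y
      using that by (simp add: L_def linear_diff[OF g(1)])
    show "2 * (x \<bullet> \<alpha>) / (\<alpha> \<bullet> \<alpha>) \<in> \<int>" if x: "x \<in> L" and \<alpha>: "\<alpha> \<in> F4_roots" for x \<alpha>
    proof -
      obtain \<psi> where \<psi>: "g x = \<iota> \<psi>" "\<psi> \<in> characters T" using x by (auto simp: L_def)
      obtain \<phi> where \<phi>: "g \<alpha> = \<iota> \<phi>" "\<phi> \<in> roots G T" using \<alpha> g(3) by blast
      show ?thesis
        using weight_integrality[OF G max ext ni \<phi>(2) \<psi>(2)] unfolding \<phi>(1)[symmetric] \<psi>(1)[symmetric] g(4) .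
    qed
  qed
  then show ?thesis unfolding L_def using g(2) by (metis bij_is_surj surj_image_vimage_eq)
qed

subsection \<open>The alcove in coordinates\<close>

text \<open>The simple roots cut out the chamber and \<open>g (1,1,0,0)\<close> is the highest root,
  so the alcove is an intersection of five closed half-spaces with nonzero normals; its interior is
  obtained by making the inequalities strict.\<close>

lemma interior_alcove_coordinates:
  fixes \<Phi> P :: "'e::euclidean_space set"
  assumes g: "linear g" "bij g" "g ` F4_roots = \<Phi>" "\<And>x y. g x \<bullet> g y = x \<bullet> y"
    and P: "P = {\<alpha> \<in> \<Phi>. g v \<bullet> \<alpha> > 0}" and v: "v \<in> open_chamber"
  shows "interior (alcove \<Phi> P m) = g ` {x \<in> open_chamber. x $ 1 + x $ 2 < real m}"
proof -
  have g0: "g x = 0 \<longleftrightarrow> x = 0" for x using g(4)[of x x] by (metis inner_eq_zero_iff)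
  have gP: "g ` {\<alpha> \<in> F4_roots. v \<bullet> \<alpha> > 0} = P" unfolding P g(3)[symmetric] by (auto simp: g(4))
  have finP: "finite P" unfolding gP[symmetric] using finite_F4_roots by simp
  have simpleP: "g \<alpha> \<in> P" if "\<alpha> \<in> F4_simple" for \<alpha>
    using that F4_simple_roots v unfolding gP[symmetric] open_chamber_iff by (auto simp: inner_commute)
  define \<theta> where "\<theta> = vec4 1 1 0 0"
  have \<theta>: "\<theta> \<in> F4_roots" by (simp add: \<theta>_def int_vec4_F4_roots)
  have \<theta>e: "\<theta> = 2 *\<^sub>R simple1 + 3 *\<^sub>R simple2 + 4 *\<^sub>R simple3 + 2 *\<^sub>R simple4"
    by (simp add: \<theta>_def vec4_eq_iff simple_defs)
  have nonneg: "\<exists>c::'e \<Rightarrow> nat. g \<theta> - \<beta> = (\<Sum>\<alpha>\<in>P. real (c \<alpha>) *\<^sub>R \<alpha>)" if \<beta>: "\<beta> \<in> \<Phi>" for \<beta>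
  proof -
    obtain x where x: "\<beta> = g x" "x \<in> F4_roots" using \<beta> g(3) by blast
    obtain k1 k2 k3 k4 :: int where
      xe: "x = of_int k1 *\<^sub>R simple1 + of_int k2 *\<^sub>R simple2 + of_int k3 *\<^sub>R simple3 + of_int k4 *\<^sub>R simple4"
      and k: "k1 \<le> 2" "k2 \<le> 3" "k3 \<le> 4" "k4 \<le> 2"
      using F4_root_coefficients[OF x(2)] by metis
    \<comment> \<open>A sum of four indicator terms lets the sum over \<open>P\<close> split without
      case distinctions on which simple root is meant.\<close>
    define c where "c \<alpha> = (if \<alpha> = g simple1 then nat (2 - k1) else 0) + (if \<alpha> = g simple2 then nat (3 - k2) else 0)
      + (if \<alpha> = g simple3 then nat (4 - k3) else 0) + (if \<alpha> = g simple4 then nat (2 - k4) else 0)" for \<alpha>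
    have "(\<Sum>\<alpha>\<in>P. real (c \<alpha>) *\<^sub>R \<alpha>) = (\<Sum>\<alpha>\<in>P.
        (if \<alpha> = g simple1 then real (nat (2 - k1)) *\<^sub>R g simple1 else 0) + (if \<alpha> = g simple2 then real (nat (3 - k2)) *\<^sub>R g simple2 else 0)
      + (if \<alpha> = g simple3 then real (nat (4 - k3)) *\<^sub>R g simple3 else 0) + (if \<alpha> = g simple4 then real (nat (2 - k4)) *\<^sub>R g simple4 else 0))"
      unfolding c_def of_nat_add scaleR_add_left
      by (intro sum.cong refl arg_cong2[where f = "(+)"]) auto
    also have "\<dots> = real (nat (2 - k1)) *\<^sub>R g simple1 + real (nat (3 - k2)) *\<^sub>R g simple2
        + real (nat (4 - k3)) *\<^sub>R g simple3 + real (nat (2 - k4)) *\<^sub>R g simple4"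
      using simpleP finP by (simp add: sum.distrib F4_simple_def)
    also have "\<dots> = g ((2 - of_int k1) *\<^sub>R simple1 + (3 - of_int k2) *\<^sub>R simple2 + (4 - of_int k3) *\<^sub>R simple3 + (2 - of_int k4) *\<^sub>R simple4)"
      using k by (simp add: linear_add[OF g(1)] linear_cmul[OF g(1)])
    also have "\<dots> = g (\<theta> - x)" unfolding \<theta>e xe by (simp add: algebra_simps)
    finally show ?thesis unfolding x linear_diff[OF g(1)] by metis
  qed
  have highest: "highest_root \<Phi> P = g \<theta>"
    unfolding highest_root_def
  proof (rule the_equality)
    show "g \<theta> \<in> \<Phi> \<and> (\<forall>\<beta>\<in>\<Phi>. \<exists>c::'e \<Rightarrow> nat. g \<theta> - \<beta> = (\<Sum>\<alpha>\<in>P. real (c \<alpha>) *\<^sub>R \<alpha>))"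
      using nonneg \<theta> g(3) by blast
    fix \<theta>' assume \<theta>': "\<theta>' \<in> \<Phi> \<and> (\<forall>\<beta>\<in>\<Phi>. \<exists>c::'e \<Rightarrow> nat. \<theta>' - \<beta> = (\<Sum>\<alpha>\<in>P. real (c \<alpha>) *\<^sub>R \<alpha>))"
    then obtain c d :: "'e \<Rightarrow> nat" where cd: "\<theta>' - g \<theta> = (\<Sum>\<alpha>\<in>P. real (c \<alpha>) *\<^sub>R \<alpha>)"
      "g \<theta> - \<theta>' = (\<Sum>\<alpha>\<in>P. real (d \<alpha>) *\<^sub>R \<alpha>)"
      using nonneg[of \<theta>'] \<theta> g(3) by blast
    \<comment> \<open>Uniqueness: two candidates differ by non-negative combinations in both
      directions. Pairing the sum of these with \<open>g v\<close>, which is positive on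
      \<open>P\<close>, makes all coefficients vanish.\<close>
    have "0 = g v \<bullet> ((\<theta>' - g \<theta>) + (g \<theta> - \<theta>'))" by simp
    also have "\<dots> = (\<Sum>\<alpha>\<in>P. real (c \<alpha> + d \<alpha>) * (g v \<bullet> \<alpha>))"
      unfolding cd by (simp add: inner_add_right inner_sum_right sum.distrib[symmetric] algebra_simps)
    finally have "(\<Sum>\<alpha>\<in>P. real (c \<alpha> + d \<alpha>) * (g v \<bullet> \<alpha>)) = 0" by simp
    then have "\<forall>\<alpha>\<in>P. real (c \<alpha> + d \<alpha>) * (g v \<bullet> \<alpha>) = 0"
      using finP P by (subst (asm) sum_nonneg_eq_0_iff) auto
    then have "\<forall>\<alpha>\<in>P. c \<alpha> = 0" using P by auto
    then have "\<theta>' - g \<theta> = 0" unfolding cd by simp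
    then show "\<theta>' = g \<theta>" by simp
  qed
  have chamber: "(\<forall>\<alpha>\<in>P. \<alpha> \<bullet> y \<ge> 0) \<longleftrightarrow> (\<forall>\<alpha>\<in>F4_simple. g \<alpha> \<bullet> y \<ge> 0)" for y
  proof
    assume y: "\<forall>\<alpha>\<in>F4_simple. g \<alpha> \<bullet> y \<ge> 0"
    show "\<forall>\<alpha>\<in>P. \<alpha> \<bullet> y \<ge> 0"
    proof
      fix \<beta> assume "\<beta> \<in> P"
      then obtain x where x: "\<beta> = g x" "x \<in> F4_roots" "v \<bullet> x > 0" unfolding gP[symmetric] by blast
      obtain k1 k2 k3 k4 :: int where
        xe: "x = of_int k1 *\<^sub>R simple1 + of_int k2 *\<^sub>R simple2 + of_int k3 *\<^sub>R simple3 + of_int k4 *\<^sub>R simple4"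
        and k: "k1 \<ge> 0 \<and> k2 \<ge> 0 \<and> k3 \<ge> 0 \<and> k4 \<ge> 0 \<or> k1 \<le> 0 \<and> k2 \<le> 0 \<and> k3 \<le> 0 \<and> k4 \<le> 0"
        using F4_root_coefficients[OF x(2)] by metis
      have sv: "v \<bullet> \<alpha> > 0" if "\<alpha> \<in> F4_simple" for \<alpha> using v that by (simp add: open_chamber_iff inner_commute)
      \<comment> \<open>Positivity of \<open>x\<close> on \<open>v\<close> decides between the two
        sign alternatives.\<close>
      have "\<not> (k1 \<le> 0 \<and> k2 \<le> 0 \<and> k3 \<le> 0 \<and> k4 \<le> 0)"
      proof
        assume "k1 \<le> 0 \<and> k2 \<le> 0 \<and> k3 \<le> 0 \<and> k4 \<le> 0"
        then have "of_int k1 * (v \<bullet> simple1) + of_int k2 * (v \<bullet> simple2) + of_int k3 * (v \<bullet> simple3) + of_int k4 * (v \<bullet> simple4) \<le> 0"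
          using sv by (intro add_nonpos_nonpos mult_nonpos_nonneg) (auto simp: F4_simple_def less_imp_le)
        then show False using x(3) unfolding xe by (simp add: inner_add_right)
      qed
      then have k: "k1 \<ge> 0" "k2 \<ge> 0" "k3 \<ge> 0" "k4 \<ge> 0" using k by auto
      have "\<beta> \<bullet> y = of_int k1 * (g simple1 \<bullet> y) + of_int k2 * (g simple2 \<bullet> y) + of_int k3 * (g simple3 \<bullet> y) + of_int k4 * (g simple4 \<bullet> y)"
        unfolding x(1) xe by (simp add: linear_add[OF g(1)] linear_cmul[OF g(1)] inner_add_left)
      also have "\<dots> \<ge> 0" using k y by (intro add_nonneg_nonneg mult_nonneg_nonneg) (auto simp: F4_simple_def)
      finally show "\<beta> \<bullet> y \<ge> 0" .
    qed
  qed (use simpleP in blast)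
  have nz: "g \<alpha> \<noteq> 0" if "\<alpha> \<in> F4_roots" for \<alpha>
    using F4_roots_nonzero[OF that] g0 by auto
  have nzs: "g simple1 \<noteq> 0" "g simple2 \<noteq> 0" "g simple3 \<noteq> 0" "g simple4 \<noteq> 0"
    using nz F4_simple_roots by (auto simp: F4_simple_def)
  have "alcove \<Phi> P m = {y. g simple1 \<bullet> y \<ge> 0} \<inter> {y. g simple2 \<bullet> y \<ge> 0} \<inter> {y. g simple3 \<bullet> y \<ge> 0}
      \<inter> {y. g simple4 \<bullet> y \<ge> 0} \<inter> {y. g \<theta> \<bullet> y \<le> real m}"
    unfolding alcove_def weyl_chamber_def highest chamber by (auto simp: F4_simple_def)
  then have "interior (alcove \<Phi> P m) = {y. g simple1 \<bullet> y > 0} \<inter> {y. g simple2 \<bullet> y > 0} \<inter> {y. g simple3 \<bullet> y > 0}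
      \<inter> {y. g simple4 \<bullet> y > 0} \<inter> {y. g \<theta> \<bullet> y < real m}"
    using nzs nz[OF \<theta>] by simp
  also have "\<dots> = g ` {x \<in> open_chamber. x $ 1 + x $ 2 < real m}"
  proof -
    have "g x \<in> {y. g simple1 \<bullet> y > 0} \<inter> {y. g simple2 \<bullet> y > 0} \<inter> {y. g simple3 \<bullet> y > 0}
      \<inter> {y. g simple4 \<bullet> y > 0} \<inter> {y. g \<theta> \<bullet> y < real m} \<longleftrightarrow> x \<in> open_chamber \<and> x $ 1 + x $ 2 < real m" for x
      by (auto simp: g(4) open_chamber_iff F4_simple_def \<theta>_def inner4)
    then show ?thesis using bij_is_surj[OF g(2)] by (auto simp: image_iff) (metis surj_def)+
  qed
  finally show ?thesis .
qed

text \<open>A symmetry carrying the standard chamber to that of \<open>P\<close> is absorbed into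
  the isometry.\<close>

lemma F4_adapted_coordinates:
  fixes \<Phi> P :: "'e::euclidean_space set"
  assumes "type_F4 \<Phi>" and "\<And>u. u \<in> \<Phi> \<Longrightarrow> (\<And>v. v \<in> \<Phi> \<Longrightarrow> v \<bullet> v \<le> u \<bullet> u) \<Longrightarrow> u \<bullet> u = 2"
    and pos: "positive_system \<Phi> P"
  obtains g :: "real^4 \<Rightarrow> 'e" and v where "linear g" "bij g" "g ` F4_roots = \<Phi>" "\<And>x y. g x \<bullet> g y = x \<bullet> y"
    "P = {\<alpha> \<in> \<Phi>. g v \<bullet> \<alpha> > 0}" "v \<in> open_chamber"
proof -
  obtain g0 :: "real^4 \<Rightarrow> 'e" where g0: "linear g0" "bij g0" "g0 ` F4_roots = \<Phi>" "\<And>x y. g0 x \<bullet> g0 y = x \<bullet> y"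
    using type_F4_isometry[OF assms(1,2)] by blast
  obtain u where u: "\<And>\<alpha>. \<alpha> \<in> \<Phi> \<Longrightarrow> u \<bullet> \<alpha> \<noteq> 0" "P = {\<alpha> \<in> \<Phi>. u \<bullet> \<alpha> > 0}"
    using pos unfolding positive_system_def by blast
  obtain u' where u': "u = g0 u'" using bij_is_surj[OF g0(2)] by blast
  have "u' \<bullet> \<alpha> \<noteq> 0" if "\<alpha> \<in> F4_roots" for \<alpha>
    using u(1)[of "g0 \<alpha>"] that g0(3) unfolding u' g0(4) by blast
  then obtain h where h: "orthogonal_transformation h" "h ` F4_roots = F4_roots"
    "\<And>\<alpha>. \<alpha> \<in> F4_simple \<Longrightarrow> u' \<bullet> h \<alpha> > 0"
    using F4_chamber_transitive by blast
  have bij_h: "bij h" using h(1) by (rule orthogonal_transformation_bij)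
  then obtain v where v: "u' = h v" by (metis bij_pointE)
  show ?thesis
  proof (rule that[of "g0 \<circ> h" v])
    show "linear (g0 \<circ> h)" using linear_compose[OF orthogonal_transformation_linear[OF h(1)] g0(1)] .
    show "bij (g0 \<circ> h)" using bij_comp[OF bij_h g0(2)] .
    show "(g0 \<circ> h) ` F4_roots = \<Phi>" by (simp only: image_comp[symmetric] h(2) g0(3))
    show "(g0 \<circ> h) x \<bullet> (g0 \<circ> h) y = x \<bullet> y" for x y
      using h(1) by (simp add: g0(4) orthogonal_transformation_def)
    show "P = {\<alpha> \<in> \<Phi>. (g0 \<circ> h) v \<bullet> \<alpha> > 0}" using u(2) by (simp add: u' v)
    show "v \<in> open_chamber" unfolding open_chamber_iff
    proof
      fix \<alpha> assume "\<alpha> \<in> F4_simple"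
      from h(3)[OF this] show "\<alpha> \<bullet> v > 0"
        using h(1) by (simp add: v orthogonal_transformation_def inner_commute)
    qed
  qed
qed

subsection \<open>Denominators\<close>

lemma denominator_power_ofD:
  assumes "denominator_power_of p x"
  obtains a :: int and k where "x * real p ^ k = of_int a"
proof -
  obtain r k where r: "x = of_rat r" "snd (quotient_of r) = int p ^ k"
    using assms unfolding denominator_power_of_def by blast
  obtain a b where q: "quotient_of r = (a, b)" by fastforce
  have b: "b = int p ^ k" using r(2) q by simp
  have "b > 0" using quotient_of_denom_pos[OF q] .
  have "r = of_int a / of_int b" using quotient_of_div[OF q] .
  then have "x = of_int a / of_int b" by (simp add: r(1) of_rat_divide)
  then have "x * real p ^ k = of_int a" using \<open>b > 0\<close> by (simp add: b)
  then show ?thesis by (rule that)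
qed

text \<open>The given fraction may be unreduced; the reduced denominator divides
  \<open>p ^ k\<close> and is therefore itself a power of \<open>p\<close>.\<close>

lemma denominator_power_ofI:
  assumes p: "prime p" and x: "x * real p ^ k = of_int a"
  shows "denominator_power_of p x"
proof -
  have p0: "p > 0" using p by (rule prime_gt_0_nat)
  define r :: rat where "r = of_int a / of_int (int p ^ k)"
  have xr: "x = of_rat r" using x p0 by (simp add: r_def of_rat_divide of_rat_power field_simps)
  obtain n d where q: "quotient_of r = (n, d)" by fastforce
  have "d > 0" using quotient_of_denom_pos[OF q] .
  have "r = of_int n / of_int d" using quotient_of_div[OF q] .
  then have "(of_int (n * int p ^ k) :: rat) = of_int (a * d)"
    using \<open>d > 0\<close> p0 by (simp add: r_def field_simps)
  then have "n * int p ^ k = a * d" by linarith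
  then have "d dvd n * int p ^ k" by simp
  then have "d dvd int p ^ k"
    using quotient_of_coprime[OF q] by (metis coprime_commute coprime_dvd_mult_right_iff)
  moreover have "prime (int p)" using p by simp
  ultimately obtain j where "normalize d = int p ^ j" using divides_primepow by blast
  then have "snd (quotient_of r) = int p ^ j" using q \<open>d > 0\<close> by simp
  then show ?thesis unfolding denominator_power_of_def using xr by blast
qed

text \<open>The factor \<open>c\<close> (1 or 2 in the applications) makes \<open>c * s\<close> an
  integer. The hypothesis gives that \<open>m'\<close> divides this integer times a power of
  \<open>p\<close>, and \<open>m'\<close> is coprime to \<open>p\<close>.\<close>

lemma div_in_Ints_if_denominator_power_of:
  assumes p: "prime p" and m: "m = p ^ i * m'" "\<not> p dvd m'" "m > 0"
    and den: "denominator_power_of p (s / real m)" and z: "of_int c * s \<in> \<int>"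
  shows "of_int c * s / real m' \<in> \<int>"
proof -
  obtain z :: int where z: "of_int c * s = of_int z" using z by (auto elim: Ints_cases)
  obtain a :: int and k where "s / real m * real p ^ k = of_int a"
    using denominator_power_ofD[OF den] by blast
  then have "s * real p ^ k = of_int a * real m" using m(3) by (simp add: field_simps)
  then have "of_int c * s * real p ^ k = of_int c * of_int a * real m" by simp
  then have "of_int (z * int p ^ k) = (of_int (c * a * (int p ^ i * int m')) :: real)"
    unfolding z by (simp add: m(1))
  then have "z * int p ^ k = c * a * (int p ^ i * int m')" by linarith
  then have "int m' dvd z * int p ^ k" by simp
  moreover have "coprime (int m') (int p ^ k)"
    using p m(2) by (metis coprime_commute coprime_int_iff coprime_power_left_iff coprime_power_right_iff of_nat_power prime_imp_coprime)
  ultimately have "int m' dvd z" by (metis coprime_dvd_mult_left_iff)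
  then obtain q where "z = int m' * q" by blast
  moreover have "m' > 0" using m by (cases m') auto
  ultimately have "of_int c * s / real m' = of_int q" by (simp add: z)
  then show ?thesis by simp
qed

text \<open>An odd power of \<open>p\<close> cannot clear a denominator 2. This is where odd primes
  part from 2.\<close>

lemma half_integer_in_Ints_if_denominator_odd:
  assumes p: "prime p" "p > 2" and m: "m = p ^ i * m'" "m > 0"
    and den: "denominator_power_of p (s / real m)" and z: "2 * s \<in> \<int>"
  shows "s \<in> \<int>"
proof -
  obtain z :: int where z: "2 * s = of_int z" using z by (auto elim: Ints_cases)
  obtain a :: int and k where "s / real m * real p ^ k = of_int a"
    using denominator_power_ofD[OF den] by blast
  then have "s * real p ^ k = of_int a * real m" using m(2) by (simp add: field_simps)
  then have "2 * s * real p ^ k = 2 * of_int a * real m" by simp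
  then have "of_int (z * int p ^ k) = (of_int (2 * (a * int m)) :: real)"
    unfolding z by simp
  then have "z * int p ^ k = 2 * (a * int m)" by linarith
  then have "even (z * int p ^ k)" by simp
  moreover have "odd p" using p prime_odd_nat by blast
  ultimately have "even z" by simp
  then obtain q where "z = 2 * q" by blast
  then have "s = of_int q" using z by simp
  then show ?thesis by simp
qed

subsection \<open>Counting\<close>

definition alcove_weights :: "nat \<Rightarrow> nat \<Rightarrow> (real^4) set" where
  "alcove_weights m p = {x \<in> F4_lattice \<inter> open_chamber. x $ 1 + x $ 2 < real m \<and>
     (\<forall>w\<in>F4_lattice. denominator_power_of p ((w \<bullet> x) / real m))}"

lemma weight_count_eq_card_alcove_weights:
  fixes G T :: "(real^'n^'n) set" and \<iota> :: "(real^'n^'n \<Rightarrow> complex) \<Rightarrow> 'e::euclidean_space"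
  assumes G: "compact_lie_group G" and max: "maximal_torus G T"
    and ext: "real_extension T \<iota>" and ni: "normalized_inner G T \<iota>"
    and F4: "type_F4 (\<iota> ` roots G T)" and P: "positive_system (\<iota> ` roots G T) P"
  shows "weight_count G T \<iota> P m p = card (alcove_weights m p)"
proof -
  have long: "u \<bullet> u = 2" if u: "u \<in> \<iota> ` roots G T" and le: "\<And>v. v \<in> \<iota> ` roots G T \<Longrightarrow> v \<bullet> v \<le> u \<bullet> u" for u
  proof -
    obtain \<phi> where \<phi>: "u = \<iota> \<phi>" "\<phi> \<in> roots G T" using u by blast
    have "\<iota> v \<bullet> \<iota> v \<le> \<iota> \<phi> \<bullet> \<iota> \<phi>" if "v \<in> roots G T" for v using le that unfolding \<phi>(1) by blast
    then show ?thesis using ni \<phi>(2) unfolding normalized_inner_def \<phi>(1) by blast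
  qed
  obtain g :: "real^4 \<Rightarrow> 'e" and v where g: "linear g" "bij g" "g ` F4_roots = \<iota> ` roots G T" "\<And>x y. g x \<bullet> g y = x \<bullet> y"
    and v: "P = {\<alpha> \<in> \<iota> ` roots G T. g v \<bullet> \<alpha> > 0}" "v \<in> open_chamber"
    by (rule F4_adapted_coordinates[OF F4 _ P]; (rule that | rule long); assumption)
  have inj: "inj g" using g(2) by (rule bij_is_inj)
  have chars: "\<iota> ` characters T = g ` F4_lattice"
    using weight_lattice_coordinates[OF G max ext ni g] by simp
  have "{a \<in> regular_weights G T \<iota> P m. \<forall>w\<in>\<iota> ` characters T. denominator_power_of p ((w \<bullet> a) / real m)}
      = g ` alcove_weights m p"
    unfolding regular_weights_def interior_alcove_coordinates[OF g v] chars image_Int[OF inj, symmetric]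
    by (auto simp: g(4) alcove_weights_def)
  then show ?thesis unfolding weight_count_def using inj by (simp add: card_image inj_on_subset)
qed

section \<open>Scaling by m' and the two lattices\<close>

lemma open_chamber_scale:
  assumes "c > 0" shows "c *\<^sub>R x \<in> open_chamber \<longleftrightarrow> x \<in> open_chamber"
  using assms by (simp add: open_chamber_iff zero_less_mult_iff)

lemma F4_lattice_scale: "x \<in> F4_lattice \<Longrightarrow> real n *\<^sub>R x \<in> F4_lattice"
proof -
  assume "x \<in> F4_lattice"
  then have "real n * (2 * x$1) \<in> \<int>" "real n * (x$2 - x$1) \<in> \<int>" "real n * (x$3 - x$1) \<in> \<int>" "real n * (x$4 - x$1) \<in> \<int>"
    unfolding F4_lattice_def by (auto intro: Ints_mult)
  then show ?thesis by (simp add: F4_lattice_def algebra_simps)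
qed

text \<open>The lattice spanned by the long roots, that is, the root lattice of type $D_4$.\<close>

definition F4_dual_lattice :: "(real^4) set" where
  "F4_dual_lattice = {vec4 (of_int a) (of_int b) (of_int c) (of_int d) | a b c d :: int. even (a + b + c + d)}"

lemma F4_dual_lattice_inner:
  assumes "w \<in> F4_lattice" "y \<in> F4_dual_lattice" shows "w \<bullet> y \<in> \<int>"
proof -
  obtain a b c d :: int where y: "y = vec4 a b c d" "even (a + b + c + d)"
    using assms(2) unfolding F4_dual_lattice_def by blast
  from assms(1) show ?thesis
  proof (cases rule: F4_lattice_cases)
    case (1 a' b' c' d')
    then show ?thesis by (simp add: y inner4 Ints_mult)
  next
    case (2 a' b' c' d')
    obtain q where q: "a + b + c + d = 2 * q" using y(2) by blast
    have "w \<bullet> y = of_int (a' * a + b' * b + c' * c + d' * d) + of_int (a + b + c + d) / 2"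
      by (simp add: 2 y inner4 field_simps)
    also have "\<dots> = of_int (a' * a + b' * b + c' * c + d' * d + q)" unfolding q by simp
    finally show ?thesis by (metis Ints_of_int)
  qed
qed

lemma F4_dual_lattice_subset: "F4_dual_lattice \<subseteq> F4_lattice"
  unfolding F4_dual_lattice_def using vec4_int_in_F4_lattice by blast

lemma double_in_F4_dual_lattice:
  assumes "x \<in> F4_lattice" shows "2 *\<^sub>R x \<in> F4_dual_lattice"
  using assms
proof (cases rule: F4_lattice_cases)
  case (1 a b c d)
  then have "2 *\<^sub>R x = vec4 (of_int (2 * a)) (of_int (2 * b)) (of_int (2 * c)) (of_int (2 * d))"
    by (simp add: vec4_eq_iff)
  moreover have "even (2 * a + 2 * b + 2 * c + 2 * d)" by simp
  ultimately show ?thesis unfolding F4_dual_lattice_def by blast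
next
  case (2 a b c d)
  then have "2 *\<^sub>R x = vec4 (of_int (2 * a + 1)) (of_int (2 * b + 1)) (of_int (2 * c + 1)) (of_int (2 * d + 1))"
    by (simp add: vec4_eq_iff)
  moreover have "even ((2 * a + 1) + (2 * b + 1) + (2 * c + 1) + (2 * d + 1))" by simp
  ultimately show ?thesis unfolding F4_dual_lattice_def by blast
qed

lemma inner_F4_lattice: "w \<in> F4_lattice \<Longrightarrow> x \<in> F4_lattice \<Longrightarrow> 2 * (w \<bullet> x) \<in> \<int>"
  using F4_dual_lattice_inner[OF _ double_in_F4_dual_lattice, of w x] by simp

text \<open>Multiplication by \<open>m'\<close> maps the points of \<open>D\<close> in the alcove of
  level \<open>p ^ i\<close> onto the weights of level \<open>m\<close>. \<open>into\<close> and
  \<open>den\<close> are the two inclusions; \<open>D\<close> is \<open>F4_lattice\<close> for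
  \<open>p = 2\<close> and its dual for odd \<open>p\<close>.\<close>

lemma card_alcove_weights_scale:
  assumes m: "m = p ^ i * m'" "m > 0"
    and sub: "D \<subseteq> F4_lattice"
    and into: "\<And>x. x \<in> alcove_weights m p \<Longrightarrow> (1 / real m') *\<^sub>R x \<in> D"
    and den: "\<And>w y. w \<in> F4_lattice \<Longrightarrow> y \<in> D \<Longrightarrow> denominator_power_of p ((w \<bullet> y) / real p ^ i)"
  shows "card (alcove_weights m p) = card {y \<in> D \<inter> open_chamber. y $ 1 + y $ 2 < real p ^ i}"
proof -
  have m': "real m' > 0" using m by (cases m') auto
  \<comment> \<open>With \<open>p = 0\<close>, positivity of \<open>m\<close> forces
    \<open>i = 0\<close>, and then \<open>p ^ i = 1\<close>.\<close>
  have pi: "real p ^ i > 0" using m by (cases "p = 0"; cases i) auto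
  let ?S = "{y \<in> D \<inter> open_chamber. y $ 1 + y $ 2 < real p ^ i}"
  have "alcove_weights m p = (\<lambda>y. real m' *\<^sub>R y) ` ?S"
  proof (intro equalityI subsetI)
    fix x assume x: "x \<in> alcove_weights m p"
    define y where "y = (1 / real m') *\<^sub>R x"
    have xy: "x = real m' *\<^sub>R y" using m' by (simp add: y_def)
    have "x \<in> open_chamber" "x $ 1 + x $ 2 < real m" using x by (auto simp: alcove_weights_def)
    then have "y \<in> open_chamber" "real m' * (y $ 1 + y $ 2) < real m' * real p ^ i"
      unfolding xy open_chamber_scale[OF m'] by (auto simp: m(1) algebra_simps)
    then have "y \<in> ?S" using into[OF x] m' by (simp add: y_def[symmetric])
    then show "x \<in> (\<lambda>y. real m' *\<^sub>R y) ` ?S" using xy by blast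
  next
    fix x assume "x \<in> (\<lambda>y. real m' *\<^sub>R y) ` ?S"
    then obtain y where x: "x = real m' *\<^sub>R y" and y: "y \<in> D" "y \<in> open_chamber" "y $ 1 + y $ 2 < real p ^ i" by blast
    have "(w \<bullet> x) / real m = (w \<bullet> y) / real p ^ i" for w using m' by (simp add: x m(1))
    moreover have "real m' * (y $ 1 + y $ 2) < real m' * real p ^ i" using y(3) m' by simp
    ultimately show "x \<in> alcove_weights m p"
      unfolding alcove_weights_def using y den sub F4_lattice_scale[of y m'] open_chamber_scale[OF m', of y]
      by (auto simp: x m(1) algebra_simps)
  qed
  moreover have "inj_on (\<lambda>y. real m' *\<^sub>R y) ?S" using m' by (simp add: inj_on_def)
  ultimately show ?thesis by (simp add: card_image)
qed

lemma card_alcove_weights_2: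
  assumes m: "m = 2 ^ i * m'" "m > 0" "odd m'"
  shows "card (alcove_weights m 2) = card {y \<in> F4_lattice \<inter> open_chamber. y $ 1 + y $ 2 < real 2 ^ i}"
proof (rule card_alcove_weights_scale)
  show "m = 2 ^ i * m'" "m > 0" using m by auto
  show "(1 / real m') *\<^sub>R x \<in> F4_lattice" if x: "x \<in> alcove_weights m 2" for x
  proof -
    have L: "x \<in> F4_lattice" and den: "\<And>w. w \<in> F4_lattice \<Longrightarrow> denominator_power_of 2 ((w \<bullet> x) / real m)"
      using x by (auto simp: alcove_weights_def)
    have int: "of_int c * (w \<bullet> x) / real m' \<in> \<int>" if "w \<in> F4_lattice" "of_int c * (w \<bullet> x) \<in> \<int>" for w and c :: int
      by (rule div_in_Ints_if_denominator_power_of[OF two_is_prime_nat m(1) _ m(2) den[OF that(1)] that(2)])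
        (use m in simp)
    \<comment> \<open>Pairing with these vectors yields the quantities in the definition of
      \<open>F4_lattice\<close>; the first one has to be doubled, whence the factor 2 for
      \<open>w(1)\<close>.\<close>
    have w: "vec4 1 0 0 0 \<in> F4_lattice" "vec4 (-1) 1 0 0 \<in> F4_lattice" "vec4 (-1) 0 1 0 \<in> F4_lattice" "vec4 (-1) 0 0 1 \<in> F4_lattice"
      by (simp_all add: F4_lattice_def)
    show ?thesis
      using L int[OF w(1), of 2] int[OF w(2), of 1] int[OF w(3), of 1] int[OF w(4), of 1]
      by (simp add: F4_lattice_def inner4 diff_divide_distrib)
  qed
  show "denominator_power_of 2 ((w \<bullet> y) / real 2 ^ i)" if "w \<in> F4_lattice" "y \<in> F4_lattice" for w y
  proof -
    have "2 * (w \<bullet> y) \<in> \<int>" using that by (rule inner_F4_lattice)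
    then obtain z :: int where "2 * (w \<bullet> y) = z" by (auto elim: Ints_cases)
    \<comment> \<open>The extra factor 2 in \<open>Suc i\<close> absorbs a half-integral
      pairing.\<close>
    then have "(w \<bullet> y) / real 2 ^ i * real 2 ^ Suc i = z" by simp
    then show ?thesis by (rule denominator_power_ofI[OF two_is_prime_nat])
  qed
qed simp

lemma card_alcove_weights_odd:
  assumes p: "prime p" "p > 2" and m: "m = p ^ i * m'" "m > 0" "\<not> p dvd m'"
  shows "card (alcove_weights m p) = card {y \<in> F4_dual_lattice \<inter> open_chamber. y $ 1 + y $ 2 < real p ^ i}"
proof (rule card_alcove_weights_scale[OF m(1,2) F4_dual_lattice_subset])
  show "(1 / real m') *\<^sub>R x \<in> F4_dual_lattice" if x: "x \<in> alcove_weights m p" for x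
  proof -
    have L: "x \<in> F4_lattice" and den: "\<And>w. w \<in> F4_lattice \<Longrightarrow> denominator_power_of p ((w \<bullet> x) / real m)"
      using x by (auto simp: alcove_weights_def)
    have int: "(w \<bullet> x) / real m' \<in> \<int>" if w: "w \<in> F4_lattice" for w
    proof -
      have "w \<bullet> x \<in> \<int>"
        by (rule half_integer_in_Ints_if_denominator_odd[OF p m(1,2) den[OF w] inner_F4_lattice[OF w L]])
      then show ?thesis
        using div_in_Ints_if_denominator_power_of[OF p(1) m(1,3,2) den[OF w], of 1] by simp
    qed
    \<comment> \<open>The unit vectors make the coordinates of the quotient integral; the half
      vector makes their sum even.\<close>
    have w: "vec4 1 0 0 0 \<in> F4_lattice" "vec4 0 1 0 0 \<in> F4_lattice" "vec4 0 0 1 0 \<in> F4_lattice" "vec4 0 0 0 1 \<in> F4_lattice"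
      "vec4 (1/2) (1/2) (1/2) (1/2) \<in> F4_lattice"
      by (simp_all add: F4_lattice_def)
    have "x $ 1 / real m' \<in> \<int>" "x $ 2 / real m' \<in> \<int>" "x $ 3 / real m' \<in> \<int>" "x $ 4 / real m' \<in> \<int>"
      using w(1-4)[THEN int] by (simp_all add: inner4)
    then obtain a b c d :: int where abcd: "x $ 1 / real m' = a" "x $ 2 / real m' = b" "x $ 3 / real m' = c" "x $ 4 / real m' = d"
      by (auto elim!: Ints_cases)
    have "(of_int (a + b + c + d) / 2 :: real) \<in> \<int>"
      using int[OF w(5)] by (simp add: inner4 abcd[symmetric] add_divide_distrib mult.commute)
    then obtain q :: int where "of_int (a + b + c + d) / 2 = (of_int q :: real)" by (auto elim: Ints_cases)
    then have "of_int (a + b + c + d) = (of_int (2 * q) :: real)" by simp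
    then have "a + b + c + d = 2 * q" by linarith
    then have "even (a + b + c + d)" by simp
    moreover have "(1 / real m') *\<^sub>R x = vec4 (of_int a) (of_int b) (of_int c) (of_int d)"
      by (simp add: vec4_eq_iff abcd[symmetric])
    ultimately show ?thesis unfolding F4_dual_lattice_def by blast
  qed
  show "denominator_power_of p ((w \<bullet> y) / real p ^ i)" if "w \<in> F4_lattice" "y \<in> F4_dual_lattice" for w y
  proof -
    have "w \<bullet> y \<in> \<int>" using that by (rule F4_dual_lattice_inner)
    then obtain z :: int where "w \<bullet> y = z" by (auto elim: Ints_cases)
    then have "(w \<bullet> y) / real p ^ i * real p ^ i = z" using p by simp
    then show ?thesis by (rule denominator_power_ofI[OF p(1)])
  qed
qed

lemma F4_lattice_tuple_iff:
  "vec4 a b c d \<in> F4_lattice \<longleftrightarrow> {a, b, c, d} \<subseteq> \<int> \<or> {a, b, c, d} \<subseteq> (\<lambda>x. x + 1/2) ` \<int>"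
proof
  assume "vec4 a b c d \<in> F4_lattice"
  then show "{a, b, c, d} \<subseteq> \<int> \<or> {a, b, c, d} \<subseteq> (\<lambda>x. x + 1/2) ` \<int>"
    by (cases rule: F4_lattice_cases) (auto simp: vec4_eq_iff)
next
  assume "{a, b, c, d} \<subseteq> \<int> \<or> {a, b, c, d} \<subseteq> (\<lambda>x. x + 1/2) ` \<int>"
  then show "vec4 a b c d \<in> F4_lattice"
    by (auto elim!: Ints_cases simp: vec4_int_in_F4_lattice vec4_half_in_F4_lattice)
qed

text \<open>Serves both counts: \<open>f\<close> is the identity for real tuples and
  \<open>real_of_int\<close> for integer ones.\<close>

lemma card_vec4_image:
  fixes f :: "'a \<Rightarrow> real"
  assumes "inj f" and "S = (\<lambda>(a, b, c, d). vec4 (f a) (f b) (f c) (f d)) ` A"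
  shows "card S = card A"
  unfolding assms(2)
proof (rule card_image)
  show "inj_on (\<lambda>(a, b, c, d). vec4 (f a) (f b) (f c) (f d)) A"
    using assms(1) by (auto simp: inj_on_def vec4_eq_iff dest: injD)
qed

theorem mainTheorem7:
  fixes G T :: "(real^'n^'n) set"
    and \<iota> :: "(real^'n^'n \<Rightarrow> complex) \<Rightarrow> 'e::euclidean_space"
    and P :: "'e set"
    and m p i m' :: nat
  assumes "compact_lie_group G" and "simple_lie_group G" and "simply_connected G"
    and "maximal_torus G T"
    and "real_extension T \<iota>" and "normalized_inner G T \<iota>"
    and "type_F4 (\<iota> ` roots G T)"
    and "positive_system (\<iota> ` roots G T) P"
    and "m > 0" and "prime p"
    and "m = p ^ i * m'" and "\<not> p dvd m'"
  shows "(p = 2 \<longrightarrow>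
            weight_count G T \<iota> P m 2 =
            card {(b1 :: real, b2 :: real, b3 :: real, b4 :: real).
                    ({b1, b2, b3, b4} \<subseteq> \<int> \<or> {b1, b2, b3, b4} \<subseteq> (\<lambda>x. x + 1/2) ` \<int>) \<and>
                    b2 > b3 \<and> b3 > b4 \<and> b4 > 0 \<and> b1 > b2 + b3 + b4 \<and>
                    real p ^ i > b1 + b2})
       \<and> (p > 2 \<longrightarrow>
            weight_count G T \<iota> P m p =
            card {(b1 :: int, b2 :: int, b3 :: int, b4 :: int).
                    b2 > b3 \<and> b3 > b4 \<and> b4 > 0 \<and> b1 > b2 + b3 + b4 \<and>
                    int p ^ i > b1 + b2 \<and> 2 dvd (b1 + b2 + b3 + b4)})"
proof (intro conjI impI)
  note count = weight_count_eq_card_alcove_weights[OF assms(1,4-8)]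
  show "weight_count G T \<iota> P m 2 =
      card {(b1 :: real, b2 :: real, b3 :: real, b4 :: real).
        ({b1, b2, b3, b4} \<subseteq> \<int> \<or> {b1, b2, b3, b4} \<subseteq> (\<lambda>x. x + 1/2) ` \<int>) \<and>
        b2 > b3 \<and> b3 > b4 \<and> b4 > 0 \<and> b1 > b2 + b3 + b4 \<and> real p ^ i > b1 + b2}"
    (is "_ = card ?A") if "p = 2"
  proof -
    have "weight_count G T \<iota> P m 2 = card {y \<in> F4_lattice \<inter> open_chamber. y $ 1 + y $ 2 < real 2 ^ i}"
      unfolding count using assms(9,11,12) \<open>p = 2\<close> by (intro card_alcove_weights_2) auto
    also have "\<dots> = card ?A"
    proof (rule card_vec4_image[of "\<lambda>x. x"])
      show "{y \<in> F4_lattice \<inter> open_chamber. y $ 1 + y $ 2 < real 2 ^ i} = (\<lambda>(a, b, c, d). vec4 a b c d) ` ?A"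
      proof (intro equalityI subsetI)
        fix y assume y: "y \<in> {y \<in> F4_lattice \<inter> open_chamber. y $ 1 + y $ 2 < real 2 ^ i}"
        have e: "y = vec4 (y$1) (y$2) (y$3) (y$4)" by (simp add: vec4_eq_iff)
        have "(y$1, y$2, y$3, y$4) \<in> ?A"
          using y F4_lattice_tuple_iff[of "y$1" "y$2" "y$3" "y$4"] unfolding e[symmetric]
          by (simp add: open_chamber_def \<open>p = 2\<close>)
        then show "y \<in> (\<lambda>(a, b, c, d). vec4 a b c d) ` ?A"
          by (rule image_eqI[rotated]) (simp add: e[symmetric])
      next
        fix y assume "y \<in> (\<lambda>(a, b, c, d). vec4 a b c d) ` ?A"
        then show "y \<in> {y \<in> F4_lattice \<inter> open_chamber. y $ 1 + y $ 2 < real 2 ^ i}"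
          using F4_lattice_tuple_iff by (auto simp: open_chamber_def \<open>p = 2\<close>)
      qed
    qed simp
    finally show ?thesis .
  qed
  show "weight_count G T \<iota> P m p =
      card {(b1 :: int, b2 :: int, b3 :: int, b4 :: int).
        b2 > b3 \<and> b3 > b4 \<and> b4 > 0 \<and> b1 > b2 + b3 + b4 \<and>
        int p ^ i > b1 + b2 \<and> 2 dvd (b1 + b2 + b3 + b4)}"
    (is "_ = card ?B") if "p > 2"
  proof -
    have pw: "real_of_int (a + b) < real p ^ i \<longleftrightarrow> a + b < int p ^ i" for a b
      by (metis of_int_less_iff of_int_of_nat_eq of_int_power)
    have "weight_count G T \<iota> P m p = card {y \<in> F4_dual_lattice \<inter> open_chamber. y $ 1 + y $ 2 < real p ^ i}"
      unfolding count using assms(9-12) \<open>p > 2\<close> by (intro card_alcove_weights_odd) auto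
    also have "\<dots> = card ?B"
    proof (rule card_vec4_image[of real_of_int])
      have mem: "vec4 (real_of_int a) (real_of_int b) (real_of_int c) (real_of_int d) \<in> open_chamber
          \<longleftrightarrow> b > c \<and> c > d \<and> d > 0 \<and> a > b + c + d" for a b c d
        unfolding open_chamber_def vec4_nth mem_Collect_eq of_int_add[symmetric] of_int_less_iff of_int_0_less_iff
        by (rule refl)
      show "{y \<in> F4_dual_lattice \<inter> open_chamber. y $ 1 + y $ 2 < real p ^ i} =
          (\<lambda>(a, b, c, d). vec4 (real_of_int a) (real_of_int b) (real_of_int c) (real_of_int d)) ` ?B"
      proof (intro equalityI subsetI)
        fix y assume y: "y \<in> {y \<in> F4_dual_lattice \<inter> open_chamber. y $ 1 + y $ 2 < real p ^ i}"
        then obtain a b c d :: int where abcd: "y = vec4 (of_int a) (of_int b) (of_int c) (of_int d)" "even (a + b + c + d)"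
          unfolding F4_dual_lattice_def by blast
        have "(a, b, c, d) \<in> ?B" using y abcd(2) pw[of a b] by (simp add: abcd(1) mem)
        then show "y \<in> (\<lambda>(a, b, c, d). vec4 (real_of_int a) (real_of_int b) (real_of_int c) (real_of_int d)) ` ?B"
          by (rule image_eqI[rotated]) (simp add: abcd(1))
      next
        fix y assume "y \<in> (\<lambda>(a, b, c, d). vec4 (real_of_int a) (real_of_int b) (real_of_int c) (real_of_int d)) ` ?B"
        then obtain a b c d where abcd: "y = vec4 (of_int a) (of_int b) (of_int c) (of_int d)" "(a, b, c, d) \<in> ?B" by auto
        then show "y \<in> {y \<in> F4_dual_lattice \<inter> open_chamber. y $ 1 + y $ 2 < real p ^ i}"
          using pw[of a b] by (auto simp: mem F4_dual_lattice_def)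
      qed
    qed (simp add: inj_def)
    finally show ?thesis .
  qed
qed

end
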